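(* Let $(M,g)$ be a closed smooth (connected) Riemannian manifold and let $p\in[1,\infty]$. There exist positive constants $r_p=r_p(M,g)$ and $c=c(p,M,g)$, both independent of $\lambda$ and of the eigenfunction, such that for every eigenvalue $\lambda>0$ of $-\Delta$, every eigenfunction $\varphi_\lambda$ with $-\Delta\varphi_\lambda=\lambda\varphi_\lambda$, and every $\delta$ with $0<\delta\le r_p\lambda^{-1/2}$, $$\|\varphi_\lambda\|_{L^p(M\setminus T_\delta)}\ \ge\ c\,\|\varphi_\lambda\|_{L^p(M)}.$$
   Context: $\Delta$ is the Laplace–Beltrami operator of $(M,g)$ with the analyst's sign convention, so $-\Delta$ is positive semidefinite, with discrete spectrum $0=\lambda_1<\lambda_2\le\lambda_3\le\dots\nearrow\infty$. Eigenfunctions are real-valued and not identically zero. $N_{\varphi_\lambda}=\{x\in M:\varphi_\lambda(x)=0\}$ is the nodal set, and $T_\delta=\{x\in M:\operatorname{dist}(x,N_{\varphi_\lambda})<\delta\}$ is the metric tubular neighbourhood of width $\delta$ around $N_{\varphi_\lambda}$. $L^p$ norms are taken with respect to the Riemannian volume. *)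

theory Defs
  imports "HOL-Analysis.Analysis" "HOL-Probability.Essential_Supremum"
begin

section \<open>Smooth functions and charts\<close>

text \<open>The functions below are only meaningful on open sets: all derivatives are two-sided.\<close>

primrec C_on :: "nat \<Rightarrow> 'a::real_normed_vector set \<Rightarrow> ('a \<Rightarrow> 'b::real_normed_vector) \<Rightarrow> bool" where
  "C_on 0 S f \<longleftrightarrow> continuous_on S f"
| "C_on (Suc k) S f \<longleftrightarrow> (\<forall>x\<in>S. f differentiable (at x)) \<and>
     (\<forall>v. C_on k S (\<lambda>x. frechet_derivative f (at x) v))"

definition smooth_on :: "'a::real_normed_vector set \<Rightarrow> ('a \<Rightarrow> 'b::real_normed_vector) \<Rightarrow> bool" where
  "smooth_on S f \<longleftrightarrow> (\<forall>k. C_on k S f)"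

definition partial :: "'n::finite \<Rightarrow> (real^'n \<Rightarrow> real) \<Rightarrow> real^'n \<Rightarrow> real" where
  "partial i f x = frechet_derivative f (at x) (axis i 1)"

text \<open>A chart is its domain together with its coordinate map, whose values outside the domain are
  irrelevant.\<close>

type_synonym ('m, 'n) chart = "'m set \<times> ('m \<Rightarrow> real^'n)"

abbreviation chart_dom :: "('m, 'n::finite) chart \<Rightarrow> 'm set" where
  "chart_dom \<equiv> fst"

abbreviation chart_map :: "('m, 'n::finite) chart \<Rightarrow> 'm \<Rightarrow> real^'n" where
  "chart_map \<equiv> snd"

abbreviation chart_ran :: "('m, 'n::finite) chart \<Rightarrow> (real^'n) set" where
  "chart_ran c \<equiv> chart_map c ` chart_dom c"

abbreviation chart_inv :: "('m, 'n::finite) chart \<Rightarrow> real^'n \<Rightarrow> 'm" where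
  "chart_inv c \<equiv> inv_into (chart_dom c) (chart_map c)"

definition smooth_atlas :: "'m::t2_space set \<Rightarrow> ('m, 'n::finite) chart set \<Rightarrow> bool" where
  "smooth_atlas M A \<longleftrightarrow>
     (\<Union>c\<in>A. chart_dom c) = M \<and>
     (\<forall>c\<in>A. openin (top_of_set M) (chart_dom c) \<and> open (chart_ran c) \<and>
            homeomorphism (chart_dom c) (chart_ran c) (chart_map c) (chart_inv c)) \<and>
     (\<forall>c\<in>A. \<forall>d\<in>A. smooth_on (chart_map c ` (chart_dom c \<inter> chart_dom d))
                              (chart_map d \<circ> chart_inv c))"

section \<open>Riemannian metrics\<close>

text \<open>The matrix \<open>g c x\<close> is the Gram matrix of the metric in the coordinates of the chart \<open>c\<close>, at the
  point with coordinates \<open>x\<close>.\<close>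

type_synonym ('m, 'n) metric_coeffs = "('m, 'n) chart \<Rightarrow> real^'n \<Rightarrow> real^'n^'n"

definition riemannian_metric ::
    "('m::t2_space, 'n::finite) chart set \<Rightarrow> ('m, 'n) metric_coeffs \<Rightarrow> bool" where
  "riemannian_metric A g \<longleftrightarrow>
     (\<forall>c\<in>A. smooth_on (chart_ran c) (g c)) \<and>
     (\<forall>c\<in>A. \<forall>x\<in>chart_ran c. transpose (g c x) = g c x \<and> (\<forall>v. v \<noteq> 0 \<longrightarrow> 0 < v \<bullet> (g c x *v v))) \<and>
     (\<forall>c\<in>A. \<forall>d\<in>A. \<forall>x\<in>chart_map c ` (chart_dom c \<inter> chart_dom d).
        let T = chart_map d \<circ> chart_inv c; J = matrix (frechet_derivative T (at x))
        in g c x = transpose J ** g d (T x) ** J)"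

text \<open>Second countability need not be demanded: a compact space with an atlas has it.\<close>

definition closed_riemannian_manifold ::
    "'m::t2_space set \<Rightarrow> ('m, 'n::finite) chart set \<Rightarrow> ('m, 'n) metric_coeffs \<Rightarrow> bool" where
  "closed_riemannian_manifold M A g \<longleftrightarrow>
     M \<noteq> {} \<and> compact M \<and> connected M \<and> smooth_atlas M A \<and> riemannian_metric A g"

section \<open>Riemannian distance\<close>

definition piecewise_C1_curve ::
    "'m::t2_space set \<Rightarrow> ('m, 'n::finite) chart set \<Rightarrow> (real \<Rightarrow> 'm) \<Rightarrow> bool" where
  "piecewise_C1_curve M A \<gamma> \<longleftrightarrow> path \<gamma> \<and> path_image \<gamma> \<subseteq> M \<and>
     (\<forall>c\<in>A. (chart_map c \<circ> \<gamma>) piecewise_C1_differentiable_on {t\<in>{0..1}. \<gamma> t \<in> chart_dom c})"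

text \<open>Where \<open>\<gamma>\<close> is differentiable, all charts around \<open>\<gamma> t\<close> give the same value, so that the supremum
  is merely a way not to choose a chart.\<close>

definition speed ::
    "('m, 'n::finite) chart set \<Rightarrow> ('m, 'n) metric_coeffs \<Rightarrow> (real \<Rightarrow> 'm) \<Rightarrow> real \<Rightarrow> ennreal" where
  "speed A g \<gamma> t = (SUP c\<in>{c\<in>A. \<gamma> t \<in> chart_dom c}.
     let v = vector_derivative (chart_map c \<circ> \<gamma>) (at t)
     in ennreal (sqrt (v \<bullet> (g c (chart_map c (\<gamma> t)) *v v))))"

definition curve_length ::
    "('m, 'n::finite) chart set \<Rightarrow> ('m, 'n) metric_coeffs \<Rightarrow> (real \<Rightarrow> 'm) \<Rightarrow> ennreal" where
  "curve_length A g \<gamma> = (\<integral>\<^sup>+t\<in>{0..1}. speed A g \<gamma> t \<partial>lborel)"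

definition riemannian_dist ::
    "'m::t2_space set \<Rightarrow> ('m, 'n::finite) chart set \<Rightarrow> ('m, 'n) metric_coeffs \<Rightarrow> 'm \<Rightarrow> 'm \<Rightarrow> ennreal" where
  "riemannian_dist M A g x y =
     (INF \<gamma>\<in>{\<gamma>. piecewise_C1_curve M A \<gamma> \<and> pathstart \<gamma> = x \<and> pathfinish \<gamma> = y}. curve_length A g \<gamma>)"

section \<open>Riemannian volume\<close>

text \<open>The volume of the domain of one chart, as a measure on all of \<open>M\<close> that vanishes off the domain:
  the image of \<open>sqrt (det g) dx\<close> under the parametrization.\<close>

definition chart_volume ::
    "'m::t2_space set \<Rightarrow> ('m, 'n::finite) metric_coeffs \<Rightarrow> ('m, 'n) chart \<Rightarrow> 'm measure" where
  "chart_volume M g c =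
     distr (density (restrict_space lborel (chart_ran c)) (\<lambda>x. ennreal (sqrt (det (g c x)))))
           (restrict_space borel M) (chart_inv c)"

text \<open>By the change of variables formula the chart volumes agree on overlaps. Hence their supremum (in
  the lattice of measures, not pointwise) is the unique Borel measure on \<open>M\<close> that agrees with each of
  them on the corresponding chart domain.\<close>

definition riemannian_volume ::
    "'m::t2_space set \<Rightarrow> ('m, 'n::finite) chart set \<Rightarrow> ('m, 'n) metric_coeffs \<Rightarrow> 'm measure" where
  "riemannian_volume M A g = (SUP c\<in>A. chart_volume M g c)"

section \<open>\<open>L\<^sup>p\<close> norms\<close>

definition Lp_norm :: "ennreal \<Rightarrow> 'm measure \<Rightarrow> ('m \<Rightarrow> real) \<Rightarrow> ennreal" where
  "Lp_norm p \<mu> f =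
     (if p = \<infinity> then esssup \<mu> (\<lambda>x. ennreal \<bar>f x\<bar>)
      else let I = \<integral>\<^sup>+x. ennreal (\<bar>f x\<bar> powr enn2real p) \<partial>\<mu>
           in if I = \<infinity> then \<infinity> else ennreal (enn2real I powr (1 / enn2real p)))"

section \<open>Laplace--Beltrami operator and eigenfunctions\<close>

definition smooth_function :: "('m, 'n::finite) chart set \<Rightarrow> ('m \<Rightarrow> real) \<Rightarrow> bool" where
  "smooth_function A u \<longleftrightarrow> (\<forall>c\<in>A. smooth_on (chart_ran c) (u \<circ> chart_inv c))"

text \<open>\<open>\<Delta>u = div grad u\<close> at the point \<open>x\<close>, in the coordinates of \<open>c\<close>:
  \<open>(det g)\<^sup>-\<^sup>1\<^sup>/\<^sup>2 \<Sum>\<^sub>i \<partial>\<^sub>i ((det g)\<^sup>1\<^sup>/\<^sup>2 \<Sum>\<^sub>j g\<^sup>i\<^sup>j \<partial>\<^sub>j u)\<close>. For smooth \<open>u\<close> the value does not depend on the chart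
  \<open>c\<close> around \<open>x\<close>.\<close>

definition laplace_beltrami ::
    "('m, 'n::finite) metric_coeffs \<Rightarrow> ('m, 'n) chart \<Rightarrow> ('m \<Rightarrow> real) \<Rightarrow> 'm \<Rightarrow> real" where
  "laplace_beltrami g c u x =
     (let w = (\<lambda>y. sqrt (det (g c y)));
          flux = (\<lambda>i y. w y * (\<Sum>j\<in>UNIV. matrix_inv (g c y) $ i $ j * partial j (u \<circ> chart_inv c) y))
      in (\<Sum>i\<in>UNIV. partial i (flux i) (chart_map c x)) / w (chart_map c x))"

text \<open>Requiring smoothness is no restriction, by elliptic regularity.\<close>

definition eigenfunction ::
    "'m::t2_space set \<Rightarrow> ('m, 'n::finite) chart set \<Rightarrow> ('m, 'n) metric_coeffs \<Rightarrow> real \<Rightarrow> ('m \<Rightarrow> real) \<Rightarrow> bool" where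
  "eigenfunction M A g lam u \<longleftrightarrow>
     smooth_function A u \<and> (\<exists>x\<in>M. u x \<noteq> 0) \<and>
     (\<forall>c\<in>A. \<forall>x\<in>chart_dom c. - laplace_beltrami g c u x = lam * u x)"

definition nodal_set :: "'m set \<Rightarrow> ('m \<Rightarrow> real) \<Rightarrow> 'm set" where
  "nodal_set M u = {x\<in>M. u x = 0}"

definition tubular_nbhd ::
    "'m::t2_space set \<Rightarrow> ('m, 'n::finite) chart set \<Rightarrow> ('m, 'n) metric_coeffs \<Rightarrow> 'm set \<Rightarrow> real \<Rightarrow> 'm set" where
  "tubular_nbhd M A g N \<delta> = {x\<in>M. (INF y\<in>N. riemannian_dist M A g x y) < ennreal \<delta>}"

end

theory Submission
  imports Defs
begin

text \<open>In a chart an eigenfunction solves \<open>a\<^sub>i\<^sub>j u\<^sub>i\<^sub>j + b\<^sub>i u\<^sub>i + \<lambda> u = 0\<close> with \<open>a = g\<inverse>\<close>. Doubling the variables (Ishii and Lions)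
  bounds its gradient on a ball of radius \<open>R \<lesssim> \<lambda>\<^sup>-\<^sup>1\<^sup>/\<^sup>2\<close> by \<open>(C / R) sup \<bar>u\<bar>\<close>, and a weighted maximum
  turns the supremum into an \<open>L\<^sup>p\<close> mean. A point of \<open>T\<^sub>\<delta>\<close> is joined to a zero of \<open>u\<close> by a curve that
  is Euclidean short, so that \<open>\<bar>u\<bar>\<^sup>p\<close> is there at most \<open>C (\<delta> / R)\<^sup>p\<close> times its mean over a ball of radius
  \<open>R\<close>. Integrating in \<open>x\<close> gives \<open>\<integral>\<close> of \<open>\<bar>u\<bar>\<^sup>p\<close> over \<open>T\<^sub>\<delta>\<close> at most \<open>C (\<delta> / R)\<^sup>p\<close> times that over \<open>M\<close>, which is half of
  it for small \<open>\<delta> / R\<close>. Since \<open>R\<close> may not exceed the size of a chart, \<open>\<lambda>\<close> has to be bounded below. If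
  \<open>\<lambda>\<close> were small and \<open>max u = 1 = max \<bar>u\<bar>\<close>, then \<open>1 - u\<close> would be a nonnegative supersolution up to an error \<open>\<lambda>\<close>; as
  \<open>u \<le> 0\<close> at a minimum, Hopf's barrier along a chain of balls would keep \<open>1 - u\<close> away from \<open>0\<close> everywhere.\<close>

section \<open>Second derivative tests\<close>

text \<open>Every estimate comes from a second derivative test at a maximum, applied to C2 functions
  and Lipschitz coefficients: the equation is never differentiated, as Bernstein's method would do,
  and nothing is integrated by parts. The price is a penalty in the doubled function that has to be
  concave, since its concavity alone produces a term of the right sign of order
  \<open>k / R\<close>. The condition \<open>lam * R\<^sup>2 \<le> 1\<close> tames the zero order
  term: after rescaling by \<open>R\<close> it is bounded by an absolute constant, so that all
  constants depend on the chart only. Two uniformities shape the rest. The lower bound for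
  eigenvalues must hold for all eigenfunctions at once, so every quantity along its chain is chosen
  before \<open>lam\<close> and \<open>u\<close>. The final constant is \<open>1 / 2\<close> for
  every exponent; the dependence on the exponent sits in the width \<open>r\<close>. An infinite
  exponent shares the finite cover with the finite ones, because on the tube it needs only a
  pointwise bound.\<close>

definition contract :: "real^'n^'n \<Rightarrow> (real^'n \<Rightarrow> real^'n \<Rightarrow> real) \<Rightarrow> real" where
  "contract Q B = (\<Sum>i\<in>UNIV. \<Sum>j\<in>UNIV. Q $ i $ j * B (axis i 1) (axis j 1))"

definition outer :: "real^'n \<Rightarrow> real^'n^'n" where
  "outer v = (\<chi> i j. v $ i * v $ j)"

definition psd :: "real^'n^'n \<Rightarrow> bool" where
  "psd Q \<longleftrightarrow> transpose Q = Q \<and> (\<forall>v. 0 \<le> v \<bullet> (Q *v v))"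

lemma contract_add: "contract (P + Q) B = contract P B + contract Q B"
  by (simp add: contract_def distrib_right sum.distrib)

lemma contract_scaleR: "contract (r *\<^sub>R Q) B = r * contract Q B"
  by (simp add: contract_def sum_distrib_left algebra_simps)

lemma contract_diff: "contract (P - Q) B = contract P B - contract Q B"
  by (simp add: contract_def left_diff_distrib sum_subtractf)

lemma contract_add2: "contract Q (\<lambda>v w. B v w + C v w) = contract Q B + contract Q C"
  by (simp add: contract_def distrib_left sum.distrib)

lemma contract_diff2: "contract Q (\<lambda>v w. B v w - C v w) = contract Q B - contract Q C"
  by (simp add: contract_def right_diff_distrib sum_subtractf)

lemma contract_mult2: "contract Q (\<lambda>v w. r * B v w) = r * contract Q B"
  by (simp add: contract_def sum_distrib_left algebra_simps)

lemma contract_inner: "contract Q (\<bullet>) = trace Q"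
  by (simp add: contract_def trace_def inner_axis_axis if_distrib cong: if_cong)

lemma contract_mat1: "contract (mat 1) B = (\<Sum>i\<in>UNIV. B (axis i 1) (axis i 1))"
  unfolding contract_def mat_def by (simp add: if_distrib[of "\<lambda>x. x * _"] cong: if_cong)

lemma linear_vec_expansion:
  fixes f :: "real^'n \<Rightarrow> 'a::real_vector"
  assumes "linear f"
  shows "f x = (\<Sum>j\<in>UNIV. x $ j *\<^sub>R f (axis j 1))"
proof -
  have "(\<Sum>j\<in>UNIV. x $ j *\<^sub>R axis j 1) = x"
    using basis_expansion[of x] by (simp only: scalar_mult_eq_scaleR)
  moreover have "f (\<Sum>j\<in>UNIV. x $ j *\<^sub>R axis j 1) = (\<Sum>j\<in>UNIV. x $ j *\<^sub>R f (axis j 1))"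
    using assms by (simp add: linear_sum linear_scale)
  ultimately show ?thesis by simp
qed

lemma contract_outer:
  assumes "bilinear B"
  shows "contract (outer v) B = B v v"
proof -
  have "(\<Sum>i\<in>UNIV. v $ i *\<^sub>R axis i 1) = v"
    using basis_expansion[of v] by (simp only: scalar_mult_eq_scaleR)
  then have "B v v = B (\<Sum>i\<in>UNIV. v $ i *\<^sub>R axis i 1) (\<Sum>j\<in>UNIV. v $ j *\<^sub>R axis j 1)"
    by simp
  also have "\<dots> = (\<Sum>(i,j)\<in>UNIV \<times> UNIV. B (v $ i *\<^sub>R axis i 1) (v $ j *\<^sub>R axis j 1))"
    by (rule bilinear_sum[OF assms])
  also have "\<dots> = contract (outer v) B"
    using assms by (simp add: contract_def outer_def sum.cartesian_product bilinear_lmul bilinear_rmul mult.assoc)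
  finally show ?thesis by simp
qed

lemma outer_mult_vec: "outer v *v w = (v \<bullet> w) *\<^sub>R v"
  by (simp add: vec_eq_iff outer_def matrix_vector_mult_def inner_vec_def sum_distrib_left sum_distrib_right algebra_simps)

lemma outer_quadratic: "w \<bullet> (outer v *v w) = (v \<bullet> w)\<^sup>2"
  by (simp add: outer_mult_vec power2_eq_square inner_commute)

lemma transpose_outer: "transpose (outer v) = outer v"
  by (simp add: transpose_def outer_def vec_eq_iff mult.commute)

lemma transpose_entry: "transpose Q = Q \<Longrightarrow> Q $ i $ j = Q $ j $ i"
  by (drule arg_cong[where f = "\<lambda>P. P $ j $ i"]) (simp add: transpose_def)

lemma psd_entry: "psd Q \<Longrightarrow> Q $ i $ j = Q $ j $ i"
  unfolding psd_def by (intro transpose_entry) blast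

lemma axis_quadratic: "(axis i 1 :: real^'n) \<bullet> (Q *v axis j 1) = Q $ i $ j"
  by (simp add: matrix_vector_mul_component inner_axis' matrix_vector_mult_basis column_def)

lemma psd_diag_nonneg: "psd Q \<Longrightarrow> 0 \<le> Q $ i $ i"
  by (metis axis_quadratic psd_def)

text \<open>The nonnegative number is the quadratic form at \<open>v - t *\<^sub>R axis i 1\<close>.
  As a polynomial in \<open>t\<close> it gives the vanishing of a row with zero diagonal entry and,
  at its minimum, the Schur complement used below.\<close>

lemma psd_quadratic_along:
  assumes "psd Q"
  shows "0 \<le> v \<bullet> (Q *v v) - 2 * t * (Q $ i \<bullet> v) + t\<^sup>2 * Q $ i $ i"
proof -
  let ?e = "axis i 1 :: real^'a"
  have tr: "transpose Q = Q" and nn: "0 \<le> (v - t *\<^sub>R ?e) \<bullet> (Q *v (v - t *\<^sub>R ?e))"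
    using assms by (auto simp: psd_def)
  have e1: "?e \<bullet> (Q *v v) = Q $ i \<bullet> v"
    by (simp add: inner_axis' matrix_vector_mul_component)
  have e2: "v \<bullet> (Q *v ?e) = Q $ i \<bullet> v"
    using e1 tr by (metis dot_lmul_matrix inner_commute transpose_matrix_vector)
  have "(v - t *\<^sub>R ?e) \<bullet> (Q *v (v - t *\<^sub>R ?e)) =
      v \<bullet> (Q *v v) - t * (?e \<bullet> (Q *v v)) - t * (v \<bullet> (Q *v ?e)) + t * t * (?e \<bullet> (Q *v ?e))"
    by (simp add: matrix_vector_mult_diff_distrib matrix_vector_mult_scaleR inner_diff_left inner_diff_right algebra_simps)
  then show ?thesis
    using nn by (simp add: e1 e2 axis_quadratic power2_eq_square algebra_simps)
qed

lemma psd_zero_diag: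
  assumes "psd Q" "Q $ i $ i = 0"
  shows "Q $ i = 0"
proof (rule ccontr)
  assume *: "Q $ i \<noteq> 0"
  define v where "v = Q $ i"
  define c where "c = v \<bullet> (Q *v v)"
  have v: "v \<bullet> v > 0" using * by (simp add: v_def)
  \<comment> \<open>With a zero diagonal entry the polynomial is affine in \<open>t\<close> with
    slope \<open>- 2 * (v \<bullet> v)\<close>; this \<open>t\<close> pushes it down to
    \<open>- 1\<close>.\<close>
  have "0 \<le> c - 2 * ((c + 1) / (2 * (v \<bullet> v))) * (v \<bullet> v)"
    using psd_quadratic_along[OF assms(1), of v "(c+1) / (2 * (v \<bullet> v))" i] assms(2)
    by (simp add: c_def v_def)
  also have "\<dots> = -1" using v by (simp add: field_simps)
  finally show False by simp
qed

text \<open>One step of symmetric Gauss elimination splits off a rank one summand and clears a row, so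
  that induction on the number of nonzero diagonal entries applies.\<close>

lemma contract_psd_nonpos:
  assumes "psd Q" "bilinear B" "\<And>v. B v v \<le> 0"
  shows "contract Q B \<le> 0"
  using assms(1)
proof (induction "card {i. Q $ i $ i \<noteq> 0}" arbitrary: Q rule: less_induct)
  case less
  show ?case
  proof (cases "\<exists>i. Q $ i $ i \<noteq> 0")
    case False
    then have "Q = 0"
      using psd_zero_diag[OF less.prems] by (simp add: vec_eq_iff)
    then show ?thesis by (simp add: contract_def)
  next
    case True
    then obtain i where "Q $ i $ i \<noteq> 0" by blast
    then have i: "Q $ i $ i > 0"
      using psd_diag_nonneg[OF less.prems, of i] by simp
    define R where "R = Q - (1 / Q $ i $ i) *\<^sub>R outer (Q $ i)"
    have R: "R $ k $ l = Q $ k $ l - Q $ i $ k * Q $ i $ l / Q $ i $ i" for k l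
      by (simp add: R_def outer_def)
    have "transpose R = R"
      by (simp add: transpose_def vec_eq_iff R psd_entry[OF less.prems] mult.commute)
    moreover have "0 \<le> v \<bullet> (R *v v)" for v
    proof -
      have "v \<bullet> (R *v v) = v \<bullet> (Q *v v) - (Q $ i \<bullet> v)\<^sup>2 / Q $ i $ i"
        by (simp add: R_def matrix_vector_mult_diff_rdistrib scaleR_matrix_vector_assoc[symmetric]
            inner_diff_right outer_quadratic)
      also have "\<dots> \<ge> 0"
        using psd_quadratic_along[OF less.prems, of v "(Q $ i \<bullet> v) / Q $ i $ i" i] i
        by (simp add: field_simps power2_eq_square)
      finally show ?thesis .
    qed
    ultimately have psdR: "psd R" by (simp add: psd_def)
    have "{k. R $ k $ k \<noteq> 0} \<subset> {k. Q $ k $ k \<noteq> 0}"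
    proof
      show "{k. R $ k $ k \<noteq> 0} \<subseteq> {k. Q $ k $ k \<noteq> 0}"
      proof clarify
        fix k assume k: "R $ k $ k \<noteq> 0" "Q $ k $ k = 0"
        have "Q $ i $ k = 0"
          using psd_zero_diag[OF less.prems k(2)] psd_entry[OF less.prems, of i k] by simp
        then show False using k by (simp add: R)
      qed
      have "R $ i $ i = 0" using i by (simp add: R)
      then have "i \<in> {k. Q $ k $ k \<noteq> 0}" "i \<notin> {k. R $ k $ k \<noteq> 0}" using i by simp_all
      then show "{k. R $ k $ k \<noteq> 0} \<noteq> {k. Q $ k $ k \<noteq> 0}" by metis
    qed
    then have "contract R B \<le> 0"
      using less.hyps[OF _ psdR] by (simp add: psubset_card_mono)
    moreover have "contract Q B = contract R B + B (Q $ i) (Q $ i) / Q $ i $ i"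
      by (simp add: R_def contract_diff contract_scaleR contract_outer[OF assms(2)])
    moreover have "B (Q $ i) (Q $ i) / Q $ i $ i \<le> 0"
      using assms(3)[of "Q $ i"] i by (simp add: divide_le_0_iff)
    ultimately show ?thesis by linarith
  qed
qed

text \<open>If \<open>m\<close> were positive, \<open>h'\<close> would be positive just to the right
  of 0, and the mean value theorem would lift \<open>h\<close> above its maximum. Only
  \<open>h'\<close> near 0 and its derivative at the single point 0 are involved.\<close>

lemma second_derivative_test:
  fixes h :: "real \<Rightarrow> real"
  assumes d: "e > 0" "\<And>t. \<bar>t\<bar> < e \<Longrightarrow> (h has_real_derivative h' t) (at t)"
    and d2: "(h' has_real_derivative m) (at 0)"
    and mx: "\<And>t. \<bar>t\<bar> < e \<Longrightarrow> h t \<le> h 0"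
  shows "h' 0 = 0" "m \<le> 0"
proof -
  show z: "h' 0 = 0"
    using DERIV_local_max[OF d(2)[of 0] d(1)] mx d(1) by auto
  show "m \<le> 0"
  proof (rule ccontr)
    assume "\<not> m \<le> 0"
    then obtain r where r: "r > 0" "\<And>t. 0 < t \<Longrightarrow> t < r \<Longrightarrow> h' 0 < h' (0 + t)"
      using DERIV_pos_inc_right[OF d2] by auto
    define t where "t = min r e / 2"
    have t: "0 < t" "t < r" "t < e" using r d(1) by (auto simp: t_def)
    obtain s where s: "0 < s" "s < t" "h t - h 0 = (t - 0) * h' s"
      using MVT2[OF t(1), of h h'] d(2) t by force
    then have "h' s > 0" using r(2)[of s] t z by simp
    then have "h t > h 0" using s t by (smt (verit) mult_pos_pos)
    then show False using mx[of t] t by simp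
  qed
qed

section \<open>Solutions of elliptic equations in nondivergence form\<close>

text \<open>The derivatives are data instead of being read off by \<open>frechet_derivative\<close>,
  so that combinations of \<open>u\<close> with explicit test functions are again of this form by
  the derivative rules. In \<open>H x v w\<close> the second differentiation is in direction
  \<open>w\<close>.\<close>

definition C2_derivs :: "(real^'n) set \<Rightarrow> (real^'n \<Rightarrow> real) \<Rightarrow> (real^'n \<Rightarrow> real^'n \<Rightarrow> real) \<Rightarrow>
    (real^'n \<Rightarrow> real^'n \<Rightarrow> real^'n \<Rightarrow> real) \<Rightarrow> bool" where
  "C2_derivs U u D H \<longleftrightarrow> (\<forall>x\<in>U. (u has_derivative D x) (at x)) \<and>
     (\<forall>v. \<forall>x\<in>U. ((\<lambda>y. D y v) has_derivative H x v) (at x))"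

text \<open>The ellipticity constant is \<open>2 * \<mu>\<close> because the doubling argument
  spends \<open>\<mu>\<close> on a rank one summand and another \<open>\<mu>\<close> on the
  Lipschitz error. One \<open>B\<close> bounds both trace and drift, as they enter the estimates
  only through upper bounds.\<close>

definition elliptic_on :: "(real^'n) set \<Rightarrow> (real^'n \<Rightarrow> real^'n^'n) \<Rightarrow> (real^'n \<Rightarrow> real^'n) \<Rightarrow>
    real \<Rightarrow> real \<Rightarrow> real \<Rightarrow> bool" where
  "elliptic_on K a b \<mu> L B \<longleftrightarrow> 0 < \<mu> \<and> 0 \<le> L \<and> 0 \<le> B \<and>
     (\<forall>x\<in>K. transpose (a x) = a x \<and> (\<forall>v. 2 * \<mu> * (v \<bullet> v) \<le> v \<bullet> (a x *v v)) \<and>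
        trace (a x) \<le> B \<and> norm (b x) \<le> B) \<and>
     (\<forall>x\<in>K. \<forall>y\<in>K. \<forall>v. \<bar>v \<bullet> ((a x - a y) *v v)\<bar> \<le> L * norm (x - y) * (v \<bullet> v))"

definition solves_on :: "(real^'n) set \<Rightarrow> (real^'n \<Rightarrow> real^'n^'n) \<Rightarrow> (real^'n \<Rightarrow> real^'n) \<Rightarrow>
    real \<Rightarrow> (real^'n \<Rightarrow> real) \<Rightarrow> bool" where
  "solves_on U a b lam u \<longleftrightarrow> (\<exists>D H. C2_derivs U u D H \<and>
     (\<forall>x\<in>U. contract (a x) (H x) + D x (b x) + lam * u x = 0))"

text \<open>Linearity in the first direction is inherited from \<open>D y\<close>, by uniqueness of
  the derivative of \<open>\<lambda>y. D y v\<close>.\<close>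

lemma C2_bilinear:
  assumes "C2_derivs U u D H" "open U" "x \<in> U"
  shows "bilinear (H x)"
proof -
  have D: "(u has_derivative D y) (at y)" if "y \<in> U" for y
    using assms that by (simp add: C2_derivs_def)
  have H: "((\<lambda>y. D y v) has_derivative H x v) (at x)" for v
    using assms by (simp add: C2_derivs_def)
  have lin: "linear (D y)" if "y \<in> U" for y
    using D[OF that] by (rule has_derivative_linear)
  have "H x (v + w) = (\<lambda>h. H x v h + H x w h)" for v w
  proof (rule has_derivative_unique)
    show "((\<lambda>y. D y (v + w)) has_derivative H x (v + w)) (at x)" by (rule H)
    have "((\<lambda>y. D y v + D y w) has_derivative (\<lambda>h. H x v h + H x w h)) (at x)"
      by (intro has_derivative_add H)
    then show "((\<lambda>y. D y (v + w)) has_derivative (\<lambda>h. H x v h + H x w h)) (at x)"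
      by (rule has_derivative_transform_within_open[OF _ assms(2,3)]) (simp add: lin linear_add)
  qed
  moreover have "H x (r *\<^sub>R v) = (\<lambda>h. r *\<^sub>R H x v h)" for r v
  proof (rule has_derivative_unique)
    show "((\<lambda>y. D y (r *\<^sub>R v)) has_derivative H x (r *\<^sub>R v)) (at x)" by (rule H)
    have "((\<lambda>y. r *\<^sub>R D y v) has_derivative (\<lambda>h. r *\<^sub>R H x v h)) (at x)"
      by (intro has_derivative_scaleR_right H)
    then show "((\<lambda>y. D y (r *\<^sub>R v)) has_derivative (\<lambda>h. r *\<^sub>R H x v h)) (at x)"
      by (rule has_derivative_transform_within_open[OF _ assms(2,3)]) (simp add: lin linear_scale)
  qed
  ultimately show ?thesis
    unfolding bilinear_def
    using has_derivative_linear[OF H] by (auto intro!: linearI)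
qed

lemma C2_line:
  assumes "C2_derivs U u D H" "x + t *\<^sub>R a \<in> U"
  shows "((\<lambda>t. u (x + t *\<^sub>R a)) has_real_derivative D (x + t *\<^sub>R a) a) (at t)"
    "((\<lambda>t. D (x + t *\<^sub>R a) a) has_real_derivative H (x + t *\<^sub>R a) a a) (at t)"
proof -
  have l: "((\<lambda>t. x + t *\<^sub>R a) has_derivative (\<lambda>s. s *\<^sub>R a)) (at t)"
    by (auto intro!: derivative_eq_intros)
  have *: "((\<lambda>t. f (x + t *\<^sub>R a)) has_real_derivative F a) (at t)"
    if "(f has_derivative F) (at (x + t *\<^sub>R a))" for f F
  proof -
    have "linear F" using that by (rule has_derivative_linear)
    then have "(\<lambda>s. F (s *\<^sub>R a)) = (*) (F a)" by (auto simp: linear_scale)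
    then show ?thesis
      using diff_chain_at[OF l that] by (simp add: has_field_derivative_def o_def)
  qed
  show "((\<lambda>t. u (x + t *\<^sub>R a)) has_real_derivative D (x + t *\<^sub>R a) a) (at t)"
    "((\<lambda>t. D (x + t *\<^sub>R a) a) has_real_derivative H (x + t *\<^sub>R a) a a) (at t)"
    using *[of u "D (x + t *\<^sub>R a)"] *[of "\<lambda>y. D y a" "H (x + t *\<^sub>R a) a"] assms
    by (auto simp: C2_derivs_def)
qed

lemma C2_continuous_on: "C2_derivs U u D H \<Longrightarrow> continuous_on U u"
  by (meson C2_derivs_def continuous_at_imp_continuous_on has_derivative_continuous)

text \<open>Serves with \<open>r = -1\<close> to turn one-sided bounds into two-sided ones, and to
  normalize an eigenfunction by its extreme value.\<close>

lemma solves_on_mult: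
  assumes "solves_on U a b lam u"
  shows "solves_on U a b lam (\<lambda>x. r * u x)"
proof -
  obtain D H where DH: "C2_derivs U u D H"
    "\<And>x. x \<in> U \<Longrightarrow> contract (a x) (H x) + D x (b x) + lam * u x = 0"
    using assms by (auto simp: solves_on_def)
  have "C2_derivs U (\<lambda>x. r * u x) (\<lambda>x v. r * D x v) (\<lambda>x v w. r * H x v w)"
    using DH(1) unfolding C2_derivs_def by (auto intro!: has_derivative_mult_right)
  moreover have "contract (a x) (\<lambda>v w. r * H x v w) + r * D x (b x) + lam * (r * u x) = 0" if "x \<in> U" for x
  proof -
    have "contract (a x) (\<lambda>v w. r * H x v w) + r * D x (b x) + lam * (r * u x) =
        r * (contract (a x) (H x) + D x (b x) + lam * u x)"
      by (simp add: contract_mult2 algebra_simps)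
    then show ?thesis using DH(2)[OF that] by simp
  qed
  ultimately show ?thesis unfolding solves_on_def by blast
qed

lemma norm_line_deriv:
  fixes w v :: "'a::real_inner"
  assumes "w + t *\<^sub>R v \<noteq> 0"
  shows "((\<lambda>t. norm (w + t *\<^sub>R v)) has_real_derivative ((w + t *\<^sub>R v) \<bullet> v) / norm (w + t *\<^sub>R v)) (at t)"
    "((\<lambda>t. ((w + t *\<^sub>R v) \<bullet> v) / norm (w + t *\<^sub>R v)) has_real_derivative
       (v \<bullet> v) / norm (w + t *\<^sub>R v) - ((w + t *\<^sub>R v) \<bullet> v)\<^sup>2 / norm (w + t *\<^sub>R v) ^ 3) (at t)"
proof -
  define q where "q t = w \<bullet> w + 2 * t * (w \<bullet> v) + t\<^sup>2 * (v \<bullet> v)" for t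
  have q: "(w + t *\<^sub>R v) \<bullet> (w + t *\<^sub>R v) = q t" for t
    by (simp add: q_def inner_add_left inner_add_right inner_commute power2_eq_square)
  have n: "norm (w + t *\<^sub>R v) = sqrt (q t)" for t
    by (simp add: norm_eq_sqrt_inner q)
  have l: "(w + t *\<^sub>R v) \<bullet> v = w \<bullet> v + t * (v \<bullet> v)" for t
    by (simp add: inner_add_left)
  have pos: "q t > 0" using assms by (simp add: q[symmetric])
  have dq: "(q has_real_derivative 2 * (w \<bullet> v + t * (v \<bullet> v))) (at t)"
    unfolding q_def by (auto intro!: derivative_eq_intros simp: algebra_simps)
  have d: "((\<lambda>t. sqrt (q t)) has_real_derivative (w \<bullet> v + t * (v \<bullet> v)) / sqrt (q t)) (at t)"
    using pos by (auto intro!: derivative_eq_intros dq simp: field_simps)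
  then show "((\<lambda>t. norm (w + t *\<^sub>R v)) has_real_derivative ((w + t *\<^sub>R v) \<bullet> v) / norm (w + t *\<^sub>R v)) (at t)"
    by (simp only: n l)
  have s: "sqrt (q t) > 0" using pos by simp
  have "((\<lambda>t. (w \<bullet> v + t * (v \<bullet> v)) / sqrt (q t)) has_real_derivative
      ((v \<bullet> v) * sqrt (q t) - (w \<bullet> v + t * (v \<bullet> v)) * ((w \<bullet> v + t * (v \<bullet> v)) / sqrt (q t))) / (sqrt (q t) * sqrt (q t))) (at t)"
    by (rule DERIV_divide[OF _ d]) (use s in \<open>auto intro!: derivative_eq_intros\<close>)
  moreover have "((v \<bullet> v) * sqrt (q t) - (w \<bullet> v + t * (v \<bullet> v)) * ((w \<bullet> v + t * (v \<bullet> v)) / sqrt (q t))) / (sqrt (q t) * sqrt (q t))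
      = (v \<bullet> v) / sqrt (q t) - (w \<bullet> v + t * (v \<bullet> v))\<^sup>2 / sqrt (q t) ^ 3"
    using s by (simp add: divide_simps) (simp add: algebra_simps power2_eq_square power3_eq_cube)
  ultimately show "((\<lambda>t. ((w + t *\<^sub>R v) \<bullet> v) / norm (w + t *\<^sub>R v)) has_real_derivative
       (v \<bullet> v) / norm (w + t *\<^sub>R v) - ((w + t *\<^sub>R v) \<bullet> v)\<^sup>2 / norm (w + t *\<^sub>R v) ^ 3) (at t)"
    by (simp only: n l)
qed

lemma bilinear_inner: "bilinear (\<lambda>v w::'a::real_inner. v \<bullet> w)"
  by (simp add: bilinear_def linear_iff inner_add_left inner_add_right)

lemma bilinear_combine:
  fixes B C :: "'a::real_vector \<Rightarrow> 'b::real_vector \<Rightarrow> real"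
  assumes "bilinear B" "bilinear C"
  shows "bilinear (\<lambda>v w. B v w + r * C v w)"
  using assms by (simp add: bilinear_def linear_iff algebra_simps)

lemma contract_le_trace:
  assumes "psd Q" "bilinear B" "\<And>v. B v v \<le> r * (v \<bullet> v)"
  shows "contract Q B \<le> r * trace Q"
proof -
  have "contract Q (\<lambda>v w. B v w + (- r) * (v \<bullet> w)) \<le> 0"
    by (intro contract_psd_nonpos assms bilinear_combine bilinear_inner) (use assms(3) in simp)
  then show ?thesis
    by (simp add: contract_diff2 contract_mult2 contract_inner)
qed

section \<open>The doubled function at its maximum\<close>

text \<open>The doubled function is tested along the line through \<open>(x, y)\<close> in direction
  \<open>(a, b)\<close>. Its penalty is a function s - s^2 / R of the distance s, so only
  \<open>a - b\<close> enters there, while the term with \<kappa> sees the first variable alone. All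
  directions stay free, since the trace inequality combines several of them.\<close>

lemma doubling_conditions:
  fixes u :: "real^'n \<Rightarrow> real"
  assumes C2: "C2_derivs U u D H" and U: "x \<in> U" "y \<in> U" and ne: "x \<noteq> y" and R: "R \<noteq> 0"
    and W: "open U" "open W" "(x, y) \<in> W"
    and mx: "\<And>x' y'. (x', y') \<in> W \<Longrightarrow>
        u x' - u y' - k * (norm (x' - y') - (x' - y') \<bullet> (x' - y') / R) - \<kappa> * ((x' - z) \<bullet> (x' - z))
      \<le> u x - u y - k * (norm (x - y) - (x - y) \<bullet> (x - y) / R) - \<kappa> * ((x - z) \<bullet> (x - z))"
  shows "D x a - D y b = k * ((x - y) \<bullet> (a - b) / norm (x - y) - 2 * ((x - y) \<bullet> (a - b)) / R)
      + 2 * \<kappa> * ((x - z) \<bullet> a)" (is ?first)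
    and "H x a a - H y b b \<le> k * ((a - b) \<bullet> (a - b) / norm (x - y)
      - ((x - y) \<bullet> (a - b))\<^sup>2 / norm (x - y) ^ 3 - 2 * ((a - b) \<bullet> (a - b)) / R) + 2 * \<kappa> * (a \<bullet> a)" (is ?second)
proof -
  define w v p where "w = x - y" and "v = a - b" and "p = x - z"
  define h where "h t = u (x + t *\<^sub>R a) - u (y + t *\<^sub>R b)
      - k * (norm (w + t *\<^sub>R v) - (w + t *\<^sub>R v) \<bullet> (w + t *\<^sub>R v) / R)
      - \<kappa> * ((p + t *\<^sub>R a) \<bullet> (p + t *\<^sub>R a))" for t
  define h' where "h' t = D (x + t *\<^sub>R a) a - D (y + t *\<^sub>R b) b
      - k * (((w + t *\<^sub>R v) \<bullet> v) / norm (w + t *\<^sub>R v) - 2 * ((w + t *\<^sub>R v) \<bullet> v) / R)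
      - 2 * \<kappa> * ((p + t *\<^sub>R a) \<bullet> a)" for t
  define m where "m = H x a a - H y b b - k * (v \<bullet> v / norm w - (w \<bullet> v)\<^sup>2 / norm w ^ 3 - 2 * (v \<bullet> v) / R)
      - 2 * \<kappa> * (a \<bullet> a)"
  have cont: "continuous_on UNIV (\<lambda>t. (x + t *\<^sub>R a, y + t *\<^sub>R b))"
    by (intro continuous_intros)
  \<comment> \<open>The diagonal is cut out because the norm is not differentiable at 0.\<close>
  define V where "V = W \<inter> U \<times> U \<inter> - {p. fst p = snd p}"
  have "closed {p :: (real^'n) \<times> (real^'n). fst p = snd p}"
    by (intro closed_Collect_eq continuous_intros)
  then have "open V" unfolding V_def using W by (intro open_Int open_Times) auto
  then have "open ((\<lambda>t. (x + t *\<^sub>R a, y + t *\<^sub>R b)) -` V)"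
    by (rule open_vimage[OF _ cont])
  moreover have "0 \<in> (\<lambda>t. (x + t *\<^sub>R a, y + t *\<^sub>R b)) -` V"
    using assms by (simp add: V_def)
  ultimately obtain e where e: "e > 0" "ball 0 e \<subseteq> (\<lambda>t. (x + t *\<^sub>R a, y + t *\<^sub>R b)) -` V"
    by (meson open_contains_ball)
  have inV: "(x + t *\<^sub>R a, y + t *\<^sub>R b) \<in> V" if "\<bar>t\<bar> < e" for t
    using e(2) that by (auto simp: subset_iff)
  have diffw: "x + t *\<^sub>R a - (y + t *\<^sub>R b) = w + t *\<^sub>R v" for t
    by (simp add: w_def v_def algebra_simps)
  have sq: "((\<lambda>t. (p + t *\<^sub>R q) \<bullet> (p + t *\<^sub>R q)) has_real_derivative 2 * ((p + t *\<^sub>R q) \<bullet> q)) (at t)"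
      "((\<lambda>t. (p + t *\<^sub>R q) \<bullet> q) has_real_derivative q \<bullet> q) (at t)" for p q :: "real^'n" and t
    by (auto simp: inner_add_left inner_add_right inner_commute intro!: derivative_eq_intros)
  have der: "(h has_real_derivative h' t) (at t)" if t: "\<bar>t\<bar> < e" for t
  proof -
    have "w + t *\<^sub>R v \<noteq> 0" "x + t *\<^sub>R a \<in> U" "y + t *\<^sub>R b \<in> U"
      using inV[OF t] by (auto simp: V_def diffw[symmetric])
    then show ?thesis unfolding h_def h'_def
      by (auto intro!: derivative_eq_intros C2_line(1)[OF C2] norm_line_deriv(1) sq
          simp: R inner_commute field_simps)
  qed
  have der2: "(h' has_real_derivative m) (at 0)"
  proof -
    have 0: "w + 0 *\<^sub>R v \<noteq> 0" "x + 0 *\<^sub>R a \<in> U" "y + 0 *\<^sub>R b \<in> U"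
      using inV[of 0] e by (auto simp: V_def w_def)
    show ?thesis unfolding h'_def m_def
      by (rule DERIV_cong, (rule C2_line(2)[OF C2 0(2)] C2_line(2)[OF C2 0(3)]
            norm_line_deriv(2)[OF 0(1)] sq(2) DERIV_diff DERIV_cmult DERIV_cdivide)+) simp
  qed
  have "h t \<le> h 0" if "\<bar>t\<bar> < e" for t
  proof -
    have xz: "x + t *\<^sub>R a - z = p + t *\<^sub>R a" by (simp add: p_def)
    have "(x + t *\<^sub>R a, y + t *\<^sub>R b) \<in> W" using inV[OF that] by (simp add: V_def)
    from mx[OF this] show ?thesis
      unfolding h_def diffw xz by (simp add: w_def p_def)
  qed
  note second_derivative_test[OF e(1) der der2 this]
  then show ?first ?second
    by (simp_all add: h'_def m_def w_def v_def p_def algebra_simps)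
qed

lemma trace_outer: "trace (outer v) = v \<bullet> v"
  by (simp add: trace_def outer_def inner_vec_def)

lemma trace_scaleR: "trace (r *\<^sub>R (Q::real^'n^'n)) = r * trace Q"
  by (simp add: trace_def sum_distrib_left)

lemma trace_mat1: "trace (mat 1 :: real^'n^'n) = CARD('n)"
  by (simp add: trace_def mat_def)

lemma abs_trace_le:
  fixes Q :: "real^'n^'n" and r :: real
  assumes "\<And>v. \<bar>v \<bullet> (Q *v v)\<bar> \<le> r * (v \<bullet> v)"
  shows "\<bar>trace Q\<bar> \<le> CARD('n) * r"
proof -
  have "\<bar>Q $ i $ i\<bar> \<le> r" for i
    using assms[of "axis i 1"] by (simp add: axis_quadratic inner_axis_axis)
  then have "(\<Sum>i\<in>(UNIV::'n set). \<bar>Q $ i $ i\<bar>) \<le> (\<Sum>i\<in>(UNIV::'n set). r)" by (intro sum_mono) auto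
  then show ?thesis
    unfolding trace_def by (intro order_trans[OF sum_abs]) simp
qed

text \<open>With \<open>\<nu>\<close> the direction of \<open>x - y\<close> and \<open>s\<close> its length, both coefficient matrices contain the
  common part \<open>C + \<mu> \<nu>\<nu>\<^sup>T\<close>. On \<open>C\<close> the two points are moved in parallel, along \<open>\<nu>\<close> in opposite directions
  (this is the only place where the concavity of the penalty is felt), and on the remainders of size
  \<open>L s\<close> independently.\<close>

lemma doubling_contract:
  fixes a :: "real^'n \<Rightarrow> real^'n^'n" and \<mu> L B k R \<kappa> :: real
  assumes ell: "elliptic_on K a b \<mu> L B" and K: "x \<in> K" "y \<in> K" and ne: "x \<noteq> y"
    and Ls: "L * norm (x - y) \<le> \<mu>" and pos: "0 \<le> k" "0 < R" "0 \<le> \<kappa>"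
    and bil: "bilinear X" "bilinear Y"
    and second: "\<And>a b. X a a - Y b b \<le> k * ((a - b) \<bullet> (a - b) / norm (x - y)
      - ((x - y) \<bullet> (a - b))\<^sup>2 / norm (x - y) ^ 3 - 2 * ((a - b) \<bullet> (a - b)) / R) + 2 * \<kappa> * (a \<bullet> a)"
  shows "contract (a x) X - contract (a y) Y \<le> 3 * CARD('n) * L * k - 8 * \<mu> * k / R + 2 * \<kappa> * B"
proof -
  define s where "s = norm (x - y)"
  define \<nu> where "\<nu> = (x - y) /\<^sub>R s"
  have s: "s > 0" using ne by (simp add: s_def)
  have \<nu>: "\<nu> \<bullet> \<nu> = 1" "(x - y) \<bullet> \<nu> = s" "x - y = s *\<^sub>R \<nu>"
    using s by (auto simp: \<nu>_def s_def dot_square_norm power2_eq_square)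
  have \<mu>: "\<mu> > 0" "L \<ge> 0" and
    ax: "transpose (a x) = a x" "transpose (a y) = a y" "trace (a x) \<le> B"
      "\<And>v. 2 * \<mu> * (v \<bullet> v) \<le> v \<bullet> (a y *v v)" and
    lip: "\<And>v. \<bar>v \<bullet> ((a x - a y) *v v)\<bar> \<le> (L * s) * (v \<bullet> v)"
    using ell K by (auto simp: elliptic_on_def s_def)
  \<comment> \<open>Thus \<open>a x = C + E + \<mu> *\<^sub>R outer \<nu>\<close> and \<open>a y = C
    + (L * s) *\<^sub>R mat 1 + \<mu> *\<^sub>R outer \<nu>\<close>, where \<open>E\<close> and
    \<open>(L * s) *\<^sub>R mat 1\<close> are of size \<open>L * s\<close>.\<close>
  define C where "C = a y - (L * s) *\<^sub>R mat 1 - \<mu> *\<^sub>R outer \<nu>"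
  define E where "E = a x - a y + (L * s) *\<^sub>R mat 1"
  have tr: "transpose (P + Q) = transpose P + transpose Q"
      "transpose (P - Q) = transpose P - transpose Q"
      "transpose (r *\<^sub>R P) = r *\<^sub>R transpose P" for P Q :: "real^'n^'n" and r
    by (simp_all add: transpose_def vec_eq_iff)
  have qf: "v \<bullet> ((r *\<^sub>R mat 1) *v v) = r * (v \<bullet> v)" "v \<bullet> ((r *\<^sub>R outer \<nu>) *v v) = r * (\<nu> \<bullet> v)\<^sup>2"
    for v :: "real^'n" and r
    by (simp_all add: scaleR_matrix_vector_assoc[symmetric] outer_quadratic)
  have psdC: "psd C"
    unfolding psd_def
  proof (intro conjI allI)
    show "transpose C = C" by (simp add: C_def tr ax transpose_outer transpose_mat)
    fix v
    have "(\<nu> \<bullet> v)\<^sup>2 \<le> v \<bullet> v"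
      using Cauchy_Schwarz_ineq[of \<nu> v] \<nu> by simp
    then have "\<mu> * (\<nu> \<bullet> v)\<^sup>2 \<le> \<mu> * (v \<bullet> v)" using \<mu> by simp
    moreover have "L * s * (v \<bullet> v) \<le> \<mu> * (v \<bullet> v)"
      using Ls by (intro mult_right_mono) (simp_all add: s_def)
    moreover have "v \<bullet> (C *v v) = v \<bullet> (a y *v v) - L * s * (v \<bullet> v) - \<mu> * (\<nu> \<bullet> v)\<^sup>2"
      by (simp add: C_def matrix_vector_mult_diff_rdistrib inner_diff_right qf)
    ultimately show "0 \<le> v \<bullet> (C *v v)" using ax(4)[of v] by linarith
  qed
  have psdE: "psd E"
    unfolding psd_def
  proof (intro conjI allI)
    show "transpose E = E" by (simp add: E_def tr ax transpose_mat)
    fix v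
    have "v \<bullet> (E *v v) = v \<bullet> ((a x - a y) *v v) + L * s * (v \<bullet> v)"
      by (simp add: E_def matrix_vector_mult_add_rdistrib inner_add_right qf)
    then show "0 \<le> v \<bullet> (E *v v)" using lip[of v] by linarith
  qed
  have tE: "trace E \<le> 2 * CARD('n) * (L * s)"
  proof -
    have "trace (a x - a y) \<le> CARD('n) * (L * s)"
      using abs_trace_le[OF lip] by simp
    moreover have "trace E = trace (a x - a y) + L * s * CARD('n)"
      by (simp only: E_def trace_add trace_scaleR trace_mat1)
    ultimately show ?thesis by (simp add: algebra_simps)
  qed
  have tC: "trace C + trace E + \<mu> = trace (a x)"
    by (simp add: C_def E_def trace_add trace_sub trace_scaleR trace_outer \<nu>)
  have axd: "contract (a x) X = contract C X + contract E X + \<mu> * X \<nu> \<nu>"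
    and ayd: "contract (a y) Y = contract C Y + L * s * (\<Sum>i\<in>UNIV. Y (axis i 1) (axis i 1)) + \<mu> * Y \<nu> \<nu>"
    by (simp_all add: C_def E_def contract_add contract_diff contract_scaleR contract_outer[OF bil(1)]
        contract_outer[OF bil(2)] contract_mat1[symmetric])
  have "contract C (\<lambda>v w. X v w + (- 1) * Y v w) \<le> 2 * \<kappa> * trace C"
    using second[of v v for v] by (intro contract_le_trace psdC bilinear_combine bil) simp
  then have 1: "contract C X - contract C Y \<le> 2 * \<kappa> * trace C"
    by (simp add: contract_diff2 contract_mult2)
  \<comment> \<open>Opposite motion along \<nu> has \<open>a - b = 2 *\<^sub>R \<nu>\<close>: the
    two terms of size \<open>4 / s\<close> cancel, and \<open>- 8 / R\<close>, which stems from the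
    concave part of the penalty, survives.\<close>
  have "X \<nu> \<nu> - Y (- \<nu>) (- \<nu>) \<le> k * (4 / s - (2 * s)\<^sup>2 / s ^ 3 - 8 / R) + 2 * \<kappa>"
  proof -
    have "(\<nu> - - \<nu>) \<bullet> (\<nu> - - \<nu>) = 4" "(x - y) \<bullet> (\<nu> - - \<nu>) = 2 * s"
      by (simp_all only: diff_minus_eq_add inner_add_left inner_add_right \<nu>(1,2))
    then show ?thesis using second[of \<nu> "- \<nu>"] \<nu>(1) by (simp only: s_def[symmetric]) simp
  qed
  also have "4 / s - (2 * s)\<^sup>2 / s ^ 3 = 0"
    using s by (simp add: power2_eq_square power3_eq_cube)
  also have "Y (- \<nu>) (- \<nu>) = Y \<nu> \<nu>" using bil(2) by (simp add: bilinear_lneg bilinear_rneg)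
  finally have "\<mu> * (X \<nu> \<nu> - Y \<nu> \<nu>) \<le> \<mu> * (k * (0 - 8 / R) + 2 * \<kappa>)"
    using \<mu>(1) by (intro mult_left_mono) auto
  then have 2: "\<mu> * X \<nu> \<nu> - \<mu> * Y \<nu> \<nu> \<le> 2 * \<kappa> * \<mu> - 8 * \<mu> * k / R"
    by (simp add: algebra_simps)
  \<comment> \<open>For independent motions the two favourable terms are dropped; the crude factor
    \<open>k / s\<close> left over is harmless because it meets matrices of size
    \<open>L * s\<close>.\<close>
  have sec': "X v v - Y w w \<le> k * ((v - w) \<bullet> (v - w) / s) + 2 * \<kappa> * (v \<bullet> v)" for v w
  proof -
    have "0 \<le> ((x - y) \<bullet> (v - w))\<^sup>2 / s ^ 3" "0 \<le> 2 * ((v - w) \<bullet> (v - w)) / R"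
      using pos s by simp_all
    then have "k * ((v - w) \<bullet> (v - w) / s - ((x - y) \<bullet> (v - w))\<^sup>2 / s ^ 3 - 2 * ((v - w) \<bullet> (v - w)) / R)
        \<le> k * ((v - w) \<bullet> (v - w) / s)"
      using pos by (intro mult_left_mono) linarith+
    then show ?thesis using second[of v w] by (simp add: s_def)
  qed
  have "X v v \<le> (k / s + 2 * \<kappa>) * (v \<bullet> v)" for v
    using sec'[of v 0] bil(2) by (simp add: bilinear_lzero algebra_simps)
  then have "contract E X \<le> (k / s + 2 * \<kappa>) * trace E"
    by (intro contract_le_trace psdE bil)
  then have 3: "contract E X \<le> k / s * trace E + 2 * \<kappa> * trace E"
    by (simp add: distrib_right)
  have "k / s * trace E \<le> k / s * (2 * CARD('n) * (L * s))"
    using tE pos s by (intro mult_left_mono) auto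
  also have "\<dots> = 2 * CARD('n) * L * k" using s by simp
  finally have 4: "k / s * trace E \<le> 2 * CARD('n) * L * k" .
  have "- Y (axis i 1) (axis i 1) \<le> k / s" for i
    using sec'[of 0 "axis i 1"] bil(1) by (simp add: bilinear_lzero inner_axis_axis)
  then have "(\<Sum>i\<in>(UNIV::'n set). - Y (axis i 1) (axis i 1)) \<le> (\<Sum>i\<in>(UNIV::'n set). k / s)"
    by (intro sum_mono) auto
  then have "L * s * (- (\<Sum>i\<in>UNIV. Y (axis i 1) (axis i 1))) \<le> L * s * (CARD('n) * (k / s))"
    using \<mu> s by (intro mult_left_mono) (auto simp: sum_negf)
  also have "\<dots> = CARD('n) * L * k" using s by simp
  finally have 5: "- (L * s * (\<Sum>i\<in>UNIV. Y (axis i 1) (axis i 1))) \<le> CARD('n) * L * k" by simp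
  \<comment> \<open>The \<kappa> terms of all the parts add up to exactly the trace of
    \<open>a x\<close>.\<close>
  have 6: "2 * \<kappa> * (trace C + trace E + \<mu>) \<le> 2 * \<kappa> * B"
    using tC ax(3) pos by (intro mult_left_mono) auto
  show ?thesis
    using 1 2 3 4 5 6 unfolding axd ayd by (simp add: algebra_simps)
qed

section \<open>The gradient estimate\<close>

text \<open>The doubled function is maximized over pairs close to \<open>z\<close>. If the bound
  failed, the maximum would be positive, hence off the diagonal, and the penalties would keep it
  inside the domain. Subtracting the equations at its two points then contradicts
  \<open>doubling_contract\<close>, as \<open>8 * \<mu> * k / R\<close> outweighs the drift,
  localization and zero order terms.\<close>

lemma lipschitz_one_sided:
  fixes a :: "real^'n \<Rightarrow> real^'n^'n" and \<mu> L B R S N lam :: real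
  assumes U: "open U" "cball z (R / 2) \<subseteq> U" and sol: "solves_on U a b lam u"
    and ell: "elliptic_on (cball z (R / 2)) a b \<mu> L B"
    and R: "0 < R" "R \<le> 1" "(3 * CARD('n) * L + 2 * B) * R \<le> 4 * \<mu>"
    and lam: "0 \<le> lam" "lam * R\<^sup>2 \<le> 1"
    and N: "11 \<le> N" "80 * B + 2 < 4 * \<mu> * N"
    and S: "0 < S" "\<And>x. x \<in> cball z (R / 2) \<Longrightarrow> \<bar>u x\<bar> \<le> S"
    and y: "y \<in> cball z (R / 4)"
  shows "u z - u y \<le> N * S / R * dist z y"
proof (rule ccontr)
  assume neg: "\<not> ?thesis"
  obtain D H where C2: "C2_derivs U u D H"
    and pde: "\<And>x. x \<in> U \<Longrightarrow> contract (a x) (H x) + D x (b x) + lam * u x = 0"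
    using sol by (auto simp: solves_on_def)
  \<comment> \<open>Each penalty reaches \<open>2 * S\<close>, a bound for the difference of two
    values of \<open>u\<close>, on its own part of the boundary:
    \<open>\<kappa> * (R / 4)\<^sup>2 = 2 * S\<close>, and at \<open>s = R / 4\<close> the term
    \<open>k * (s - s\<^sup>2 / R)\<close> is \<open>3 / 16 * (S * N)\<close>, which exceeds
    \<open>2 * S\<close> once \<open>N \<ge> 11\<close>.\<close>
  define k \<kappa> where "k = S * N / R" and "\<kappa> = 32 * S / R\<^sup>2"
  have kk: "k > 0" "\<kappa> > 0" using S N R by (auto simp: k_def \<kappa>_def)
  have \<mu>: "0 < \<mu>" "0 \<le> L" "0 \<le> B" using ell by (auto simp: elliptic_on_def)
  define F where "F x y = u x - u y - k * (norm (x - y) - (x - y) \<bullet> (x - y) / R)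
      - \<kappa> * ((x - z) \<bullet> (x - z))" for x y
  define W where "W = cball z (R / 4) \<times> cball z (R / 2) \<inter> {p. dist (fst p) (snd p) \<le> R / 4}"
  have "compact W" unfolding W_def
    by (intro compact_Int_closed compact_Times closed_Collect_le continuous_intros) auto
  moreover have "(z, y) \<in> W" using y R by (auto simp: W_def)
  moreover have "continuous_on W (\<lambda>p. F (fst p) (snd p))"
  proof -
    have uc: "continuous_on U u" using C2 by (rule C2_continuous_on)
    have "fst ` W \<subseteq> U" "snd ` W \<subseteq> U"
      using U(2) R(1) by (auto simp: W_def subset_iff)
    then have "continuous_on W (\<lambda>p. u (fst p))" "continuous_on W (\<lambda>p. u (snd p))"
      by (auto intro!: continuous_on_compose2[OF uc] continuous_intros)
    then show ?thesis unfolding F_def using R(1) by (intro continuous_intros) auto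
  qed
  ultimately obtain q where "q \<in> W" "\<forall>p\<in>W. F (fst p) (snd p) \<le> F (fst q) (snd q)"
    using continuous_attains_sup[of W "\<lambda>p. F (fst p) (snd p)"] by blast
  then obtain x0 y0 where xy: "(x0, y0) \<in> W"
    and mx: "\<And>x y. (x, y) \<in> W \<Longrightarrow> F x y \<le> F x0 y0"
    by (metis prod.collapse fst_conv snd_conv)
  have "F z y > 0"
  proof -
    have "k * (norm (z - y) - (z - y) \<bullet> (z - y) / R) \<le> k * norm (z - y)"
      using kk R by (intro mult_left_mono) auto
    moreover have "u z - u y > k * norm (z - y)" using neg by (simp add: k_def dist_norm mult.commute)
    ultimately show ?thesis by (simp add: F_def)
  qed
  then have F0: "F x0 y0 > 0" using mx[OF \<open>(z, y) \<in> W\<close>] by simp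
  define s where "s = norm (x0 - y0)"
  have s4: "0 \<le> s" "s \<le> R / 4" using xy by (auto simp: W_def s_def dist_norm)
  have x0: "norm (x0 - z) \<le> R / 4" "x0 \<in> cball z (R / 2)" "y0 \<in> cball z (R / 2)"
    using xy R by (auto simp: W_def dist_norm norm_minus_commute)
  have xyU: "x0 \<in> U" "y0 \<in> U" using x0 U by auto
  have u2: "u x0 - u y0 \<le> 2 * S" using S(2)[OF x0(2)] S(2)[OF x0(3)] by linarith
  have pen: "(x0 - y0) \<bullet> (x0 - y0) = s\<^sup>2" by (simp add: s_def dot_square_norm)
  have ne: "x0 \<noteq> y0"
  proof
    assume "x0 = y0"
    then have "F x0 y0 \<le> 0" using kk by (simp add: F_def)
    then show False using F0 by simp
  qed
  have spos: "s > 0" using ne by (simp add: s_def)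
  have "0 \<le> s - s\<^sup>2 / R"
  proof -
    have "s * s \<le> s * (R / 4)" using s4 by (intro mult_left_mono) auto
    also have "\<dots> \<le> s * R" using s4 R by (intro mult_left_mono) auto
    finally show ?thesis using R by (simp add: field_simps power2_eq_square)
  qed
  then have phi: "0 \<le> k * (s - s\<^sup>2 / R)" using kk by simp
  have xin: "norm (x0 - z) < R / 4"
  proof (rule ccontr)
    assume "\<not> ?thesis"
    then have "norm (x0 - z) = R / 4" using x0 by simp
    then have "(x0 - z) \<bullet> (x0 - z) = (R / 4)\<^sup>2" by (simp only: dot_square_norm)
    moreover have "\<kappa> * (R / 4)\<^sup>2 = 2 * S"
      using R(1) by (simp add: \<kappa>_def power2_eq_square)
    ultimately have "\<kappa> * ((x0 - z) \<bullet> (x0 - z)) = 2 * S" by (simp only:)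
    then show False using F0 u2 phi by (simp add: F_def pen s_def[symmetric])
  qed
  have sin: "s < R / 4"
  proof (rule ccontr)
    assume "\<not> ?thesis"
    then have "s = R / 4" using s4 by simp
    then have "k * (s - s\<^sup>2 / R) = 3 / 16 * (S * N)"
      using R(1) by (simp only: k_def) (simp add: power2_eq_square field_simps)
    also have "\<dots> \<ge> 3 / 16 * (S * 11)" using N S by (intro mult_left_mono) auto
    finally have "k * (s - s\<^sup>2 / R) > 2 * S" using S(1) by linarith
    moreover have "0 \<le> \<kappa> * ((x0 - z) \<bullet> (x0 - z))" using kk by simp
    ultimately show False using F0 u2 by (simp add: F_def pen s_def[symmetric])
  qed
  define V where "V = {p. dist (fst p) z < R / 4} \<inter> {p. dist (fst p) (snd p) < R / 4}"
  have V: "open V" "(x0, y0) \<in> V"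
    using xin sin by (auto simp: V_def dist_norm s_def intro!: open_Int open_Collect_less continuous_intros)
  \<comment> \<open>The constraint on the second point never becomes active: it follows from the
    other two by the triangle inequality.\<close>
  have "V \<subseteq> W"
  proof
    fix p assume p: "p \<in> V"
    have "dist z (snd p) \<le> dist (fst p) z + dist (fst p) (snd p)"
      by (metis dist_commute dist_triangle)
    then show "p \<in> W" using p by (auto simp: V_def W_def dist_commute mem_Times_iff)
  qed
  then have mxV: "F x' y' \<le> F x0 y0" if "(x', y') \<in> V" for x' y' using mx that by blast
  have R0: "R \<noteq> 0" using R by simp
  note conds = doubling_conditions[OF C2 xyU ne R0 U(1) V, where k = k and \<kappa> = \<kappa> and z = z,
      OF mxV[unfolded F_def]]
  have bil: "bilinear (H x0)" "bilinear (H y0)" using C2_bilinear[OF C2 U(1)] xyU by auto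
  have n1: "1 \<le> real CARD('n)" by (simp add: Suc_leI)
  have Lb: "3 * CARD('n) * L * R \<le> 4 * \<mu>"
  proof -
    have "0 \<le> 2 * B * R" using R \<mu> by simp
    then show ?thesis using R(3) by (simp only: distrib_right)
  qed
  have "L * s \<le> \<mu>"
  proof -
    have "L * s \<le> L * (R / 4)" using s4 \<mu> by (intro mult_left_mono) auto
    moreover have "1 * (L * R) \<le> CARD('n) * (L * R)"
      using n1 \<mu> R by (intro mult_right_mono) auto
    moreover have "3 * (CARD('n) * (L * R)) \<le> 4 * \<mu>" using Lb by (simp add: mult.assoc)
    ultimately show ?thesis using \<mu>(1) by simp
  qed
  then have main: "contract (a x0) (H x0) - contract (a y0) (H y0)
      \<le> 3 * CARD('n) * L * k - 8 * \<mu> * k / R + 2 * \<kappa> * B"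
    using kk R by (intro doubling_contract[OF ell x0(2,3) ne _ _ _ _ bil conds(2)]) (auto simp: s_def)
  have lin: "D x 0 = 0" if "x \<in> U" for x
    using C2 that has_derivative_linear linear_0 by (metis C2_derivs_def)
  \<comment> \<open>The derivative \<open>1 - 2 * s / R\<close> of the penalty has modulus at most 1
    on the range of \<open>s\<close>, so that up to the localization term the gradient of
    \<open>u\<close> at both points is of size \<open>k\<close>.\<close>
  have dirbound: "\<bar>(x0 - y0) \<bullet> v / norm (x0 - y0) - 2 * ((x0 - y0) \<bullet> v) / R\<bar> \<le> norm v" for v
  proof -
    have "(x0 - y0) \<bullet> v / norm (x0 - y0) - 2 * ((x0 - y0) \<bullet> v) / R = (x0 - y0) \<bullet> v * (1 / s - 2 / R)"
      by (simp only: s_def right_diff_distrib) simp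
    also have "\<bar>\<dots>\<bar> = \<bar>(x0 - y0) \<bullet> v\<bar> * \<bar>1 / s - 2 / R\<bar>" by (simp add: abs_mult)
    also have "\<dots> \<le> (s * norm v) * (1 / s)"
    proof (rule mult_mono)
      show "\<bar>1 / s - 2 / R\<bar> \<le> 1 / s"
        using spos s4 R by (simp add: abs_if field_simps)
      show "\<bar>(x0 - y0) \<bullet> v\<bar> \<le> s * norm v" unfolding s_def by (rule Cauchy_Schwarz_ineq2)
    qed (use spos in auto)
    finally show ?thesis using spos by simp
  qed
  have bn: "norm (b x0) \<le> B" "norm (b y0) \<le> B" using ell x0 by (auto simp: elliptic_on_def)
  \<comment> \<open>The gradient at one point is read off by moving that point alone, with direction
    0 for the other.\<close>
  have Dx: "\<bar>D x0 (b x0)\<bar> \<le> k * B + 2 * \<kappa> * (R / 4 * B)"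
  proof -
    have eq: "D x0 (b x0) = k * ((x0 - y0) \<bullet> b x0 / norm (x0 - y0) - 2 * ((x0 - y0) \<bullet> b x0) / R)
        + 2 * \<kappa> * ((x0 - z) \<bullet> b x0)"
      using conds(1)[of "b x0" 0] lin[OF xyU(2)] by simp
    have 1: "\<bar>k * ((x0 - y0) \<bullet> b x0 / norm (x0 - y0) - 2 * ((x0 - y0) \<bullet> b x0) / R)\<bar> \<le> k * B"
      unfolding abs_mult using kk bn dirbound[of "b x0"] by (intro mult_mono) auto
    have "\<bar>(x0 - z) \<bullet> b x0\<bar> \<le> norm (x0 - z) * norm (b x0)" by (rule Cauchy_Schwarz_ineq2)
    also have "\<dots> \<le> R / 4 * B" using x0 bn R by (intro mult_mono) auto
    finally have "2 * \<kappa> * \<bar>(x0 - z) \<bullet> b x0\<bar> \<le> 2 * \<kappa> * (R / 4 * B)"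
      using kk by (intro mult_left_mono) auto
    then have 2: "\<bar>2 * \<kappa> * ((x0 - z) \<bullet> b x0)\<bar> \<le> 2 * \<kappa> * (R / 4 * B)"
      using kk by (simp add: abs_mult)
    show ?thesis unfolding eq by (rule order_trans[OF abs_triangle_ineq add_mono[OF 1 2]])
  qed
  have Dy: "\<bar>D y0 (b y0)\<bar> \<le> k * B"
  proof -
    have "- D y0 (b y0) = k * ((x0 - y0) \<bullet> (- b y0) / norm (x0 - y0) - 2 * ((x0 - y0) \<bullet> (- b y0)) / R)"
      using conds(1)[of 0 "b y0"] lin[OF xyU(1)] by simp
    then have "\<bar>D y0 (b y0)\<bar> = \<bar>k * ((x0 - y0) \<bullet> (- b y0) / norm (x0 - y0) - 2 * ((x0 - y0) \<bullet> (- b y0)) / R)\<bar>"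
      by (metis abs_minus_cancel)
    also have "\<dots> \<le> k * B"
      unfolding abs_mult using kk bn dirbound[of "- b y0"] by (intro mult_mono) auto
    finally show ?thesis .
  qed
  have "lam * (u x0 - u y0) \<le> lam * (2 * S)" using u2 lam by (intro mult_left_mono) auto
  moreover have "contract (a x0) (H x0) - contract (a y0) (H y0) =
      - D x0 (b x0) + D y0 (b y0) - lam * (u x0 - u y0)"
    using pde[OF xyU(1)] pde[OF xyU(2)] by (simp add: algebra_simps)
  ultimately have "8 * \<mu> * k / R \<le> 3 * CARD('n) * L * k + 2 * \<kappa> * B + 2 * (k * B) + 2 * \<kappa> * (R / 4 * B) + lam * (2 * S)"
    using main Dx Dy by linarith
  \<comment> \<open>Multiplying by \<open>R\<^sup>2 / S\<close> removes all scales and leaves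
    \<open>8 * \<mu> * N \<le> 4 * \<mu> * N + 80 * B + 2\<close>, contrary to the choice of
    \<open>N\<close>.\<close>
  then have "8 * \<mu> * k / R * (R\<^sup>2 / S) \<le> (3 * CARD('n) * L * k + 2 * \<kappa> * B + 2 * (k * B) + 2 * \<kappa> * (R / 4 * B) + lam * (2 * S)) * (R\<^sup>2 / S)"
    using S R by (intro mult_right_mono) auto
  moreover have "8 * \<mu> * k / R * (R\<^sup>2 / S) = 8 * \<mu> * N"
    using S R by (simp add: k_def power2_eq_square)
  moreover have "(3 * CARD('n) * L * k + 2 * \<kappa> * B + 2 * (k * B) + 2 * \<kappa> * (R / 4 * B) + lam * (2 * S)) * (R\<^sup>2 / S)
      = (3 * CARD('n) * L + 2 * B) * R * N + 64 * B + 16 * R * B + 2 * (lam * R\<^sup>2)"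
    using S R by (simp add: k_def \<kappa>_def power2_eq_square field_simps)
  moreover have "(3 * CARD('n) * L + 2 * B) * R * N \<le> 4 * \<mu> * N"
    using R N by (intro mult_right_mono) auto
  moreover have "R * B \<le> 1 * B" using R \<mu> by (intro mult_right_mono) auto
  ultimately show False using N lam by linarith
qed

text \<open>The one-sided estimate for \<open>u\<close> and for \<open>- u\<close>. The case
  \<open>S = 0\<close> is separate because the doubling constants are multiples of \<open>S\<close>
  and have to be positive.\<close>

theorem lipschitz_estimate:
  fixes a :: "real^'n \<Rightarrow> real^'n^'n" and \<mu> L B R S N lam :: real
  assumes U: "open U" "cball z (R / 2) \<subseteq> U" and sol: "solves_on U a b lam u"
    and ell: "elliptic_on (cball z (R / 2)) a b \<mu> L B"
    and R: "0 < R" "R \<le> 1" "(3 * CARD('n) * L + 2 * B) * R \<le> 4 * \<mu>"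
    and lam: "0 \<le> lam" "lam * R\<^sup>2 \<le> 1"
    and N: "11 \<le> N" "80 * B + 2 < 4 * \<mu> * N"
    and S: "\<And>x. x \<in> cball z (R / 2) \<Longrightarrow> \<bar>u x\<bar> \<le> S"
    and y: "y \<in> cball z (R / 4)"
  shows "\<bar>u z - u y\<bar> \<le> N * S / R * dist z y"
proof (cases "S = 0")
  case True
  then have "u z = 0" "u y = 0" using S[of z] S[of y] y R by auto
  then show ?thesis using True by simp
next
  case False
  have "0 \<le> S" using S[of z] R by auto
  then have S': "0 < S" using False by simp
  have "solves_on U a b lam (\<lambda>x. - u x)" using solves_on_mult[OF sol, of "-1"] by simp
  note * = lipschitz_one_sided[OF U sol ell R lam N S' S y]
    lipschitz_one_sided[OF U this ell R lam N S' _ y]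
  show ?thesis using *(1) *(2) S by simp
qed

section \<open>Mean values and tubes in coordinates\<close>

text \<open>In this section the equation acts only through this scale invariant bound. All radii
  \<open>d \<le> R\<close> are included because the weighted maximum below selects a ball whose
  radius is not known beforehand.\<close>

definition gradient_bounded :: "(real^'n) set \<Rightarrow> real \<Rightarrow> real \<Rightarrow> (real^'n \<Rightarrow> real) \<Rightarrow> bool" where
  "gradient_bounded K R N u \<longleftrightarrow> (\<forall>z d S. 0 < d \<longrightarrow> d \<le> R \<longrightarrow> cball z (d / 2) \<subseteq> K \<longrightarrow>
     (\<forall>x\<in>cball z (d / 2). \<bar>u x\<bar> \<le> S) \<longrightarrow> (\<forall>x\<in>cball z (d / 4). \<bar>u z - u x\<bar> \<le> N * S / d * dist z x))"

lemma gradient_boundedD: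
  assumes "gradient_bounded K R N u" "0 < d" "d \<le> R" "cball z (d / 2) \<subseteq> K"
    "\<And>x. x \<in> cball z (d / 2) \<Longrightarrow> \<bar>u x\<bar> \<le> S" "x \<in> cball z (d / 4)"
  shows "\<bar>u z - u x\<bar> \<le> N * S / d * dist z x"
  using assms unfolding gradient_bounded_def by blast

lemma gradient_bounded_subset: "gradient_bounded K R N u \<Longrightarrow> K' \<subseteq> K \<Longrightarrow> gradient_bounded K' R N u"
  unfolding gradient_bounded_def by blast

text \<open>Around the weighted maximum \<open>\<bar>u\<bar>\<close> keeps at least half of its
  value on a ball whose radius is the base of the second factor times the distance to the boundary.
  The first two factors are its volume up to scaling, the last is the loss in
  \<open>\<bar>u\<bar> powr p\<close>.\<close>

definition mv_const :: "'n::finite itself \<Rightarrow> real \<Rightarrow> real \<Rightarrow> real" where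
  "mv_const _ N p = unit_ball_vol CARD('n) * (1 / (2 ^ Suc CARD('n) * N)) ^ CARD('n) * (1 / 2) powr p"

lemma mv_const_pos: "N > 0 \<Longrightarrow> mv_const TYPE('n::finite) N p > 0"
  by (simp add: mv_const_def)

abbreviation power_integral :: "'a measure \<Rightarrow> real \<Rightarrow> ('a \<Rightarrow> real) \<Rightarrow> 'a set \<Rightarrow> ennreal" where
  "power_integral m p u B \<equiv> \<integral>\<^sup>+x. ennreal (\<bar>u x\<bar> powr p) * indicator B x \<partial>m"

text \<open>The maximum of \<open>(\<rho> - \<bar>y - z\<bar>)\<^sup>n \<bar>u y\<bar>\<^sup>p\<close> is attained at a point around which \<open>\<bar>u\<bar>\<close> exceeds its own value
  by a bounded factor only, so that the gradient bound keeps \<open>\<bar>u\<bar>\<close> comparable to that value on a ball of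
  comparable size.\<close>

lemma mean_value_inequality:
  fixes u :: "real^'n \<Rightarrow> real"
  assumes u: "continuous_on (cball z \<rho>) u" and gb: "gradient_bounded (cball z \<rho>) R N u"
    and \<rho>: "0 < \<rho>" "\<rho> \<le> R" and N: "1 \<le> N" and p: "1 \<le> p"
  shows "ennreal (mv_const TYPE('n) N p * \<rho> ^ CARD('n) * \<bar>u z\<bar> powr p)
    \<le> power_integral lborel p u (cball z \<rho>)"
proof (cases "u z = 0")
  case True
  then show ?thesis by simp
next
  case False
  let ?n = "CARD('n)"
  define h where "h x = (\<rho> - dist z x) ^ ?n * \<bar>u x\<bar> powr p" for x
  have "continuous_on (cball z \<rho>) h"
    unfolding h_def using p by (intro continuous_intros u continuous_on_powr') auto
  then obtain y where y: "y \<in> cball z \<rho>" and mx: "\<And>x. x \<in> cball z \<rho> \<Longrightarrow> h x \<le> h y"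
    using continuous_attains_sup[of "cball z \<rho>" h] \<rho> by auto
  define d m where "d = \<rho> - dist z y" and "m = \<bar>u y\<bar>"
  have hz: "h z = \<rho> ^ ?n * \<bar>u z\<bar> powr p" by (simp add: h_def)
  have hy: "h y = d ^ ?n * m powr p" by (simp add: h_def d_def m_def)
  have "0 < h z" using False \<rho> by (simp add: hz)
  also have zy: "h z \<le> h y" using mx[of z] \<rho> by simp
  finally have hy0: "0 < h y" .
  have "d \<noteq> 0" "m \<noteq> 0" using hy0 by (auto simp: hy power_0_left)
  moreover have "0 \<le> d" using y by (simp add: d_def)
  ultimately have d: "0 < d" and m: "0 < m" by (simp_all add: m_def)
  have dR: "d \<le> R" using \<rho> zero_le_dist[of z y] unfolding d_def by linarith
  have sub: "cball y r \<subseteq> cball z \<rho>" if "r \<le> d" for r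
    using that by (simp add: cball_subset_cball_iff dist_commute d_def)
  have up: "\<bar>u x\<bar> \<le> 2 ^ ?n * m" if x: "x \<in> cball y (d / 2)" for x
  proof -
    have xz: "x \<in> cball z \<rho>" using sub[of "d / 2"] x d by auto
    have "d / 2 \<le> \<rho> - dist z x" using x dist_triangle[of z x y] by (simp add: d_def)
    \<comment> \<open>On the half ball the distance to the outer sphere is still at least
      \<open>d / 2\<close>, so maximality costs the factor \<open>2 ^ ?n\<close> only.\<close>
    then have "(d / 2) ^ ?n * \<bar>u x\<bar> powr p \<le> h x"
      unfolding h_def using d by (intro mult_right_mono power_mono) auto
    also have "\<dots> \<le> h y" by (rule mx[OF xz])
    finally have "\<bar>u x\<bar> powr p \<le> 2 ^ ?n * m powr p"
      using d by (simp add: hy power_divide field_simps)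
    \<comment> \<open>Since \<open>p \<ge> 1\<close> the factor may be raised to the power
      \<open>p\<close>, which makes the bound for \<open>\<bar>u\<bar>\<close> itself independent of
      \<open>p\<close>.\<close>
    also have "\<dots> \<le> (2 ^ ?n) powr p * m powr p"
      using p powr_mono[of 1 p "2 ^ ?n :: real"] by (intro mult_right_mono) auto
    also have "\<dots> = (2 ^ ?n * m) powr p" using m by (simp add: powr_mult)
    finally show ?thesis
      using p m by (metis abs_ge_zero linorder_not_le mult_pos_pos order_less_imp_le order_less_le_trans
          powr_less_mono2 zero_less_numeral zero_less_one zero_less_power)
  qed
  \<comment> \<open>Chosen so that the gradient bound, with \<open>2 ^ ?n * m\<close> in place of
    \<open>S\<close>, lets \<open>\<bar>u\<bar>\<close> fall by at most
    \<open>m / 2\<close>.\<close>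
  define \<epsilon> where "\<epsilon> = 1 / (2 ^ Suc ?n * N)"
  have \<epsilon>: "0 < \<epsilon>" "\<epsilon> \<le> 1 / 4"
  proof -
    have "2 ^ Suc 1 * 1 \<le> (2::real) ^ Suc ?n * N"
      using N by (intro mult_mono power_increasing) (auto simp: Suc_leI)
    then show "\<epsilon> \<le> 1 / 4" by (simp add: \<epsilon>_def divide_simps)
    show "0 < \<epsilon>" using N by (simp add: \<epsilon>_def)
  qed
  have \<epsilon>d: "\<epsilon> * d \<le> d / 4" using mult_right_mono[OF \<epsilon>(2), of d] d by linarith
  have low: "m / 2 \<le> \<bar>u x\<bar>" if x: "x \<in> cball y (\<epsilon> * d)" for x
  proof -
    have "x \<in> cball y (d / 4)" using x \<epsilon>d unfolding mem_cball by linarith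
    then have "\<bar>u y - u x\<bar> \<le> N * (2 ^ ?n * m) / d * dist y x"
      using d by (intro gradient_boundedD[OF gb _ dR] sub up) auto
    also have "\<dots> \<le> N * (2 ^ ?n * m) / d * (\<epsilon> * d)"
      using x N m d by (intro mult_left_mono) auto
    also have "\<dots> = m / 2" using d N by (simp add: \<epsilon>_def)
    finally show ?thesis unfolding m_def by linarith
  qed
  have "ennreal (mv_const TYPE('n) N p * \<rho> ^ ?n * \<bar>u z\<bar> powr p) \<le>
      ennreal ((m / 2) powr p * (unit_ball_vol ?n * (\<epsilon> * d) ^ ?n))"
  proof (rule ennreal_leI)
    have "mv_const TYPE('n) N p * \<rho> ^ ?n * \<bar>u z\<bar> powr p = (unit_ball_vol ?n * \<epsilon> ^ ?n * (1 / 2) powr p) * h z"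
      by (simp add: mv_const_def \<epsilon>_def hz)
    also have "\<dots> \<le> (unit_ball_vol ?n * \<epsilon> ^ ?n * (1 / 2) powr p) * h y"
      using zy \<epsilon> by (intro mult_left_mono) auto
    also have "\<dots> = (m / 2) powr p * (unit_ball_vol ?n * (\<epsilon> * d) ^ ?n)"
      using m by (simp add: hy powr_divide power_mult_distrib field_simps powr_mult)
    finally show "mv_const TYPE('n) N p * \<rho> ^ ?n * \<bar>u z\<bar> powr p \<le> (m / 2) powr p * (unit_ball_vol ?n * (\<epsilon> * d) ^ ?n)" .
  qed
  also have "\<dots> = ennreal ((m / 2) powr p) * emeasure lborel (cball y (\<epsilon> * d))"
    using \<epsilon> d by (simp add: emeasure_cball ennreal_mult)
  also have "\<dots> = (\<integral>\<^sup>+x. ennreal ((m / 2) powr p) * indicator (cball y (\<epsilon> * d)) x \<partial>lborel)"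
    by (subst nn_integral_cmult_indicator) auto
  also have "\<dots> \<le> power_integral lborel p u (cball z \<rho>)"
  proof (rule nn_integral_mono)
    fix x
    show "ennreal ((m / 2) powr p) * indicator (cball y (\<epsilon> * d)) x \<le> ennreal (\<bar>u x\<bar> powr p) * indicator (cball z \<rho>) x"
    proof (cases "x \<in> cball y (\<epsilon> * d)")
      case True
      moreover have "x \<in> cball z \<rho>" using True sub[of "\<epsilon> * d"] \<epsilon>d d by (auto simp del: mem_cball)
      ultimately show ?thesis
        using low[OF True] m p by (simp del: mem_cball) (intro ennreal_leI powr_mono2, auto)
    qed simp
  qed
  finally show ?thesis .
qed

text \<open>Comparing \<open>u x\<close> with the zero \<open>y\<close> by the gradient bound gains
  the factor \<open>N * \<delta> / R\<close> against the maximum over the half ball. The mean value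
  inequality is then applied at the maximum point, with radius \<open>R / 2\<close> so as to stay
  inside \<open>cball x R\<close>.\<close>

lemma near_zero_bound:
  fixes u :: "real^'n \<Rightarrow> real"
  assumes u: "continuous_on (cball x R) u" and gb: "gradient_bounded (cball x R) R N u"
    and R: "0 < R" and N: "1 \<le> N" and p: "1 \<le> p"
    and y: "dist x y \<le> \<delta>" "u y = 0" "\<delta> \<le> R / 4"
  shows "ennreal (\<bar>u x\<bar> powr p) \<le> ennreal ((N * \<delta> / R) powr p / (mv_const TYPE('n) N p * (R / 2) ^ CARD('n)))
     * power_integral lborel p u (cball x R)"
proof -
  let ?I = "\<integral>\<^sup>+t. ennreal (\<bar>u t\<bar> powr p) * indicator (cball x R) t \<partial>lborel"
  let ?c = "mv_const TYPE('n) N p * (R / 2) ^ CARD('n)"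
  have c: "?c > 0" using mv_const_pos[of N, where 'n = 'n] N R by simp
  have "continuous_on (cball x (R / 2)) (\<lambda>t. \<bar>u t\<bar>)"
    using R by (intro continuous_intros continuous_on_subset[OF u]) auto
  then obtain z where z: "z \<in> cball x (R / 2)" and mx: "\<And>t. t \<in> cball x (R / 2) \<Longrightarrow> \<bar>u t\<bar> \<le> \<bar>u z\<bar>"
    using continuous_attains_sup[of "cball x (R / 2)" "\<lambda>t. \<bar>u t\<bar>"] R by auto
  have sub: "cball z (R / 2) \<subseteq> cball x R"
    using z by (simp add: cball_subset_cball_iff dist_commute)
  have "\<bar>u x - u y\<bar> \<le> N * \<bar>u z\<bar> / R * dist x y"
    using R y mx by (intro gradient_boundedD[OF gb]) auto
  also have "\<dots> \<le> N * \<bar>u z\<bar> / R * \<delta>" using y N R by (intro mult_left_mono) auto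
  finally have ux: "\<bar>u x\<bar> \<le> (N * \<delta> / R) * \<bar>u z\<bar>" using y by (simp add: field_simps)
  have "\<bar>u x\<bar> powr p \<le> (N * \<delta> / R) powr p * \<bar>u z\<bar> powr p"
    unfolding powr_mult[symmetric] using p by (intro powr_mono2 ux) auto
  also have "\<dots> = (N * \<delta> / R) powr p / ?c * (?c * \<bar>u z\<bar> powr p)"
    using c by (metis less_irrefl nonzero_eq_divide_eq times_divide_eq_left mult.assoc)
  finally have "ennreal (\<bar>u x\<bar> powr p) \<le> ennreal ((N * \<delta> / R) powr p / ?c) * ennreal (?c * \<bar>u z\<bar> powr p)"
    using c by (subst ennreal_mult[symmetric]) (auto intro: ennreal_leI)
  also have "\<dots> \<le> ennreal ((N * \<delta> / R) powr p / ?c) * ?I"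
  proof (rule mult_left_mono)
    have "ennreal (?c * \<bar>u z\<bar> powr p) \<le> power_integral lborel p u (cball z (R / 2))"
      using R by (intro mean_value_inequality[of _ _ _ R] N p continuous_on_subset[OF u sub]
          gradient_bounded_subset[OF gb sub]) auto
    also have "\<dots> \<le> ?I"
      by (intro nn_integral_mono mult_left_mono) (use sub in \<open>auto simp: indicator_def subset_iff\<close>)
    finally show "ennreal (?c * \<bar>u z\<bar> powr p) \<le> ?I" .
  qed simp
  finally show ?thesis .
qed

text \<open>The volume of a ball of radius \<open>R\<close> divided by \<open>mv_const\<close> times
  \<open>(R / 2) ^ CARD('n)\<close>; the radius cancels, so that tubes at all scales share one
  constant.\<close>

definition tube_const :: "'n::finite itself \<Rightarrow> real \<Rightarrow> real \<Rightarrow> real" where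
  "tube_const _ N p = unit_ball_vol CARD('n) * 2 ^ CARD('n) / mv_const TYPE('n) N p"

text \<open>The pointwise bound is integrated and the order of integration exchanged:
  \<open>cball x R\<close> is \<open>cball 0 R\<close> shifted by \<open>x\<close>, and for each
  \<open>h\<close> the integral of \<open>f (h + x)\<close> over \<open>x\<close> is the whole
  integral of \<open>f\<close>. Averaging over balls therefore costs just the volume of one
  ball.\<close>

lemma tube_integral_bound:
  fixes u :: "real^'n \<Rightarrow> real"
  assumes u: "continuous_on (cball x0 (2 * \<rho>)) u" and gb: "gradient_bounded (cball x0 (2 * \<rho>)) R N u"
    and R: "0 < R" "R \<le> \<rho>" and N: "1 \<le> N" and p: "1 \<le> p"
    and T: "T \<in> sets borel" "T \<subseteq> cball x0 \<rho>" "\<And>x. x \<in> T \<Longrightarrow> \<exists>y. dist x y \<le> \<delta> \<and> u y = 0"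
    and \<delta>: "0 \<le> \<delta>" "\<delta> \<le> R / 4"
  shows "power_integral lborel p u T
    \<le> ennreal (tube_const TYPE('n) N p * (N * \<delta> / R) powr p)
       * power_integral lborel p u (cball x0 (2 * \<rho>))"
proof -
  let ?c = "mv_const TYPE('n) N p * (R / 2) ^ CARD('n)"
  define k where "k = (N * \<delta> / R) powr p / ?c"
  have c: "?c > 0" "mv_const TYPE('n) N p > 0" using mv_const_pos[of N, where 'n = 'n] N R by simp_all
  \<comment> \<open>Cut off by zero, so that shifts are defined everywhere and the invariance of
    Lebesgue measure applies.\<close>
  define f where "f x = ennreal (\<bar>u x\<bar> powr p) * indicator (cball x0 (2 * \<rho>)) x" for x
  have [measurable]: "cball x r \<in> sets (borel :: (real^'n) measure)" for x r
    by simp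
  have "f \<in> borel_measurable borel"
  proof -
    have "(\<lambda>x. indicator (cball x0 (2 * \<rho>)) x *\<^sub>R u x) \<in> borel_measurable borel"
      using u by (intro borel_measurable_continuous_on_indicator) auto
    then have "(\<lambda>x. ennreal (\<bar>indicator (cball x0 (2 * \<rho>)) x *\<^sub>R u x\<bar> powr p) * indicator (cball x0 (2 * \<rho>)) x) \<in> borel_measurable borel"
      by measurable
    also have "(\<lambda>x. ennreal (\<bar>indicator (cball x0 (2 * \<rho>)) x *\<^sub>R u x\<bar> powr p) * indicator (cball x0 (2 * \<rho>)) x) = f"
      by (auto simp: f_def fun_eq_iff indicator_def)
    finally show ?thesis .
  qed
  note [measurable] = this
  have shift: "(\<integral>\<^sup>+x. f (h + x) \<partial>lborel) = (\<integral>\<^sup>+x. f x \<partial>lborel)" for h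
    by (subst (2) lborel_distr_plus[symmetric, of h]) (simp add: nn_integral_distr)
  have pt: "ennreal (\<bar>u x\<bar> powr p) * indicator T x
      \<le> ennreal k * (\<integral>\<^sup>+h. indicator (cball (0::real^'n) R) h * f (h + x) \<partial>lborel)" for x
  proof (cases "x \<in> T")
    case True
    have "dist x0 x \<le> \<rho>" using T True by auto
    then have sub: "cball x R \<subseteq> cball x0 (2 * \<rho>)"
      using R by (simp add: cball_subset_cball_iff dist_commute)
    obtain y where "dist x y \<le> \<delta>" "u y = 0" using T True by blast
    then have "ennreal (\<bar>u x\<bar> powr p) \<le> ennreal k * power_integral lborel p u (cball x R)"
      unfolding k_def using \<delta>
      by (intro near_zero_bound R N p continuous_on_subset[OF u sub] gradient_bounded_subset[OF gb sub]) auto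
    also have "power_integral lborel p u (cball x R) = (\<integral>\<^sup>+t. indicator (cball x R) t * f t \<partial>lborel)"
      by (intro nn_integral_cong) (use sub in \<open>auto simp: f_def indicator_def subset_iff\<close>)
    also have "\<dots> = (\<integral>\<^sup>+h. indicator (cball x R) (x + h) * f (x + h) \<partial>lborel)"
      by (subst lborel_distr_plus[symmetric, of x]) (simp add: nn_integral_distr)
    also have "\<dots> = (\<integral>\<^sup>+h. indicator (cball (0::real^'n) R) h * f (h + x) \<partial>lborel)"
      by (intro nn_integral_cong) (auto simp: indicator_def dist_norm add.commute)
    finally show ?thesis using True by simp
  qed simp
  have "power_integral lborel p u T
      \<le> (\<integral>\<^sup>+x. ennreal k * (\<integral>\<^sup>+h. indicator (cball (0::real^'n) R) h * f (h + x) \<partial>lborel) \<partial>lborel)"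
    by (intro nn_integral_mono pt)
  also have "\<dots> = ennreal k * (\<integral>\<^sup>+x. (\<integral>\<^sup>+h. indicator (cball (0::real^'n) R) h * f (h + x) \<partial>lborel) \<partial>lborel)"
    by (intro nn_integral_cmult) measurable
  also have "(\<integral>\<^sup>+x. (\<integral>\<^sup>+h. indicator (cball (0::real^'n) R) h * f (h + x) \<partial>lborel) \<partial>lborel)
      = (\<integral>\<^sup>+h. (\<integral>\<^sup>+x. indicator (cball (0::real^'n) R) h * f (h + x) \<partial>lborel) \<partial>lborel)"
    by (intro lborel_pair.Fubini') measurable
  also have "\<dots> = (\<integral>\<^sup>+h. indicator (cball (0::real^'n) R) h * (\<integral>\<^sup>+x. f x \<partial>lborel) \<partial>lborel)"
    by (intro nn_integral_cong) (simp add: nn_integral_cmult shift)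
  also have "(\<integral>\<^sup>+h. indicator (cball (0::real^'n) R) h * (\<integral>\<^sup>+x. f x \<partial>lborel) \<partial>lborel) = emeasure lborel (cball (0::real^'n) R) * (\<integral>\<^sup>+x. f x \<partial>lborel)"
    by (subst nn_integral_multc) auto
  also have "emeasure lborel (cball (0::real^'n) R) = ennreal (unit_ball_vol CARD('n) * R ^ CARD('n))"
    using R by (simp add: emeasure_cball)
  also have "ennreal k * (ennreal (unit_ball_vol CARD('n) * R ^ CARD('n)) * (\<integral>\<^sup>+x. f x \<partial>lborel))
      = ennreal (k * (unit_ball_vol CARD('n) * R ^ CARD('n))) * (\<integral>\<^sup>+x. f x \<partial>lborel)"
  proof -
    have "0 \<le> k" "0 \<le> unit_ball_vol CARD('n) * R ^ CARD('n)" using c R by (simp_all add: k_def)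
    then show ?thesis by (simp only: ennreal_mult mult.assoc)
  qed
  also have "k * (unit_ball_vol CARD('n) * R ^ CARD('n)) = tube_const TYPE('n) N p * (N * \<delta> / R) powr p"
    using c R by (simp add: k_def tube_const_def power_divide)
  finally show ?thesis unfolding f_def .
qed

section \<open>Hopf's barrier\<close>

lemma C2_local_max:
  assumes C2: "C2_derivs U f D H" and U: "open U" "x \<in> U"
    and W: "open W" "x \<in> W" "\<And>y. y \<in> W \<Longrightarrow> f y \<le> f x"
  shows "D x v = 0" "H x v v \<le> 0"
proof -
  have "open ((\<lambda>t. x + t *\<^sub>R v) -` (U \<inter> W))"
    by (intro open_vimage open_Int U W continuous_intros)
  moreover have "0 \<in> (\<lambda>t. x + t *\<^sub>R v) -` (U \<inter> W)" using U W by simp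
  ultimately obtain e where e: "e > 0" "ball 0 e \<subseteq> (\<lambda>t. x + t *\<^sub>R v) -` (U \<inter> W)"
    by (meson open_contains_ball)
  then have in_UW: "x + t *\<^sub>R v \<in> U" "x + t *\<^sub>R v \<in> W" if "\<bar>t\<bar> < e" for t
    using that by (auto simp: subset_iff)
  have "((\<lambda>t. D (x + t *\<^sub>R v) v) has_real_derivative H x v v) (at 0)"
    using C2_line(2)[OF C2, of x 0 v] U by simp
  note second_derivative_test[OF e(1) C2_line(1)[OF C2 in_UW(1)] this]
  then show "D x v = 0" "H x v v \<le> 0" using W(3)[OF in_UW(2)] by simp_all
qed

lemma elliptic_on_psd:
  assumes "elliptic_on K a b \<mu> L B" "x \<in> K"
  shows "psd (a x)"
proof -
  have "transpose (a x) = a x" "2 * \<mu> * (v \<bullet> v) \<le> v \<bullet> (a x *v v)" "0 < \<mu>" for v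
    using assms by (auto simp: elliptic_on_def)
  moreover from this have "0 \<le> v \<bullet> (a x *v v)" for v
    using order_trans[of 0 "2 * \<mu> * (v \<bullet> v)"] by simp
  ultimately show ?thesis by (simp add: psd_def)
qed

lemma maximum_principle:
  assumes C2: "C2_derivs U f D H" and U: "open U" "x \<in> U" and psd: "psd (a x)"
    and W: "open W" "x \<in> W" "\<And>y. y \<in> W \<Longrightarrow> f y \<le> f x"
  shows "contract (a x) (H x) + D x (b x) \<le> 0"
proof -
  have "contract (a x) (H x) \<le> 0"
    using C2_local_max(2)[OF assms(1-3,5-7)]
    by (intro contract_psd_nonpos psd C2_bilinear[OF C2 U])
  moreover have "D x (b x) = 0" using C2_local_max(1)[OF assms(1-3,5-7)] .
  ultimately show ?thesis by simp
qed

text \<open>At a maximum the elliptic part is nonpositive, so the equation fixes the sign of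
  \<open>lam * u x\<close>. Applied to \<open>- u\<close> at a minimum, it shows that an
  eigenfunction is nonpositive somewhere without integrating it over the manifold.\<close>

lemma local_max_nonneg:
  assumes "solves_on U a b lam u" "open U" "x \<in> U" "psd (a x)" "0 < lam"
    and "\<And>y. y \<in> U \<Longrightarrow> u y \<le> u x"
  shows "0 \<le> u x"
proof -
  obtain D H where C2: "C2_derivs U u D H"
    and pde: "\<And>x. x \<in> U \<Longrightarrow> contract (a x) (H x) + D x (b x) + lam * u x = 0"
    using assms by (auto simp: solves_on_def)
  have "contract (a x) (H x) + D x (b x) \<le> 0"
    using assms by (intro maximum_principle[OF C2, where W = U and a = a and x = x]) auto
  then have "0 \<le> lam * u x" using pde[of x] assms by simp
  then show ?thesis using assms by (simp add: zero_le_mult_iff)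
qed

definition gauss_bump :: "real \<Rightarrow> real^'n \<Rightarrow> real^'n \<Rightarrow> real" where
  "gauss_bump \<alpha> z y = exp (- \<alpha> * ((y - z) \<bullet> (y - z)))"

lemma gauss_bump_C2:
  "C2_derivs UNIV (gauss_bump \<alpha> z) (\<lambda>y v. gauss_bump \<alpha> z y * (- 2 * \<alpha> * ((y - z) \<bullet> v)))
    (\<lambda>y v w. gauss_bump \<alpha> z y * (4 * \<alpha>\<^sup>2 * (((y - z) \<bullet> v) * ((y - z) \<bullet> w)) - 2 * \<alpha> * (v \<bullet> w)))"
  unfolding C2_derivs_def
proof (intro conjI allI ballI)
  fix y
  show *: "(gauss_bump \<alpha> z has_derivative (\<lambda>v. gauss_bump \<alpha> z y * (- 2 * \<alpha> * ((y - z) \<bullet> v)))) (at y)" for y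
    unfolding gauss_bump_def[abs_def]
    by (auto intro!: derivative_eq_intros simp: inner_commute algebra_simps)
  fix v
  show "((\<lambda>y. gauss_bump \<alpha> z y * (- 2 * \<alpha> * ((y - z) \<bullet> v))) has_derivative
      (\<lambda>w. gauss_bump \<alpha> z y * (4 * \<alpha>\<^sup>2 * (((y - z) \<bullet> v) * ((y - z) \<bullet> w)) - 2 * \<alpha> * (v \<bullet> w)))) (at y)"
    by (auto intro!: derivative_eq_intros * simp: inner_commute algebra_simps power2_eq_square)
qed

lemma contract_rank_one: "contract Q (\<lambda>v w. (d \<bullet> v) * (d \<bullet> w)) = d \<bullet> (Q *v d)"
proof -
  have "d \<bullet> axis i 1 = d $ i" for i by (simp add: inner_axis)
  then show ?thesis
    by (simp add: contract_def) (simp add: matrix_vector_mult_def inner_vec_def sum_distrib_left mult_ac)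
qed

text \<open>Hopf's barrier: on the annulus \<open>\<eta> \<le> \<bar>y - z\<bar> \<le> 3\<rho>\<close> the Gaussian is a strict subsolution once \<open>\<alpha>\<close> is
  large, and \<open>1 - u\<close> is a supersolution up to the error \<open>lam\<close>.\<close>

lemma barrier:
  fixes a :: "real^'n \<Rightarrow> real^'n^'n" and \<mu> L B \<rho> \<eta> \<alpha> t lam :: real
  assumes U: "open U" "cball z (3 * \<rho>) \<subseteq> U" and sol: "solves_on U a b lam u"
    and ell: "elliptic_on (cball z (3 * \<rho>)) a b \<mu> L B"
    and \<rho>: "0 < \<eta>" "\<eta> \<le> \<rho>" and \<alpha>: "0 < \<alpha>" "2 * B + 6 * B * \<rho> + 1 \<le> 8 * \<alpha> * \<mu> * \<eta>\<^sup>2"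
    and u: "\<And>y. y \<in> cball z (3 * \<rho>) \<Longrightarrow> u y \<le> 1" "\<And>y. y \<in> cball z \<eta> \<Longrightarrow> u y \<le> 1 - t"
    and t: "0 < t" and lam: "0 \<le> lam" "lam < t * (\<alpha> * exp (- \<alpha> * (3 * \<rho>)\<^sup>2))"
    and y: "y \<in> cball z (2 * \<rho>)"
  shows "u y \<le> 1 - t * (exp (- \<alpha> * (2 * \<rho>)\<^sup>2) - exp (- \<alpha> * (3 * \<rho>)\<^sup>2))"
proof -
  obtain D H where C2: "C2_derivs U u D H"
    and pde: "\<And>x. x \<in> U \<Longrightarrow> contract (a x) (H x) + D x (b x) + lam * u x = 0"
    using sol by (auto simp: solves_on_def)
  define e3 where "e3 = exp (- \<alpha> * (3 * \<rho>)\<^sup>2)"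
  define w where "w = gauss_bump \<alpha> z"
  define Dw where "Dw y v = w y * (- 2 * \<alpha> * ((y - z) \<bullet> v))" for y v
  define Hw where "Hw y v v' = w y * (4 * \<alpha>\<^sup>2 * (((y - z) \<bullet> v) * ((y - z) \<bullet> v')) - 2 * \<alpha> * (v \<bullet> v'))" for y v v'
  have C2w: "C2_derivs UNIV w Dw Hw"
    using gauss_bump_C2[of \<alpha> z] by (simp add: w_def Dw_def[abs_def] Hw_def[abs_def])
  have w_eq: "w y = exp (- \<alpha> * (norm (y - z))\<^sup>2)" for y
    by (simp add: w_def gauss_bump_def dot_square_norm)
  \<comment> \<open>The barrier \<open>t * (w y - e3)\<close> vanishes on the outer sphere and is at
    most \<open>t\<close> on the inner one, where \<open>1 - u\<close> is at least \<open>t\<close>;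
    so a positive maximum of \<open>f\<close> over the annulus would be interior.\<close>
  define f where "f y = t * (w y - e3) - (1 - u y)" for y
  have C2f: "C2_derivs U f (\<lambda>x v. t * Dw x v + D x v) (\<lambda>x v v'. t * Hw x v v' + H x v v')"
    using C2 C2w unfolding C2_derivs_def f_def
    by (auto intro!: derivative_eq_intros has_derivative_add has_derivative_mult_right)
  have \<rho>0: "0 < \<rho>" using \<rho> by simp
  have fle: "f x \<le> 0" if x: "\<eta> \<le> dist z x" "dist z x \<le> 3 * \<rho>" for x
  proof -
    define Z where "Z = cball z (3 * \<rho>) \<inter> {y. \<eta> \<le> dist z y}"
    have ZU: "Z \<subseteq> U" using U by (auto simp: Z_def)
    have "compact Z" unfolding Z_def
      by (intro compact_Int_closed closed_Collect_le continuous_intros) auto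
    moreover have "x \<in> Z" using x by (simp add: Z_def)
    moreover have "continuous_on Z f"
      using C2_continuous_on[OF C2f] ZU by (rule continuous_on_subset)
    ultimately obtain y where y: "y \<in> Z" and mx: "\<And>x. x \<in> Z \<Longrightarrow> f x \<le> f y"
      using continuous_attains_sup[of Z f] by blast
    have "f y \<le> 0"
    proof (rule ccontr)
      assume "\<not> f y \<le> 0"
      then have fy: "0 < f y" by simp
      have yc: "y \<in> cball z (3 * \<rho>)" using y by (simp add: Z_def)
      have e3: "0 < e3" by (simp add: e3_def)
      have "dist z y \<noteq> \<eta>"
      proof
        assume "dist z y = \<eta>"
        then have "u y \<le> 1 - t" using u(2) by simp
        moreover have "w y \<le> 1" using \<alpha> by (simp add: w_eq)
        moreover from this e3 have "t * (w y - e3) \<le> t * 1"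
          using t by (intro mult_left_mono) linarith+
        ultimately have "f y \<le> 0" by (simp add: f_def)
        then show False using fy by simp
      qed
      moreover have "dist z y \<noteq> 3 * \<rho>"
      proof
        assume "dist z y = 3 * \<rho>"
        then have "w y = e3" by (simp add: w_eq e3_def dist_norm norm_minus_commute)
        then have "f y \<le> 0" using u(1)[OF yc] by (simp add: f_def)
        then show False using fy by simp
      qed
      ultimately have yin: "\<eta> < dist z y" "dist z y < 3 * \<rho>" using y by (auto simp: Z_def)
      define W where "W = {y. \<eta> < dist z y} \<inter> {y. dist z y < 3 * \<rho>}"
      have W: "open W" "y \<in> W" unfolding W_def using yin
        by (auto intro!: open_Int open_Collect_less continuous_intros)
      have WZ: "f x \<le> f y" if "x \<in> W" for x using mx[of x] that by (simp add: W_def Z_def)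
      have "psd (a y)" by (rule elliptic_on_psd[OF ell yc])
      then have M: "contract (a y) (\<lambda>v v'. t * Hw y v v' + H y v v') + (t * Dw y (b y) + D y (b y)) \<le> 0"
        using y ZU WZ by (intro maximum_principle[OF C2f U(1) _ _ W]) auto
      have yU: "y \<in> U" using y ZU by auto
      have Lu: "contract (a y) (H y) + D y (b y) \<ge> - lam"
        using pde[OF yU] mult_left_mono[OF u(1)[OF yc] lam(1)] by simp
      have ay: "2 * \<mu> * ((y - z) \<bullet> (y - z)) \<le> (y - z) \<bullet> (a y *v (y - z))" "trace (a y) \<le> B" "norm (b y) \<le> B"
          "0 < \<mu>" "0 \<le> B"
        using ell yc by (auto simp: elliptic_on_def)
      have "contract (a y) (Hw y) = w y * (4 * \<alpha>\<^sup>2 * ((y - z) \<bullet> (a y *v (y - z))) - 2 * \<alpha> * trace (a y))"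
        unfolding Hw_def by (simp add: contract_mult2 contract_diff2 contract_rank_one contract_inner)
      moreover have "4 * \<alpha>\<^sup>2 * (2 * \<mu> * \<eta>\<^sup>2) \<le> 4 * \<alpha>\<^sup>2 * ((y - z) \<bullet> (a y *v (y - z)))"
      proof (intro mult_left_mono order_trans[OF _ ay(1)])
        show "\<eta>\<^sup>2 \<le> (y - z) \<bullet> (y - z)"
          using yin \<rho> by (simp add: dot_square_norm dist_norm norm_minus_commute power_mono)
      qed (use ay in auto)
      moreover have "2 * \<alpha> * trace (a y) \<le> 2 * \<alpha> * B" using ay \<alpha> by simp
      moreover from calculation(2,3) have "8 * \<alpha>\<^sup>2 * \<mu> * \<eta>\<^sup>2 - 2 * \<alpha> * B
          \<le> 4 * \<alpha>\<^sup>2 * ((y - z) \<bullet> (a y *v (y - z))) - 2 * \<alpha> * trace (a y)"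
        by linarith
      ultimately have 1: "contract (a y) (Hw y) \<ge> w y * (8 * \<alpha>\<^sup>2 * \<mu> * \<eta>\<^sup>2 - 2 * \<alpha> * B)"
        by (metis w_eq exp_ge_zero mult_left_mono)
      have "(y - z) \<bullet> b y \<le> norm (y - z) * norm (b y)" by (rule norm_cauchy_schwarz)
      also have "\<dots> \<le> 3 * \<rho> * B"
        using yin ay \<rho>0 by (intro mult_mono) (auto simp: dist_norm norm_minus_commute)
      finally have "(y - z) \<bullet> b y \<le> 3 * \<rho> * B" .
      then have "2 * \<alpha> * ((y - z) \<bullet> b y) \<le> 2 * \<alpha> * (3 * \<rho> * B)"
        using \<alpha> by (intro mult_left_mono) auto
      then have 2: "Dw y (b y) \<ge> w y * (- (2 * \<alpha> * (3 * \<rho> * B)))"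
        unfolding Dw_def by (intro mult_left_mono) (linarith, simp add: w_eq)
      have "norm (y - z) \<le> 3 * \<rho>" using yin by (simp add: dist_norm norm_minus_commute)
      then have "\<alpha> * (norm (y - z))\<^sup>2 \<le> \<alpha> * (3 * \<rho>)\<^sup>2" using \<alpha> by (intro mult_left_mono power_mono) auto
      then have "e3 \<le> w y" by (simp add: w_eq e3_def)
      \<comment> \<open>The hypothesis on \<alpha> says that the bracket is at least 1, so the
        operator applied to \<open>w\<close> yields at least \<open>e3 * \<alpha>\<close>.\<close>
      then have "e3 * \<alpha> \<le> w y * (\<alpha> * (8 * \<alpha> * \<mu> * \<eta>\<^sup>2 - 2 * B - 6 * B * \<rho>))"
        using \<alpha> e3 by (intro mult_mono) auto
      also have "\<dots> = w y * (8 * \<alpha>\<^sup>2 * \<mu> * \<eta>\<^sup>2 - 2 * \<alpha> * B) + w y * (- (2 * \<alpha> * (3 * \<rho> * B)))"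
        by (simp add: algebra_simps power2_eq_square)
      also have "\<dots> \<le> contract (a y) (Hw y) + Dw y (b y)" using 1 2 by simp
      finally have "t * (e3 * \<alpha>) \<le> t * (contract (a y) (Hw y) + Dw y (b y))"
        using t by simp
      then have "t * (e3 * \<alpha>) \<le> lam"
        using M Lu by (simp add: contract_add2 contract_mult2 algebra_simps)
      then show False using lam by (simp add: e3_def mult.commute)
    qed
    then show ?thesis using mx[OF \<open>x \<in> Z\<close>] by simp
  qed
  have e23: "0 \<le> exp (- \<alpha> * (2 * \<rho>)\<^sup>2) - e3"
    using \<alpha> \<rho> by (simp add: e3_def power_mono)
  show ?thesis
  proof (cases "dist z y \<le> \<eta>")
    case True
    \<comment> \<open>In the small ball the assumption \<open>u y \<le> 1 - t\<close> is already
      stronger, since the difference of the exponentials is at most 1.\<close>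
    have "exp (- \<alpha> * (2 * \<rho>)\<^sup>2) \<le> 1" "0 < e3" using \<alpha> by (auto simp: e3_def)
    then have "t * (exp (- \<alpha> * (2 * \<rho>)\<^sup>2) - e3) \<le> t * 1"
      using t by (intro mult_left_mono) linarith+
    then show ?thesis using u(2)[of y] True by (simp add: e3_def)
  next
    case False
    have "norm (y - z) \<le> 2 * \<rho>" using y by (simp add: dist_norm norm_minus_commute)
    then have "\<alpha> * (norm (y - z))\<^sup>2 \<le> \<alpha> * (2 * \<rho>)\<^sup>2" using \<alpha> by (intro mult_left_mono power_mono) auto
    then have "exp (- \<alpha> * (2 * \<rho>)\<^sup>2) \<le> w y" by (simp add: w_eq)
    then have "t * (exp (- \<alpha> * (2 * \<rho>)\<^sup>2) - e3) \<le> t * (w y - e3)" using t by simp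
    then show ?thesis using fle[of y] False y \<rho>0 by (simp add: f_def e3_def)
  qed
qed

section \<open>The Laplace--Beltrami operator in a chart\<close>

text \<open>Continuity is asked for each fixed direction, which in finite dimension amounts to
  continuity of the derivative and passes through the rules below without operator norms.\<close>

definition C1_fun :: "'a::real_normed_vector set \<Rightarrow> ('a \<Rightarrow> 'b::real_normed_vector) \<Rightarrow> bool" where
  "C1_fun U f \<longleftrightarrow> (\<exists>f'. (\<forall>x\<in>U. (f has_derivative f' x) (at x)) \<and> (\<forall>v. continuous_on U (\<lambda>x. f' x v)))"

lemma C1_funI:
  "(\<And>x. x \<in> U \<Longrightarrow> (f has_derivative f' x) (at x)) \<Longrightarrow> (\<And>v. continuous_on U (\<lambda>x. f' x v)) \<Longrightarrow> C1_fun U f"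
  by (auto simp: C1_fun_def)

lemma smooth_on_C1:
  assumes "smooth_on U f"
  shows "C1_fun U f"
proof -
  have "C_on (Suc 0) U f" using assms by (simp only: smooth_on_def)
  then show ?thesis by (auto intro!: C1_funI simp: frechet_derivative_works)
qed

lemma C1_fun_continuous: "C1_fun U f \<Longrightarrow> continuous_on U f"
  by (meson C1_fun_def continuous_at_imp_continuous_on has_derivative_continuous)

lemma C1_fun_const: "C1_fun U (\<lambda>x. c)"
  by (rule C1_funI[of _ _ "\<lambda>x v. 0"]) auto

lemma C1_fun_bounded_linear:
  assumes "bounded_linear h" "C1_fun U f"
  shows "C1_fun U (\<lambda>x. h (f x))"
proof -
  obtain f' where f: "\<forall>x\<in>U. (f has_derivative f' x) (at x)" "\<forall>v. continuous_on U (\<lambda>x. f' x v)"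
    using assms(2) by (auto simp: C1_fun_def)
  show ?thesis
    using f by (intro C1_funI[of _ _ "\<lambda>x v. h (f' x v)"])
      (auto intro!: bounded_linear.has_derivative[OF assms(1)] bounded_linear.continuous_on[OF assms(1)])
qed

lemma C1_fun_mult:
  fixes f g :: "_ \<Rightarrow> real"
  assumes "C1_fun U f" "C1_fun U g"
  shows "C1_fun U (\<lambda>x. f x * g x)"
proof -
  obtain f' g' where f: "\<forall>x\<in>U. (f has_derivative f' x) (at x)" "\<forall>v. continuous_on U (\<lambda>x. f' x v)"
    and g: "\<forall>x\<in>U. (g has_derivative g' x) (at x)" "\<forall>v. continuous_on U (\<lambda>x. g' x v)"
    using assms by (auto simp: C1_fun_def)
  have c: "continuous_on U f" "continuous_on U g" using assms by (auto intro: C1_fun_continuous)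
  show ?thesis
    by (rule C1_funI[of _ _ "\<lambda>x v. f x * g' x v + f' x v * g x"])
      (use f g c in \<open>auto intro!: has_derivative_mult continuous_intros\<close>)
qed

lemma C1_fun_sum:
  fixes f :: "'i \<Rightarrow> 'a::real_normed_vector \<Rightarrow> real"
  assumes "\<And>i. i \<in> I \<Longrightarrow> C1_fun U (f i)"
  shows "C1_fun U (\<lambda>x. \<Sum>i\<in>I. f i x)"
proof -
  obtain f' where f: "\<And>i. i \<in> I \<Longrightarrow> (\<forall>x\<in>U. (f i has_derivative f' i x) (at x)) \<and> (\<forall>v. continuous_on U (\<lambda>x. f' i x v))"
    using assms unfolding C1_fun_def by metis
  show ?thesis
    by (rule C1_funI[of _ _ "\<lambda>x v. \<Sum>i\<in>I. f' i x v"])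
      (use f in \<open>auto intro!: has_derivative_sum continuous_on_sum\<close>)
qed

lemma C1_fun_prod:
  fixes f :: "'i \<Rightarrow> 'a::real_normed_vector \<Rightarrow> real"
  assumes "\<And>i. i \<in> I \<Longrightarrow> C1_fun U (f i)"
  shows "C1_fun U (\<lambda>x. \<Prod>i\<in>I. f i x)"
  using assms
  by (induction I rule: infinite_finite_induct) (auto intro: C1_fun_const C1_fun_mult)

lemma C1_fun_compose_real:
  fixes f :: "_ \<Rightarrow> real"
  assumes "C1_fun U f" "\<And>x. x \<in> U \<Longrightarrow> (h has_real_derivative h' (f x)) (at (f x))"
    "continuous_on (f ` U) h'"
  shows "C1_fun U (\<lambda>x. h (f x))"
proof -
  obtain f' where f: "\<forall>x\<in>U. (f has_derivative f' x) (at x)" "\<forall>v. continuous_on U (\<lambda>x. f' x v)"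
    using assms by (auto simp: C1_fun_def)
  show ?thesis
  proof (rule C1_funI[of _ _ "\<lambda>x v. h' (f x) * f' x v"])
    fix x assume "x \<in> U"
    then show "((\<lambda>x. h (f x)) has_derivative (\<lambda>v. h' (f x) * f' x v)) (at x)"
      using f diff_chain_at[of f "f' x" x h "(*) (h' (f x))"] assms(2)[of x]
      by (auto simp: has_field_derivative_def o_def)
  next
    fix v show "continuous_on U (\<lambda>x. h' (f x) * f' x v)"
      using f by (intro continuous_intros continuous_on_compose2[OF assms(3)] C1_fun_continuous[OF assms(1)]) auto
  qed
qed

lemma C1_fun_det:
  fixes f :: "'a::real_normed_vector \<Rightarrow> real^'n^'n"
  assumes "\<And>i j. C1_fun U (\<lambda>x. f x $ i $ j)"
  shows "C1_fun U (\<lambda>x. det (f x))"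
  unfolding det_def by (intro C1_fun_sum C1_fun_mult C1_fun_prod C1_fun_const assms)

lemma C1_fun_entry:
  fixes f :: "'a::real_normed_vector \<Rightarrow> real^'n^'m"
  assumes "C1_fun U f"
  shows "C1_fun U (\<lambda>x. f x $ i $ j)"
  by (intro C1_fun_bounded_linear[OF bounded_linear_vec_nth] assms)

lemma C1_fun_divide:
  fixes f g :: "_ \<Rightarrow> real"
  assumes "C1_fun U f" "C1_fun U g" "\<And>x. x \<in> U \<Longrightarrow> g x \<noteq> 0"
  shows "C1_fun U (\<lambda>x. f x / g x)"
proof -
  have "C1_fun U (\<lambda>x. inverse (g x))"
  proof (rule C1_fun_compose_real[OF assms(2), where h' = "\<lambda>t. - (inverse t ^ Suc (Suc 0))"])
    show "(inverse has_real_derivative - (inverse (g x) ^ Suc (Suc 0))) (at (g x))" if "x \<in> U" for x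
      using assms(3)[OF that] by (rule DERIV_inverse)
    show "continuous_on (g ` U) (\<lambda>t. - (inverse t ^ Suc (Suc 0)))"
      using assms(3) by (intro continuous_intros) auto
  qed
  then show ?thesis unfolding divide_inverse by (intro C1_fun_mult assms)
qed

lemma C1_fun_sqrt:
  assumes "C1_fun U f" "\<And>x. x \<in> U \<Longrightarrow> 0 < f x"
  shows "C1_fun U (\<lambda>x. sqrt (f x))"
proof (rule C1_fun_compose_real[OF assms(1), where h' = "\<lambda>t. inverse (sqrt t) / 2"])
  show "(sqrt has_real_derivative inverse (sqrt (f x)) / 2) (at (f x))" if "x \<in> U" for x
    using assms(2)[OF that] by (rule DERIV_real_sqrt)
  show "continuous_on (f ` U) (\<lambda>t. inverse (sqrt t) / 2)"
    using assms(2) by (intro continuous_intros) force+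
qed

section \<open>Inverses of positive definite matrices\<close>

lemma matrix_inv_right_left:
  assumes "invertible (P :: real^'n^'n)"
  shows "P ** matrix_inv P = mat 1" "matrix_inv P ** P = mat 1"
  using someI_ex[of "\<lambda>Q. P ** Q = mat 1 \<and> Q ** P = mat 1"] assms
  by (auto simp: matrix_inv_def invertible_def)

text \<open>Cramer's rule for the columns of the inverse. It makes every entry a quotient of
  determinants and thereby accessible to the rules for C1 functions.\<close>

lemma matrix_inv_entry:
  fixes P :: "real^'n^'n"
  assumes "det P \<noteq> 0"
  shows "matrix_inv P $ k $ l = det (\<chi> i j. if j = k then axis l 1 $ i else P $ i $ j) / det P"
proof -
  have "invertible P" using assms by (simp add: invertible_det_nz)
  then have "P *v (matrix_inv P *v axis l 1) = axis l 1"
    by (simp add: matrix_vector_mul_assoc matrix_inv_right_left)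
  then have "(matrix_inv P *v axis l 1) = (\<chi> k. det (\<chi> i j. if j = k then axis l 1 $ i else P $ i $ j) / det P)"
    using cramer[OF assms] by blast
  then have "(matrix_inv P *v axis l 1) $ k = det (\<chi> i j. if j = k then axis l 1 $ i else P $ i $ j) / det P"
    by simp
  then show ?thesis by (simp add: matrix_vector_mult_basis column_def)
qed

lemma C1_fun_matrix_inv:
  fixes f :: "'a::real_normed_vector \<Rightarrow> real^'n^'n"
  assumes "\<And>i j. C1_fun U (\<lambda>x. f x $ i $ j)" "\<And>x. x \<in> U \<Longrightarrow> det (f x) \<noteq> 0"
  shows "C1_fun U (\<lambda>x. matrix_inv (f x) $ k $ l)"
proof -
  have "C1_fun U (\<lambda>x. det (\<chi> i j. if j = k then axis l 1 $ i else f x $ i $ j) / det (f x))"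
  proof (intro C1_fun_divide C1_fun_det assms)
    show "C1_fun U (\<lambda>x. (\<chi> i j. if j = k then axis l 1 $ i else f x $ i $ j) $ i $ j)" for i j
      using assms(1) by (cases "j = k") (auto intro: C1_fun_const)
  qed
  then obtain F where F: "\<forall>x\<in>U. ((\<lambda>x. det (\<chi> i j. if j = k then axis l 1 $ i else f x $ i $ j) / det (f x)) has_derivative F x) (at x)"
      "\<forall>v. continuous_on U (\<lambda>x. F x v)"
    by (auto simp: C1_fun_def)
  show ?thesis
  proof (rule C1_funI[where f' = F])
    show "((\<lambda>x. matrix_inv (f x) $ k $ l) has_derivative F x) (at x)" if "x \<in> U" for x
    proof (rule has_derivative_transform_eventually)
      show "((\<lambda>x. det (\<chi> i j. if j = k then axis l 1 $ i else f x $ i $ j) / det (f x)) has_derivative F x) (at x)"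
        using F that by blast
      \<comment> \<open>Differentiating Cramer's formula requires it near \<open>x\<close> and not
        only on \<open>U\<close>; continuity of the determinant supplies the neighbourhood.\<close>
      have "isCont (\<lambda>x. det (f x)) x"
        using C1_fun_det[OF assms(1)] that by (auto simp: C1_fun_def intro: has_derivative_continuous)
      then have "eventually (\<lambda>y. det (f y) \<noteq> 0) (at x)"
        using assms(2)[OF that] by (intro tendsto_imp_eventually_ne) (auto simp: isCont_def)
      then show "\<forall>\<^sub>F y in at x. det (\<chi> i j. if j = k then axis l 1 $ i else f y $ i $ j) / det (f y) = matrix_inv (f y) $ k $ l"
        by eventually_elim (simp add: matrix_inv_entry)
      show "det (\<chi> i j. if j = k then axis l 1 $ i else f x $ i $ j) / det (f x) = matrix_inv (f x) $ k $ l"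
        using assms(2)[OF that] by (simp add: matrix_inv_entry)
    qed simp
  qed (use F in blast)
qed

definition posdef :: "real^'n^'n \<Rightarrow> bool" where
  "posdef P \<longleftrightarrow> transpose P = P \<and> (\<forall>v. v \<noteq> 0 \<longrightarrow> 0 < v \<bullet> (P *v v))"

lemma posdef_imp_psd: "posdef P \<Longrightarrow> psd P"
  unfolding posdef_def psd_def by (metis inner_zero_left less_imp_le order_refl)

lemma posdef_invertible:
  assumes "posdef P"
  shows "invertible P"
proof -
  have "\<forall>x. P *v x = 0 \<longrightarrow> x = 0"
    using assms by (force simp: posdef_def)
  then show ?thesis
    using matrix_left_invertible_ker[of P] invertible_left_inverse by blast
qed

text \<open>Along the segment to the identity all matrices are positive definite, hence their determinants
  do not vanish.\<close>

lemma posdef_det_pos: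
  assumes "posdef P"
  shows "0 < det P"
proof (rule ccontr)
  assume neg: "\<not> 0 < det P"
  define Q where "Q t = t *\<^sub>R P + (1 - t) *\<^sub>R mat 1" for t
  have "continuous_on {0..1::real} (\<lambda>t. det (Q t))"
    unfolding det_def Q_def by (intro continuous_intros)
  moreover have "det (Q 0) = 1" "det (Q 1) = det P" by (simp_all add: Q_def)
  ultimately obtain t where t: "0 \<le> t" "t \<le> 1" "det (Q t) = 0"
    using IVT2'[of "\<lambda>t. det (Q t)" 1 0 0] neg by auto
  have "posdef (Q t)"
    unfolding posdef_def
  proof (intro conjI allI impI)
    have "transpose P = P" using assms by (simp add: posdef_def)
    then show "transpose (Q t) = Q t"
      by (simp add: Q_def vec_eq_iff transpose_def mat_def)
    fix v :: "real^'a" assume v: "v \<noteq> 0"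
    have "v \<bullet> (Q t *v v) = t * (v \<bullet> (P *v v)) + (1 - t) * (v \<bullet> v)"
      by (simp add: Q_def matrix_vector_mult_add_rdistrib inner_add_right scaleR_matrix_vector_assoc[symmetric])
    moreover have "0 < v \<bullet> (P *v v)" "0 < v \<bullet> v" using assms v by (auto simp: posdef_def)
    ultimately show "0 < v \<bullet> (Q t *v v)"
      using t by (cases "t = 0") (auto intro!: add_pos_nonneg)
  qed
  then show False using posdef_invertible[of "Q t"] t(3) by (simp add: invertible_det_nz)
qed

text \<open>The form of the inverse at \<open>v\<close> is the form of \<open>P\<close> at
  \<open>matrix_inv P *v v\<close>.\<close>

lemma posdef_matrix_inv:
  assumes "posdef P"
  shows "posdef (matrix_inv P)"
proof -
  let ?Q = "matrix_inv P"
  have inv: "P ** ?Q = mat 1" "?Q ** P = mat 1"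
    using matrix_inv_right_left[OF posdef_invertible[OF assms]] .
  have "transpose ?Q = transpose ?Q ** (P ** ?Q)" by (simp add: inv)
  also have "\<dots> = transpose (P ** ?Q) ** ?Q"
    using assms by (simp add: posdef_def matrix_transpose_mul matrix_mul_assoc)
  also have "\<dots> = ?Q" by (simp add: inv transpose_mat)
  finally have "transpose ?Q = ?Q" .
  moreover have "0 < v \<bullet> (?Q *v v)" if "v \<noteq> 0" for v
  proof -
    have v: "P *v (?Q *v v) = v" by (simp add: matrix_vector_mul_assoc inv)
    then have "?Q *v v \<noteq> 0" using that by (metis matrix_vector_mult_0_right)
    then have "0 < (?Q *v v) \<bullet> (P *v (?Q *v v))" using assms by (simp add: posdef_def)
    then show ?thesis by (simp add: v inner_commute)
  qed
  ultimately show ?thesis by (simp add: posdef_def)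
qed

text \<open>Bounds for the finitely many partial derivatives bound the operator norm of the
  derivative, and convexity of \<open>K\<close> admits the mean value inequality.\<close>

lemma C1_fun_lipschitz:
  fixes f :: "real^'n \<Rightarrow> real"
  assumes "C1_fun U f" "K \<subseteq> U" "compact K" "convex K"
  shows "\<exists>L\<ge>0. \<forall>x\<in>K. \<forall>y\<in>K. \<bar>f x - f y\<bar> \<le> L * norm (x - y)"
proof -
  obtain f' where f: "\<And>x. x \<in> U \<Longrightarrow> (f has_derivative f' x) (at x)" "\<And>v. continuous_on U (\<lambda>x. f' x v)"
    using assms by (auto simp: C1_fun_def)
  have "\<exists>B. \<forall>x\<in>K. \<bar>f' x (axis i 1)\<bar> \<le> B" for i
  proof -
    have "compact ((\<lambda>x. f' x (axis i 1)) ` K)"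
      using assms by (intro compact_continuous_image continuous_on_subset[OF f(2)])
    then have "bounded ((\<lambda>x. f' x (axis i 1)) ` K)" by (rule compact_imp_bounded)
    then show ?thesis by (auto simp: bounded_iff)
  qed
  then obtain B where B: "\<And>i x. x \<in> K \<Longrightarrow> \<bar>f' x (axis i 1)\<bar> \<le> B i" by metis
  define L where "L = (\<Sum>i\<in>UNIV. \<bar>B i\<bar>)"
  have "onorm (f' x) \<le> L" if x: "x \<in> K" for x
  proof (rule onorm_le)
    fix h
    have lin: "linear (f' x)" using f(1)[of x] x assms has_derivative_linear by blast
    have "f' x h = (\<Sum>i\<in>UNIV. h $ i * f' x (axis i 1))"
      using linear_vec_expansion[OF lin, of h] by simp
    also have "\<bar>\<dots>\<bar> \<le> (\<Sum>i\<in>UNIV. \<bar>h $ i * f' x (axis i 1)\<bar>)" by (rule sum_abs)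
    also have "\<dots> \<le> (\<Sum>i\<in>UNIV. norm h * \<bar>B i\<bar>)"
      unfolding abs_mult using B[OF x] component_le_norm_cart[of h]
      by (intro sum_mono mult_mono) (auto intro: order_trans[OF _ abs_ge_self])
    finally show "norm (f' x h) \<le> L * norm h" by (simp add: L_def sum_distrib_left mult.commute)
  qed
  then have "\<bar>f x - f y\<bar> \<le> L * norm (x - y)" if "x \<in> K" "y \<in> K" for x y
    using differentiable_bound[OF assms(4), of f f' L x y] f(1) assms(2) that
    by (metis has_derivative_at_withinI real_norm_def subsetD)
  moreover have "L \<ge> 0" by (simp add: L_def sum_nonneg)
  ultimately show ?thesis by blast
qed

section \<open>From divergence form to an elliptic equation with uniform constants\<close>

lemma smooth_on_C2:
  assumes "smooth_on U u"
  shows "C2_derivs U u (\<lambda>x. frechet_derivative u (at x))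
    (\<lambda>x v. frechet_derivative (\<lambda>y. frechet_derivative u (at y) v) (at x))"
proof -
  have "C_on (Suc (Suc 0)) U u" using assms by (simp only: smooth_on_def)
  then show ?thesis by (auto simp: C2_derivs_def frechet_derivative_works)
qed

text \<open>Carrying out the outer derivative produces the drift b_j = (1/w) sum_i d_i (w g^ij),
  where w is the root of the determinant. It depends on the metric alone and is therefore chosen
  before \<open>u\<close>: the constants of a chart must serve all eigenfunctions.\<close>

lemma laplace_expansion:
  fixes G :: "real^'n \<Rightarrow> real^'n^'n"
  assumes G: "smooth_on U G" "\<And>y. y \<in> U \<Longrightarrow> posdef (G y)"
  shows "\<exists>b. continuous_on U b \<and> (\<forall>u D H y. C2_derivs U u D H \<longrightarrow> y \<in> U \<longrightarrow> (\<forall>x\<in>U. frechet_derivative u (at x) = D x) \<longrightarrow> open U \<longrightarrow>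
    (\<Sum>i\<in>UNIV. partial i (\<lambda>y. sqrt (det (G y)) * (\<Sum>j\<in>UNIV. matrix_inv (G y) $ i $ j * partial j u y)) y) / sqrt (det (G y))
    = contract (matrix_inv (G y)) (H y) + D y (b y))"
proof -
  define w where "w y = sqrt (det (G y))" for y
  have wpos: "w y > 0" if "y \<in> U" for y using posdef_det_pos[OF G(2)[OF that]] by (simp add: w_def)
  have C1e: "C1_fun U (\<lambda>y. G y $ i $ j)" for i j
    by (intro C1_fun_entry smooth_on_C1 G)
  have C1w: "C1_fun U w" unfolding w_def
    by (intro C1_fun_sqrt C1_fun_det C1e posdef_det_pos G)
  have "C1_fun U (\<lambda>y. w y * matrix_inv (G y) $ i $ j)" for i j
    by (intro C1_fun_mult C1w C1_fun_matrix_inv C1e) (use posdef_det_pos[OF G(2)] in force)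
  then have "\<forall>ij. \<exists>F. (\<forall>y\<in>U. ((\<lambda>y. w y * matrix_inv (G y) $ fst ij $ snd ij) has_derivative F y) (at y)) \<and>
      (\<forall>v. continuous_on U (\<lambda>y. F y v))"
    unfolding C1_fun_def by blast
  from choice[OF this] obtain F where F: "\<forall>ij. (\<forall>y\<in>U. ((\<lambda>y. w y * matrix_inv (G y) $ fst ij $ snd ij) has_derivative F ij y) (at y)) \<and>
      (\<forall>v. continuous_on U (\<lambda>y. F ij y v))"
    by blast
  define A' where "A' i j = F (i, j)" for i j
  have A': "((\<lambda>y. w y * matrix_inv (G y) $ i $ j) has_derivative A' i j y) (at y)" if "y \<in> U" for i j y
    using F[rule_format, of "(i, j)"] that by (simp add: A'_def)
  have A'2: "continuous_on U (\<lambda>y. A' i j y v)" for i j v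
    using F[rule_format, of "(i, j)"] by (simp add: A'_def)
  define b where "b y = (\<chi> j. (\<Sum>i\<in>UNIV. A' i j y (axis i 1)) / w y)" for y
  have "\<forall>y\<in>U. w y \<noteq> 0" using wpos by (metis less_irrefl)
  then have "continuous_on U (\<lambda>y. (\<Sum>i\<in>UNIV. A' i j y (axis i 1)) / w y)" for j
    by (rule continuous_on_divide[OF continuous_on_sum[OF A'2] C1_fun_continuous[OF C1w]])
  then have "continuous_on U b" unfolding b_def[abs_def] by (rule continuous_on_vec_lambda)
  moreover have "(\<Sum>i\<in>UNIV. partial i (\<lambda>y. w y * (\<Sum>j\<in>UNIV. matrix_inv (G y) $ i $ j * partial j u y)) y) / w y
      = contract (matrix_inv (G y)) (H y) + D y (b y)"
    if C2: "C2_derivs U u D H" and y: "y \<in> U" and D: "\<forall>x\<in>U. frechet_derivative u (at x) = D x" and U: "open U" for u D H y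
  proof -
    \<comment> \<open>Second derivatives will appear as \<open>H y (axis j 1) (axis i 1)\<close>, in
      the order opposite to \<open>contract\<close>; it is the symmetry of the matrix, not that of
      \<open>H\<close>, which exchanges the indices.\<close>
    have sym: "matrix_inv (G y) $ i $ j = matrix_inv (G y) $ j $ i" for i j
      using posdef_matrix_inv[OF G(2)[OF y]] by (intro transpose_entry) (simp add: posdef_def)
    have "partial i (\<lambda>y. w y * (\<Sum>j\<in>UNIV. matrix_inv (G y) $ i $ j * partial j u y)) y
        = (\<Sum>j\<in>UNIV. w y * matrix_inv (G y) $ i $ j * H y (axis j 1) (axis i 1) + A' i j y (axis i 1) * D y (axis j 1))" for i
    proof -
      have "((\<lambda>y. \<Sum>j\<in>UNIV. (w y * matrix_inv (G y) $ i $ j) * D y (axis j 1)) has_derivative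
          (\<lambda>v. \<Sum>j\<in>UNIV. (w y * matrix_inv (G y) $ i $ j) * H y (axis j 1) v + A' i j y v * D y (axis j 1))) (at y)"
        using C2 y by (intro has_derivative_sum has_derivative_mult A') (auto simp: C2_derivs_def)
      then have "((\<lambda>y. w y * (\<Sum>j\<in>UNIV. matrix_inv (G y) $ i $ j * partial j u y)) has_derivative
          (\<lambda>v. \<Sum>j\<in>UNIV. (w y * matrix_inv (G y) $ i $ j) * H y (axis j 1) v + A' i j y v * D y (axis j 1))) (at y)"
        by (rule has_derivative_transform_within_open[OF _ U y])
          (simp add: partial_def D sum_distrib_left mult.assoc)
      from frechet_derivative_at[OF this] show ?thesis
        unfolding partial_def by metis
    qed
    then have "(\<Sum>i\<in>UNIV. partial i (\<lambda>y. w y * (\<Sum>j\<in>UNIV. matrix_inv (G y) $ i $ j * partial j u y)) y)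
        = (\<Sum>i\<in>UNIV. \<Sum>j\<in>UNIV. w y * matrix_inv (G y) $ i $ j * H y (axis j 1) (axis i 1))
          + (\<Sum>i\<in>UNIV. \<Sum>j\<in>UNIV. A' i j y (axis i 1) * D y (axis j 1))"
      by (simp add: sum.distrib)
    also have "(\<Sum>i\<in>UNIV. \<Sum>j\<in>UNIV. w y * matrix_inv (G y) $ i $ j * H y (axis j 1) (axis i 1)) = w y * contract (matrix_inv (G y)) (H y)"
      unfolding contract_def by (subst sum.swap) (simp add: sum_distrib_left sym mult.assoc)
    also have "(\<Sum>i\<in>UNIV. \<Sum>j\<in>UNIV. A' i j y (axis i 1) * D y (axis j 1)) = w y * D y (b y)"
    proof -
      have lin: "linear (D y)" using C2 y has_derivative_linear by (auto simp: C2_derivs_def)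
      from linear_vec_expansion[OF lin, of "b y"]
      have "D y (b y) = (\<Sum>j\<in>UNIV. b y $ j * D y (axis j 1))" by (simp only: real_scaleR_def)
      also have "w y * \<dots> = (\<Sum>j\<in>UNIV. (\<Sum>i\<in>UNIV. A' i j y (axis i 1)) * D y (axis j 1))"
        using wpos[OF y] by (simp add: sum_distrib_left b_def)
      also have "\<dots> = (\<Sum>i\<in>UNIV. \<Sum>j\<in>UNIV. A' i j y (axis i 1) * D y (axis j 1))"
        by (subst sum.swap) (simp add: sum_distrib_right)
      finally show ?thesis by simp
    qed
    finally show ?thesis using wpos[OF y] by (simp add: add_divide_distrib)
  qed
  ultimately show ?thesis unfolding w_def by blast
qed

lemma quadratic_bound:
  fixes P :: "real^'n^'n"
  shows "\<bar>v \<bullet> (P *v v)\<bar> \<le> (\<Sum>i\<in>UNIV. \<Sum>j\<in>UNIV. \<bar>P $ i $ j\<bar>) * (v \<bullet> v)"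
proof -
  have "v \<bullet> (P *v v) = (\<Sum>i\<in>UNIV. \<Sum>j\<in>UNIV. v $ i * (P $ i $ j * v $ j))"
    by (simp add: inner_vec_def matrix_vector_mult_def sum_distrib_left)
  also have "\<bar>\<dots>\<bar> \<le> (\<Sum>i\<in>UNIV. \<Sum>j\<in>UNIV. \<bar>v $ i * (P $ i $ j * v $ j)\<bar>)"
    by (rule order_trans[OF sum_abs]) (rule sum_mono, rule sum_abs)
  also have "\<dots> \<le> (\<Sum>i\<in>UNIV. \<Sum>j\<in>UNIV. \<bar>P $ i $ j\<bar> * (v \<bullet> v))"
  proof (intro sum_mono)
    fix i j
    have "\<bar>v $ i\<bar> * \<bar>v $ j\<bar> \<le> norm v * norm v"
      by (intro mult_mono component_le_norm_cart) auto
    then have "\<bar>P $ i $ j\<bar> * (\<bar>v $ i\<bar> * \<bar>v $ j\<bar>) \<le> \<bar>P $ i $ j\<bar> * (v \<bullet> v)"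
      by (intro mult_left_mono) (auto simp: dot_square_norm power2_eq_square)
    then show "\<bar>v $ i * (P $ i $ j * v $ j)\<bar> \<le> \<bar>P $ i $ j\<bar> * (v \<bullet> v)"
      by (simp add: abs_mult mult_ac)
  qed
  also have "\<dots> = (\<Sum>i\<in>UNIV. \<Sum>j\<in>UNIV. \<bar>P $ i $ j\<bar>) * (v \<bullet> v)"
    by (simp add: sum_distrib_right)
  finally show ?thesis .
qed

text \<open>The quadratic form has a positive minimum on the compact product of \<open>K\<close>
  with the unit sphere, and homogeneity does the rest.\<close>

lemma posdef_uniform:
  fixes P :: "'a::topological_space \<Rightarrow> real^'n^'n"
  assumes K: "compact K" "K \<noteq> {}" and c: "\<And>i j. continuous_on K (\<lambda>x. P x $ i $ j)"
    and pd: "\<And>x. x \<in> K \<Longrightarrow> posdef (P x)"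
  shows "\<exists>m>0. \<forall>x\<in>K. \<forall>v. m * (v \<bullet> v) \<le> v \<bullet> (P x *v v)"
proof -
  have "K \<times> sphere (0::real^'n) 1 \<noteq> {}" using K by simp
  moreover have "compact (K \<times> sphere (0::real^'n) 1)" using K by (intro compact_Times) auto
  moreover have "continuous_on (K \<times> sphere (0::real^'n) 1) (\<lambda>q. snd q \<bullet> (P (fst q) *v snd q))"
  proof -
    have *: "continuous_on (K \<times> sphere (0::real^'n) 1) (\<lambda>q. P (fst q) $ i $ j)" for i j
      by (rule continuous_on_compose2[OF c]) (auto intro: continuous_intros)
    have **: "continuous_on (K \<times> sphere (0::real^'n) 1) (\<lambda>q. snd q $ i)" for i
      by (intro continuous_intros)
    show ?thesis
      unfolding inner_vec_def matrix_vector_mult_def vec_lambda_beta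
      by (intro continuous_on_sum continuous_on_inner continuous_on_mult * **)
  qed
  ultimately obtain q where q: "q \<in> K \<times> sphere (0::real^'n) 1"
    and mn: "\<forall>q'\<in>K \<times> sphere (0::real^'n) 1. snd q \<bullet> (P (fst q) *v snd q) \<le> snd q' \<bullet> (P (fst q') *v snd q')"
    using continuous_attains_inf[of "K \<times> sphere (0::real^'n) 1" "\<lambda>q. snd q \<bullet> (P (fst q) *v snd q)"]
    by blast
  define m where "m = snd q \<bullet> (P (fst q) *v snd q)"
  have "snd q \<noteq> 0" using q by auto
  then have "m > 0" using pd[of "fst q"] q by (auto simp: m_def posdef_def)
  moreover have "m * (v \<bullet> v) \<le> v \<bullet> (P x *v v)" if x: "x \<in> K" for x v
  proof (cases "v = 0")
    case False
    have "m \<le> (v /\<^sub>R norm v) \<bullet> (P x *v (v /\<^sub>R norm v))"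
      using mn[rule_format, of "(x, v /\<^sub>R norm v)"] x False by (simp add: m_def)
    also have "\<dots> = (v \<bullet> (P x *v v)) / (v \<bullet> v)"
      using False by (simp add: matrix_vector_mult_scaleR dot_square_norm power2_eq_square divide_simps)
    finally show ?thesis using False by (simp add: field_simps)
  qed simp
  ultimately show ?thesis by blast
qed

lemma continuous_on_bounded_real:
  fixes f :: "'a::topological_space \<Rightarrow> real"
  assumes "compact K" "continuous_on K f"
  shows "\<exists>B\<ge>0. \<forall>x\<in>K. \<bar>f x\<bar> \<le> B"
proof -
  have "bounded (f ` K)" using assms by (intro compact_imp_bounded compact_continuous_image)
  then show ?thesis unfolding bounded_pos by (auto intro: less_imp_le)
qed

lemma elliptic_on_compact:
  fixes G :: "real^'n \<Rightarrow> real^'n^'n"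
  assumes G: "smooth_on U G" "\<And>y. y \<in> U \<Longrightarrow> posdef (G y)" and b: "continuous_on U b"
    and K: "compact K" "convex K" "K \<noteq> {}" "K \<subseteq> U"
  shows "\<exists>\<mu> L B. elliptic_on K (\<lambda>y. matrix_inv (G y)) b \<mu> L B"
proof -
  define a where "a y = matrix_inv (G y)" for y
  have C1: "C1_fun U (\<lambda>y. a y $ i $ j)" for i j
    unfolding a_def by (intro C1_fun_matrix_inv C1_fun_entry smooth_on_C1 G) (use posdef_det_pos[OF G(2)] in force)
  have c: "continuous_on K (\<lambda>y. a y $ i $ j)" for i j
    by (rule continuous_on_subset[OF C1_fun_continuous[OF C1] K(4)])
  have pd: "posdef (a y)" if "y \<in> K" for y
    unfolding a_def using that K by (intro posdef_matrix_inv G) auto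
  obtain m where m: "m > 0" "\<And>y v. y \<in> K \<Longrightarrow> m * (v \<bullet> v) \<le> v \<bullet> (a y *v v)"
    using posdef_uniform[OF K(1,3) c pd] by blast
  obtain L where L: "\<And>i j. 0 \<le> L i j" "\<And>i j x y. x \<in> K \<Longrightarrow> y \<in> K \<Longrightarrow> \<bar>a x $ i $ j - a y $ i $ j\<bar> \<le> L i j * norm (x - y)"
    using C1_fun_lipschitz[OF C1 K(4,1,2)] by metis
  obtain B1 where B1: "0 \<le> B1" "\<And>y. y \<in> K \<Longrightarrow> \<bar>trace (a y)\<bar> \<le> B1"
    using continuous_on_bounded_real[OF K(1) continuous_on_sum[of UNIV K "\<lambda>i y. a y $ i $ i", OF c]]
    by (auto simp: trace_def)
  obtain B2 where B2: "0 \<le> B2" "\<And>y. y \<in> K \<Longrightarrow> \<bar>norm (b y)\<bar> \<le> B2"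
    using continuous_on_bounded_real[OF K(1) continuous_on_norm[OF continuous_on_subset[OF b K(4)]]] by auto
  define LL where "LL = (\<Sum>i\<in>UNIV. \<Sum>j\<in>UNIV. L i j)"
  \<comment> \<open>Half of \<open>m\<close>, because \<open>elliptic_on\<close> carries the factor
    2.\<close>
  have "elliptic_on K a b (m / 2) LL (max B1 B2)"
    unfolding elliptic_on_def
  proof (intro conjI ballI allI)
    show "0 \<le> LL" unfolding LL_def by (intro sum_nonneg L)
    fix x assume x: "x \<in> K"
    show "transpose (a x) = a x" using pd[OF x] by (simp add: posdef_def)
    show "2 * (m / 2) * (v \<bullet> v) \<le> v \<bullet> (a x *v v)" for v using m(2)[OF x] by simp
    show "trace (a x) \<le> max B1 B2" using B1(2)[OF x] by simp
    show "norm (b x) \<le> max B1 B2" using B2(2)[OF x] by simp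
    fix y v assume y: "y \<in> K"
    have "\<bar>v \<bullet> ((a x - a y) *v v)\<bar> \<le> (\<Sum>i\<in>UNIV. \<Sum>j\<in>UNIV. \<bar>(a x - a y) $ i $ j\<bar>) * (v \<bullet> v)"
      by (rule quadratic_bound)
    also have "\<dots> \<le> (\<Sum>i\<in>UNIV. \<Sum>j\<in>UNIV. L i j * norm (x - y)) * (v \<bullet> v)"
      using L(2)[OF x y] by (intro mult_right_mono sum_mono) auto
    finally show "\<bar>v \<bullet> ((a x - a y) *v v)\<bar> \<le> LL * norm (x - y) * (v \<bullet> v)"
      by (simp add: LL_def sum_distrib_right)
  qed (use m B1 in auto)
  then show ?thesis unfolding a_def by blast
qed

text \<open>The ellipticity data fix \<open>R0\<close> and \<open>N\<close> before \<open>u\<close>,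
  \<open>lam\<close> and \<open>R\<close> appear; uniformity in the eigenvalue rests on this
  order.\<close>

lemma gradient_bounded_solution:
  fixes a :: "real^'n \<Rightarrow> real^'n^'n"
  assumes ell: "elliptic_on K a b \<mu> L B" and U: "open U" "K \<subseteq> U"
  shows "\<exists>R0>0. \<exists>N\<ge>1. \<forall>u lam R. solves_on U a b lam u \<longrightarrow> 0 \<le> lam \<longrightarrow> R \<le> R0 \<longrightarrow> lam * R\<^sup>2 \<le> 1 \<longrightarrow>
    gradient_bounded K R N u"
proof -
  have pos: "0 < \<mu>" "0 \<le> L" "0 \<le> B" using ell by (auto simp: elliptic_on_def)
  define Q where "Q = 3 * CARD('n) * L + 2 * B"
  have Q: "0 \<le> Q" using pos by (simp add: Q_def)
  \<comment> \<open>Radii up to \<open>R0\<close> satisfy the smallness condition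
    \<open>Q * d \<le> 4 * \<mu>\<close> of \<open>lipschitz_estimate\<close>, with
    \<open>Q + 1\<close> in the denominator because \<open>Q\<close> may vanish; \<open>N\<close> is
    the larger of what its two lower bounds ask for.\<close>
  define R0 where "R0 = min 1 (4 * \<mu> / (Q + 1))"
  define N where "N = max 11 ((80 * B + 3) / (4 * \<mu>))"
  have R0: "0 < R0" using pos Q by (simp add: R0_def)
  have N: "11 \<le> N" "80 * B + 2 < 4 * \<mu> * N"
  proof -
    have "4 * \<mu> * ((80 * B + 3) / (4 * \<mu>)) \<le> 4 * \<mu> * N"
      using pos by (intro mult_left_mono) (auto simp: N_def)
    then show "80 * B + 2 < 4 * \<mu> * N" using pos by simp
  qed (simp add: N_def)
  have "gradient_bounded K R N u"
    if sol: "solves_on U a b lam u" and lam: "0 \<le> lam" "lam * R\<^sup>2 \<le> 1" and R: "R \<le> R0" for u lam R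
    unfolding gradient_bounded_def
  proof (intro allI impI)
    fix z d S assume d: "0 < d" "d \<le> R" and sub: "cball z (d / 2) \<subseteq> K"
      and S: "\<forall>x\<in>cball z (d / 2). \<bar>u x\<bar> \<le> S"
    have d1: "d \<le> 1" "d \<le> 4 * \<mu> / (Q + 1)" using d R by (auto simp: R0_def)
    have "Q * d \<le> (Q + 1) * (4 * \<mu> / (Q + 1))"
      using d1 d Q pos by (intro mult_mono) auto
    then have Qd: "Q * d \<le> 4 * \<mu>" using Q by simp
    have "lam * d\<^sup>2 \<le> lam * R\<^sup>2" using d lam by (intro mult_left_mono power_mono) auto
    then have ld: "lam * d\<^sup>2 \<le> 1" using lam by simp
    have elld: "elliptic_on (cball z (d / 2)) a b \<mu> L B"
      using ell sub unfolding elliptic_on_def by blast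
    show "\<forall>x\<in>cball z (d / 4). \<bar>u z - u x\<bar> \<le> N * S / d * dist z x"
    proof
      fix x assume "x \<in> cball z (d / 4)"
      then show "\<bar>u z - u x\<bar> \<le> N * S / d * dist z x"
        using S sub U
        by (intro lipschitz_estimate[OF U(1) _ sol elld d(1) d1(1) Qd[unfolded Q_def] lam(1) ld N]) auto
    qed
  qed
  moreover have "1 \<le> N" using N by simp
  ultimately show ?thesis using R0 by blast
qed

section \<open>Change of variables\<close>

text \<open>The library's change of variables formula requires a well-ordered index type.\<close>

typedef ('n::finite) idx = "{i::nat. i < CARD('n)}"
  by (rule exI[of _ 0]) simp

setup_lifting type_definition_idx

instantiation idx :: (finite) wellorder
begin

lift_definition less_eq_idx :: "'a idx \<Rightarrow> 'a idx \<Rightarrow> bool" is "(\<le>)" .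
lift_definition less_idx :: "'a idx \<Rightarrow> 'a idx \<Rightarrow> bool" is "(<)" .

instance
proof
  fix P :: "'a idx \<Rightarrow> bool" and i
  assume step: "\<And>i. (\<And>j. j < i \<Longrightarrow> P j) \<Longrightarrow> P i"
  show "P i"
    by (induction "Rep_idx i" arbitrary: i rule: less_induct) (metis step less_idx.rep_eq)
qed (transfer; linarith)+

end

lemma bij_Rep_idx: "bij_betw Rep_idx (UNIV :: 'n::finite idx set) {i. i < CARD('n)}"
  by (metis bij_betw_def type_definition.Rep_range type_definition_idx type_definition.Rep_inject inj_onI)

instance idx :: (finite) finite
proof
  show "finite (UNIV :: 'a idx set)"
    using bij_betw_finite[OF bij_Rep_idx] by simp
qed

definition enum_idx :: "'n::finite \<Rightarrow> 'n idx" where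
  "enum_idx = (SOME f. bij f)"

lemma bij_enum_idx: "bij (enum_idx :: 'n::finite \<Rightarrow> 'n idx)"
proof -
  have "card (UNIV :: 'n idx set) = CARD('n)"
    using bij_betw_same_card[OF bij_Rep_idx] by simp
  then have "\<exists>f :: 'n \<Rightarrow> 'n idx. bij f"
    using finite_same_card_bij[of "UNIV :: 'n set" "UNIV :: 'n idx set"] by simp
  then show ?thesis unfolding enum_idx_def by (rule someI_ex)
qed

abbreviation deidx :: "'n::finite idx \<Rightarrow> 'n" where "deidx \<equiv> inv enum_idx"

lemma deidx_enum [simp]: "deidx (enum_idx i) = i"
  by (rule inv_f_f[OF bij_is_inj[OF bij_enum_idx]])

lemma enum_deidx [simp]: "enum_idx (deidx k) = k"
  by (rule surj_f_inv_f[OF bij_is_surj[OF bij_enum_idx]])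

lemma bij_deidx: "bij (deidx :: 'n::finite idx \<Rightarrow> 'n)"
  by (rule bij_imp_bij_inv[OF bij_enum_idx])

definition to_idx :: "real^'n \<Rightarrow> real^('n idx)" where "to_idx x = (\<chi> k. x $ deidx k)"

definition of_idx :: "real^('n::finite idx) \<Rightarrow> real^'n" where "of_idx y = (\<chi> i. y $ enum_idx i)"

lemma of_to_idx [simp]: "of_idx (to_idx x) = x"
  by (simp add: of_idx_def to_idx_def vec_eq_iff)

lemma to_of_idx [simp]: "to_idx (of_idx y) = y"
  by (simp add: of_idx_def to_idx_def vec_eq_iff)

lemma linear_to_idx: "linear to_idx" and linear_of_idx: "linear of_idx"
  by (auto intro!: linearI simp: to_idx_def of_idx_def vec_eq_iff)

lemma bounded_linear_to_idx: "bounded_linear to_idx" and bounded_linear_of_idx: "bounded_linear of_idx"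
  using linear_to_idx linear_of_idx by (simp_all add: linear_conv_bounded_linear)

lemma measurable_to_idx [measurable]: "to_idx \<in> borel_measurable borel"
  and measurable_of_idx [measurable]: "of_idx \<in> borel_measurable borel"
  by (auto intro!: borel_measurable_continuous_onI linear_continuous_on bounded_linear_to_idx bounded_linear_of_idx)

lemma emeasure_lborel_box_cart:
  fixes l u :: "real^'n"
  assumes "\<And>i. l $ i \<le> u $ i"
  shows "emeasure lborel (box l u) = (\<Prod>i\<in>UNIV. u $ i - l $ i)"
proof -
  have inj: "inj (\<lambda>i::'n. axis i (1::real))" by (auto intro!: injI simp: axis_eq_axis)
  have B: "(Basis :: (real^'n) set) = range (\<lambda>i. axis i 1)" by (auto simp: Basis_vec_def)
  have "(\<Prod>b\<in>Basis. (u - l) \<bullet> b) = (\<Prod>i\<in>UNIV. u $ i - l $ i)"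
    unfolding B prod.reindex[OF inj] by (simp add: inner_axis)
  moreover have "\<forall>b\<in>Basis. l \<bullet> b \<le> u \<bullet> b" using assms by (auto simp: B inner_axis)
  ultimately show ?thesis by (simp add: emeasure_lborel_box)
qed

text \<open>Renaming coordinates maps boxes to boxes with the same side lengths, and boxes determine
  Lebesgue measure.\<close>

lemma distr_to_idx: "distr lborel borel (to_idx :: real^'n \<Rightarrow> _) = lborel"
proof (rule lborel_eqI[symmetric])
  fix l u :: "real^('n idx)"
  assume "\<And>b. b \<in> Basis \<Longrightarrow> l \<bullet> b \<le> u \<bullet> b"
  then have le: "l $ k \<le> u $ k" for k
    by (metis axis_in_Basis_iff cart_eq_inner_axis Basis_real_def insertI1)
  have "(to_idx :: real^'n \<Rightarrow> _) -` box l u = box (of_idx l) (of_idx u)"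
  proof (intro set_eqI)
    fix x :: "real^'n"
    have "(\<forall>k. l $ k < x $ deidx k \<and> x $ deidx k < u $ k) \<longleftrightarrow> (\<forall>i. l $ enum_idx i < x $ i \<and> x $ i < u $ enum_idx i)"
      by (metis deidx_enum enum_deidx)
    then show "x \<in> to_idx -` box l u \<longleftrightarrow> x \<in> box (of_idx l) (of_idx u)"
      by (simp add: mem_box_cart to_idx_def of_idx_def)
  qed
  then have "emeasure (distr lborel borel to_idx) (box l u) = emeasure lborel (box (of_idx l) (of_idx u :: real^'n))"
    by (simp add: emeasure_distr)
  also have "\<dots> = (\<Prod>i\<in>UNIV. u $ enum_idx (i::'n) - l $ enum_idx i)"
    using le by (subst emeasure_lborel_box_cart) (auto simp: of_idx_def)
  also have "(\<Prod>i\<in>UNIV. u $ enum_idx (i::'n) - l $ enum_idx i) = (\<Prod>k\<in>UNIV. u $ k - l $ k)"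
    by (rule prod.reindex_bij_betw[OF bij_enum_idx])
  also have "ennreal \<dots> = emeasure lborel (box l u)"
    using le by (simp add: emeasure_lborel_box_cart)
  also have "\<dots> = (\<Prod>b\<in>Basis. (u - l) \<bullet> b)"
    using \<open>\<And>b. b \<in> Basis \<Longrightarrow> l \<bullet> b \<le> u \<bullet> b\<close> by (simp add: emeasure_lborel_box)
  finally show "emeasure (distr lborel borel (to_idx :: real^'n \<Rightarrow> _)) (box l u) = (\<Prod>b\<in>Basis. (u - l) \<bullet> b)" .
qed simp

lemma nn_integral_to_idx:
  assumes "f \<in> borel_measurable borel"
  shows "(\<integral>\<^sup>+x. f (to_idx x) \<partial>lborel) = (\<integral>\<^sup>+y. f y \<partial>lborel)"
  by (subst distr_to_idx[symmetric], subst nn_integral_distr) (use assms in auto)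

text \<open>In the Leibniz sum the permutations of the two index types correspond by conjugation
  with \<open>deidx\<close>, which preserves signs.\<close>

lemma det_idx: "det (\<chi> k l. P $ deidx k $ deidx l) = det (P :: real^'n^'n)"
proof -
  let ?m = "map_permutation UNIV (deidx :: 'n idx \<Rightarrow> 'n)"
  have inj: "inj (deidx :: 'n idx \<Rightarrow> 'n)" using bij_deidx by (rule bij_is_inj)
  have m: "?m p i = deidx (p (enum_idx i))" for p i
  proof -
    have "inv_into UNIV (deidx :: 'n idx \<Rightarrow> 'n) i = enum_idx i"
      by (metis bij_enum_idx inv_inv_eq)
    moreover have "range (deidx :: 'n idx \<Rightarrow> 'n) = UNIV" using bij_deidx by (rule bij_is_surj)
    ultimately show ?thesis by (simp add: map_permutation_def restrict_id_def)
  qed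
  have bij: "bij_betw ?m {p. p permutes UNIV} {p. p permutes UNIV}"
  proof (rule bij_betwI[where g = "map_permutation UNIV (enum_idx :: 'n \<Rightarrow> 'n idx)"])
    have e: "map_permutation UNIV enum_idx q k = enum_idx (q (deidx k))" for q :: "'n \<Rightarrow> 'n" and k
    proof -
      have "range (enum_idx :: 'n \<Rightarrow> 'n idx) = UNIV" using bij_enum_idx by (rule bij_is_surj)
      then show ?thesis by (simp add: map_permutation_def restrict_id_def)
    qed
    show "map_permutation UNIV enum_idx (?m p) = p" for p
      by (simp add: fun_eq_iff e m)
    show "?m (map_permutation UNIV enum_idx q) = q" for q
      by (simp add: fun_eq_iff e m)
    show "?m \<in> {p. p permutes UNIV} \<rightarrow> {p. p permutes UNIV}"
      using map_permutation_permutes[OF bij_deidx] by auto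
    show "map_permutation UNIV (enum_idx :: 'n \<Rightarrow> 'n idx) \<in> {p. p permutes UNIV} \<rightarrow> {p. p permutes UNIV}"
      using map_permutation_permutes[OF bij_enum_idx] by auto
  qed
  have "det P = (\<Sum>p\<in>{p. p permutes UNIV}. of_int (sign (?m p)) * (\<Prod>i\<in>UNIV. P $ i $ ?m p i))"
    unfolding det_def by (rule sum.reindex_bij_betw[OF bij, symmetric])
  also have "\<dots> = (\<Sum>p\<in>{p. p permutes UNIV}. of_int (sign p) * (\<Prod>k\<in>UNIV. P $ deidx k $ deidx (p k)))"
  proof (intro sum.cong refl arg_cong2[where f = "(*)"])
    fix p :: "'n idx \<Rightarrow> 'n idx" assume "p \<in> {p. p permutes UNIV}"
    then show "of_int (sign (?m p)) = (of_int (sign p) :: real)"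
      using sign_map_permutation[OF inj, of p] by simp
    show "(\<Prod>i\<in>UNIV. P $ i $ ?m p i) = (\<Prod>k\<in>UNIV. P $ deidx k $ deidx (p k))"
      by (subst prod.reindex_bij_betw[OF bij_deidx, symmetric]) (simp add: m)
  qed
  also have "\<dots> = det (\<chi> k l. P $ deidx k $ deidx l)" by (simp add: det_def)
  finally show ?thesis by simp
qed

text \<open>Finiteness on the image side makes the integrals absolutely convergent, so that the
  formula for signed integrands applies. \<open>\<psi>\<close> is separate from the product of
  Jacobian and \<open>\<phi> (T x)\<close>, so that its measurability may come from another
  description, in the application from a density of the metric.\<close>

lemma change_of_variables_wellorder:
  fixes T :: "real^'m::{finite,wellorder} \<Rightarrow> real^'m::_" and \<phi> \<psi> :: "real^'m::_ \<Rightarrow> real"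
  assumes S: "S \<in> sets borel" "T ` S \<in> sets borel"
    and der: "\<And>x. x \<in> S \<Longrightarrow> (T has_derivative T' x) (at x within S)" and inj: "inj_on T S"
    and meas: "(\<lambda>y. indicator (T ` S) y * \<phi> y) \<in> borel_measurable borel" "(\<lambda>x. indicator S x * \<psi> x) \<in> borel_measurable borel"
    and nonneg: "\<And>y. y \<in> T ` S \<Longrightarrow> 0 \<le> \<phi> y" "\<And>x. x \<in> S \<Longrightarrow> 0 \<le> \<psi> x"
    and \<psi>: "\<And>x. x \<in> S \<Longrightarrow> \<psi> x = \<bar>det (matrix (T' x))\<bar> * \<phi> (T x)"
    and fin: "(\<integral>\<^sup>+y. ennreal (indicator (T ` S) y * \<phi> y) \<partial>lborel) < \<infinity>"
  shows "(\<integral>\<^sup>+x. ennreal (indicator S x * \<psi> x) \<partial>lborel) = (\<integral>\<^sup>+y. ennreal (indicator (T ` S) y * \<phi> y) \<partial>lborel)"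
proof -
  have nn: "0 \<le> indicator (T ` S) y * \<phi> y" "0 \<le> indicator S x * \<psi> x" for x y
    using nonneg by (auto simp: indicator_def)
  \<comment> \<open>Scalars are embedded as \<open>real^1\<close>, since the formula is used for
    vector valued integrands.\<close>
  have v: "bounded_linear (vec :: real \<Rightarrow> real^1)"
    by (auto intro!: linear_linear[THEN iffD1] linearI simp: linear_conv_bounded_linear[symmetric] vec_eq_iff)
  have i\<phi>: "integrable lebesgue (\<lambda>y. indicator (T ` S) y * \<phi> y)"
    using fin meas nn by (subst integrable_completion) (auto intro!: integrableI_nonneg)
  have ind: "indicator A x *\<^sub>R (vec r :: real^1) = vec (indicator A x * r)" for A :: "(real^'m::_) set" and x r
    by (simp add: vec_eq_iff)
  have "(\<lambda>y. vec (\<phi> y) :: real^1) absolutely_integrable_on T ` S"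
    unfolding set_integrable_def ind by (rule integrable_bounded_linear[OF v i\<phi>])
  then have *: "(\<lambda>x. \<bar>det (matrix (T' x))\<bar> *\<^sub>R (vec (\<phi> (T x)) :: real^1)) absolutely_integrable_on S"
      "integral S (\<lambda>x. \<bar>det (matrix (T' x))\<bar> *\<^sub>R (vec (\<phi> (T x)) :: real^1)) = integral (T ` S) (\<lambda>y. vec (\<phi> y))"
    using has_absolute_integral_change_of_variables[OF _ der inj, of "\<lambda>y. vec (\<phi> y) :: real^1"] S
    by (auto simp: lborelD)
  have **: "indicator S x *\<^sub>R (\<bar>det (matrix (T' x))\<bar> *\<^sub>R (vec (\<phi> (T x)) :: real^1)) = vec (indicator S x * \<psi> x)" for x
    by (cases "x \<in> S") (simp_all add: vec_eq_iff \<psi>)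
  have iv: "integrable lebesgue (\<lambda>x. vec (indicator S x * \<psi> x) :: real^1)"
    using *(1) by (simp only: set_integrable_def **)
  then have "integrable lebesgue (\<lambda>x. (vec (indicator S x * \<psi> x) :: real^1) $ 1)"
    by (rule integrable_bounded_linear[OF bounded_linear_vec_nth])
  then have i\<psi>: "integrable lebesgue (\<lambda>x. indicator S x * \<psi> x)" by simp
  have "(\<integral>x. vec (indicator S x * \<psi> x) \<partial>lebesgue) = (\<integral>y. (vec (indicator (T ` S) y * \<phi> y) :: real^1) \<partial>lebesgue)"
    using *(2) set_lebesgue_integral_eq_integral(2)[OF *(1)]
      set_lebesgue_integral_eq_integral(2)[OF \<open>(\<lambda>y. vec (\<phi> y) :: real^1) absolutely_integrable_on T ` S\<close>]
    by (simp only: set_lebesgue_integral_def ** ind)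
  then have eq: "(\<integral>x. indicator S x * \<psi> x \<partial>lebesgue) = (\<integral>y. indicator (T ` S) y * \<phi> y \<partial>lebesgue)"
    by (simp only: integral_bounded_linear[OF v i\<psi>] integral_bounded_linear[OF v i\<phi>]) (simp add: vec_eq_iff)
  have "(\<integral>\<^sup>+x. ennreal (indicator S x * \<psi> x) \<partial>lborel) = (\<integral>\<^sup>+x. ennreal (indicator S x * \<psi> x) \<partial>lebesgue)"
    by (simp add: nn_integral_completion)
  also have "\<dots> = ennreal (\<integral>x. indicator S x * \<psi> x \<partial>lebesgue)"
    using nn by (intro nn_integral_eq_integral i\<psi>) simp
  also have "\<dots> = (\<integral>\<^sup>+y. ennreal (indicator (T ` S) y * \<phi> y) \<partial>lebesgue)"
    using nn unfolding eq by (intro nn_integral_eq_integral[symmetric] i\<phi>) simp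
  also have "\<dots> = (\<integral>\<^sup>+y. ennreal (indicator (T ` S) y * \<phi> y) \<partial>lborel)"
    by (simp add: nn_integral_completion)
  finally show ?thesis .
qed

text \<open>The map is conjugated with \<open>to_idx\<close>, which changes neither Lebesgue measure
  nor the Jacobian determinant.\<close>

lemma change_of_variables:
  fixes T :: "real^'n \<Rightarrow> real^'n" and \<phi> \<psi> :: "real^'n \<Rightarrow> real"
  assumes S: "S \<in> sets borel" "T ` S \<in> sets borel"
    and der: "\<And>x. x \<in> S \<Longrightarrow> (T has_derivative T' x) (at x within S)" and inj: "inj_on T S"
    and meas: "(\<lambda>y. indicator (T ` S) y * \<phi> y) \<in> borel_measurable borel" "(\<lambda>x. indicator S x * \<psi> x) \<in> borel_measurable borel"
    and nonneg: "\<And>y. y \<in> T ` S \<Longrightarrow> 0 \<le> \<phi> y" "\<And>x. x \<in> S \<Longrightarrow> 0 \<le> \<psi> x"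
    and \<psi>: "\<And>x. x \<in> S \<Longrightarrow> \<psi> x = \<bar>det (matrix (T' x))\<bar> * \<phi> (T x)"
    and fin: "(\<integral>\<^sup>+y. ennreal (indicator (T ` S) y * \<phi> y) \<partial>lborel) < \<infinity>"
  shows "(\<integral>\<^sup>+x. ennreal (indicator S x * \<psi> x) \<partial>lborel) = (\<integral>\<^sup>+y. ennreal (indicator (T ` S) y * \<phi> y) \<partial>lborel)"
proof -
  define S' where "S' = of_idx -` S"
  define U where "U = (\<lambda>y. to_idx (T (of_idx y)))"
  have US: "U ` S' = of_idx -` (T ` S)"
  proof (intro set_eqI iffI)
    fix y assume "y \<in> of_idx -` T ` S"
    then obtain x where "x \<in> S" "of_idx y = T x" by auto
    then have "to_idx x \<in> S'" "U (to_idx x) = y" by (simp_all add: S'_def U_def) (metis to_of_idx)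
    then show "y \<in> U ` S'" by blast
  qed (auto simp: U_def S'_def)
  have ind: "indicator (of_idx -` A) y = (indicator A (of_idx y) :: real)" for A :: "(real^'n) set" and y
    by (simp add: indicator_def)
  have S'im: "of_idx ` S' \<subseteq> S" by (auto simp: S'_def)
  have derU: "(U has_derivative (\<lambda>h. to_idx (T' (of_idx y) (of_idx h)))) (at y within S')" if "y \<in> S'" for y
  proof -
    have "of_idx y \<in> S" using that by (simp add: S'_def)
    from has_derivative_subset[OF der[OF this] S'im]
    have "((\<lambda>y. T (of_idx y)) has_derivative (\<lambda>h. T' (of_idx y) (of_idx h))) (at y within S')"
      by (intro has_derivative_in_compose[of of_idx of_idx y S' T "T' (of_idx y)"]
          bounded_linear_imp_has_derivative bounded_linear_of_idx)
    then show ?thesis unfolding U_def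
      by (rule bounded_linear.has_derivative[OF bounded_linear_to_idx])
  qed
  have det_eq: "det (matrix (\<lambda>h. to_idx (T' (of_idx y) (of_idx h)))) = det (matrix (T' (of_idx y)))" for y
  proof -
    have "of_idx (axis l 1) = (axis (deidx l) 1 :: real^'n)" for l
      by (auto simp: of_idx_def axis_def vec_eq_iff)
    then have "matrix (\<lambda>h. to_idx (T' (of_idx y) (of_idx h))) = (\<chi> k l. matrix (T' (of_idx y)) $ deidx k $ deidx l)"
      by (simp add: matrix_def to_idx_def)
    then show ?thesis by (simp add: det_idx)
  qed
  have m1: "(\<lambda>y. indicator (U ` S') y * \<phi> (of_idx y)) \<in> borel_measurable borel"
      "(\<lambda>y. indicator S' y * \<psi> (of_idx y)) \<in> borel_measurable borel"
    using measurable_compose[OF measurable_of_idx meas(1)] measurable_compose[OF measurable_of_idx meas(2)]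
    by (simp_all only: US ind) (simp_all only: S'_def ind)
  have i1: "(\<integral>\<^sup>+y. ennreal (indicator (U ` S') y * \<phi> (of_idx y)) \<partial>lborel) = (\<integral>\<^sup>+y. ennreal (indicator (T ` S) y * \<phi> y) \<partial>lborel)"
    by (subst nn_integral_to_idx[symmetric]) (use m1 in \<open>auto simp: US ind\<close>)
  have i2: "(\<integral>\<^sup>+y. ennreal (indicator S' y * \<psi> (of_idx y)) \<partial>lborel) = (\<integral>\<^sup>+y. ennreal (indicator S y * \<psi> y) \<partial>lborel)"
    by (subst nn_integral_to_idx[symmetric]) (use m1 in \<open>auto simp: S'_def ind\<close>)
  have "(\<integral>\<^sup>+y. ennreal (indicator S' y * \<psi> (of_idx y)) \<partial>lborel) = (\<integral>\<^sup>+y. ennreal (indicator (U ` S') y * \<phi> (of_idx y)) \<partial>lborel)"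
  proof (rule change_of_variables_wellorder[OF _ _ derU _ m1])
    show "S' \<in> sets borel" unfolding S'_def using measurable_sets[OF measurable_of_idx S(1)] by simp
    show "U ` S' \<in> sets borel" unfolding US using measurable_sets[OF measurable_of_idx S(2)] by simp
    show "inj_on U S'"
      using inj unfolding inj_on_def U_def S'_def by (metis of_to_idx to_of_idx vimageE)
    show "\<psi> (of_idx x) = \<bar>det (matrix (\<lambda>h. to_idx (T' (of_idx x) (of_idx h))))\<bar> * \<phi> (of_idx (U x))" if "x \<in> S'" for x
      using \<psi>[of "of_idx x"] that by (simp add: det_eq U_def S'_def)
  qed (use nonneg fin i1 in \<open>auto simp: U_def S'_def\<close>)
  then show ?thesis by (simp only: i1 i2)
qed

text \<open>For \<open>q \<ge> 1\<close> the q-th root of \<open>1 / 2\<close> is at least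
  \<open>1 / 2\<close>, so the factor does not deteriorate with the exponent.\<close>

lemma Lp_norm_half:
  fixes f :: "'m \<Rightarrow> real"
  assumes p: "1 \<le> p" "p \<noteq> \<infinity>"
    and I: "(\<integral>\<^sup>+x. ennreal (\<bar>f x\<bar> powr enn2real p) \<partial>\<mu>) < \<infinity>"
      "ennreal (1 / 2) * (\<integral>\<^sup>+x. ennreal (\<bar>f x\<bar> powr enn2real p) \<partial>\<mu>) \<le> (\<integral>\<^sup>+x. ennreal (\<bar>f x\<bar> powr enn2real p) \<partial>\<nu>)"
  shows "ennreal (1 / 2) * Lp_norm p \<mu> f \<le> Lp_norm p \<nu> f"
proof -
  define q where "q = enn2real p"
  have q: "1 \<le> q"
  proof -
    obtain r where r: "p = ennreal r" "0 \<le> r" using p(2) by (cases p) auto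
    then show ?thesis using p(1) by (simp add: q_def)
  qed
  define J where "J = (\<integral>\<^sup>+x. ennreal (\<bar>f x\<bar> powr q) \<partial>\<nu>)"
  obtain a where a: "(\<integral>\<^sup>+x. ennreal (\<bar>f x\<bar> powr q) \<partial>\<mu>) = ennreal a" "0 \<le> a"
    using I(1) by (cases "\<integral>\<^sup>+x. ennreal (\<bar>f x\<bar> powr q) \<partial>\<mu>") (auto simp: q_def)
  have n\<mu>: "Lp_norm p \<mu> f = ennreal (a powr (1 / q))"
    using p(2) a by (simp add: Lp_norm_def q_def[symmetric] Let_def)
  show ?thesis
  proof (cases "J = \<infinity>")
    case True
    then have "Lp_norm p \<nu> f = \<infinity>" using p(2) by (simp add: Lp_norm_def q_def[symmetric] J_def Let_def)
    then show ?thesis by simp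
  next
    case False
    then obtain b where b: "J = ennreal b" "0 \<le> b" by (cases J) auto
    have n\<nu>: "Lp_norm p \<nu> f = ennreal (b powr (1 / q))"
      using p(2) b by (simp add: Lp_norm_def q_def[symmetric] J_def Let_def)
    have "ennreal (1 / 2) * ennreal a \<le> ennreal b" using I(2) a b by (simp add: q_def J_def)
    then have ab: "1 / 2 * a \<le> b" using a b by (simp add: ennreal_mult[symmetric] del: ennreal_half)
    have "(1 / 2) powr 1 \<le> (1 / 2 :: real) powr (1 / q)" using q by (intro powr_mono') auto
    then have "1 / 2 * a powr (1 / q) \<le> (1 / 2) powr (1 / q) * a powr (1 / q)"
      by (intro mult_right_mono) auto
    also have "\<dots> = (1 / 2 * a) powr (1 / q)" by (simp only: powr_mult)
    also have "\<dots> \<le> b powr (1 / q)" using ab a q by (intro powr_mono2) auto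
    finally have "ennreal (1 / 2 * a powr (1 / q)) \<le> ennreal (b powr (1 / q))" by (rule ennreal_leI)
    moreover have "ennreal (1 / 2 * a powr (1 / q)) = ennreal (1 / 2) * ennreal (a powr (1 / q))"
      by (rule ennreal_mult) simp_all
    ultimately show ?thesis unfolding n\<mu> n\<nu> by (simp only:)
  qed
qed

section \<open>Charts and the Riemannian volume\<close>

locale closed_manifold =
  fixes M :: "'m::t2_space set" and A :: "('m, 'n::finite) chart set" and g :: "('m, 'n) metric_coeffs"
  assumes closed: "closed_riemannian_manifold M A g"
begin

lemma compact_M: "compact M" and connected_M: "connected M" and M_nonempty: "M \<noteq> {}"
  using closed by (auto simp: closed_riemannian_manifold_def)

lemma atlas: "smooth_atlas M A" and metric: "riemannian_metric A g"
  using closed by (auto simp: closed_riemannian_manifold_def)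

lemma chart_cover: "x \<in> M \<Longrightarrow> \<exists>c\<in>A. x \<in> chart_dom c"
  using atlas by (auto simp: smooth_atlas_def)

lemma dom_subset: "c \<in> A \<Longrightarrow> chart_dom c \<subseteq> M"
  using atlas by (auto simp: smooth_atlas_def)

lemma A_nonempty: "A \<noteq> {}"
  using chart_cover M_nonempty by blast

lemma openin_dom: "c \<in> A \<Longrightarrow> openin (top_of_set M) (chart_dom c)"
  and open_ran: "c \<in> A \<Longrightarrow> open (chart_ran c)"
  and chart_homeo: "c \<in> A \<Longrightarrow> homeomorphism (chart_dom c) (chart_ran c) (chart_map c) (chart_inv c)"
  using atlas by (auto simp: smooth_atlas_def)

lemma inv_map: "c \<in> A \<Longrightarrow> x \<in> chart_dom c \<Longrightarrow> chart_inv c (chart_map c x) = x"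
  and map_inv: "c \<in> A \<Longrightarrow> y \<in> chart_ran c \<Longrightarrow> chart_map c (chart_inv c y) = y"
  and cont_map: "c \<in> A \<Longrightarrow> continuous_on (chart_dom c) (chart_map c)"
  and cont_inv: "c \<in> A \<Longrightarrow> continuous_on (chart_ran c) (chart_inv c)"
  using chart_homeo unfolding homeomorphism_def by blast+

lemma inv_dom: "c \<in> A \<Longrightarrow> y \<in> chart_ran c \<Longrightarrow> chart_inv c y \<in> chart_dom c"
  using chart_homeo[of c] by (metis homeomorphism_image2 imageI)

lemma openin_chart_image:
  assumes "c \<in> A" "open V" "V \<subseteq> chart_ran c"
  shows "openin (top_of_set M) (chart_inv c ` V)"
proof -
  have "openin (top_of_set (chart_ran c)) V" using assms by (simp add: openin_open_eq open_ran)
  then have "openin (top_of_set (chart_dom c)) (chart_inv c ` V)"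
    using homeomorphism_imp_open_map[OF homeomorphism_symD[OF chart_homeo[OF assms(1)]]] by blast
  then show ?thesis using openin_dom[OF assms(1)] openin_trans by blast
qed

lemma posdef_g: "c \<in> A \<Longrightarrow> y \<in> chart_ran c \<Longrightarrow> posdef (g c y)"
  using metric by (auto simp: riemannian_metric_def posdef_def)

lemma smooth_g: "c \<in> A \<Longrightarrow> smooth_on (chart_ran c) (g c)"
  using metric by (auto simp: riemannian_metric_def)

lemma transition_open:
  assumes "c \<in> A" "d \<in> A"
  shows "open (chart_map c ` (chart_dom c \<inter> chart_dom d))"
proof -
  have "openin (top_of_set (chart_dom c)) (chart_dom c \<inter> chart_dom d)"
    using openin_dom[OF assms(2)] dom_subset[OF assms(1)] openin_subtopology_Int2
    by (metis inf.absorb_iff2 inf_commute subtopology_subtopology subtopology_topspace)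
  then have "openin (top_of_set (chart_ran c)) (chart_map c ` (chart_dom c \<inter> chart_dom d))"
    using homeomorphism_imp_open_map[OF chart_homeo[OF assms(1)]] by blast
  then show ?thesis using open_ran[OF assms(1)] openin_open_trans by blast
qed

lemma transition_C1:
  assumes "c \<in> A" "d \<in> A"
  shows "C1_fun (chart_map c ` (chart_dom c \<inter> chart_dom d)) (chart_map d \<circ> chart_inv c)"
  using atlas assms by (auto simp: smooth_atlas_def intro!: smooth_on_C1)

lemma transition_deriv:
  assumes "c \<in> A" "d \<in> A" "x \<in> chart_map c ` (chart_dom c \<inter> chart_dom d)"
  shows "((chart_map d \<circ> chart_inv c) has_derivative frechet_derivative (chart_map d \<circ> chart_inv c) (at x)) (at x)"
  using transition_C1[OF assms(1,2)] assms(3)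
  by (metis C1_fun_def differentiable_def frechet_derivative_works)

lemma transition_metric:
  assumes "c \<in> A" "d \<in> A" "x \<in> chart_map c ` (chart_dom c \<inter> chart_dom d)"
  shows "g c x = transpose (matrix (frechet_derivative (chart_map d \<circ> chart_inv c) (at x))) **
     g d ((chart_map d \<circ> chart_inv c) x) ** matrix (frechet_derivative (chart_map d \<circ> chart_inv c) (at x))"
  using metric assms unfolding riemannian_metric_def Let_def by blast

text \<open>The root of the determinant of a congruence. With the change of variables formula it
  makes the chart volumes agree on overlaps.\<close>

lemma transition_density:
  assumes "c \<in> A" "d \<in> A" "x \<in> chart_map c ` (chart_dom c \<inter> chart_dom d)"
  shows "sqrt (det (g c x)) = \<bar>det (matrix (frechet_derivative (chart_map d \<circ> chart_inv c) (at x)))\<bar>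
    * sqrt (det (g d ((chart_map d \<circ> chart_inv c) x)))"
proof -
  let ?T = "chart_map d \<circ> chart_inv c"
  let ?J = "matrix (frechet_derivative ?T (at x))"
  have "det (g c x) = (det ?J)\<^sup>2 * det (g d (?T x))"
    using arg_cong[OF transition_metric[OF assms], of det]
    unfolding det_mul det_transpose power2_eq_square by (simp only: mult.assoc mult.left_commute mult.commute)
  then show ?thesis by (simp only: real_sqrt_mult real_sqrt_abs)
qed

section \<open>Chart volumes and their supremum\<close>

definition MB :: "'m measure" where "MB = restrict_space borel M"

lemma space_MB: "space MB = M"
  by (simp add: MB_def space_restrict_space)

lemma openin_sets_MB: "openin (top_of_set M) S \<Longrightarrow> S \<in> sets MB"
  by (auto simp: MB_def openin_open sets_restrict_space)

lemma dom_sets_MB: "c \<in> A \<Longrightarrow> chart_dom c \<in> sets MB"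
  by (intro openin_sets_MB openin_dom)

lemma measurable_chart_inv:
  assumes "c \<in> A"
  shows "chart_inv c \<in> measurable (restrict_space lborel (chart_ran c)) MB"
proof -
  have "chart_inv c \<in> borel_measurable (restrict_space borel (chart_ran c))"
    by (rule borel_measurable_continuous_on_restrict[OF cont_inv[OF assms]])
  then have "chart_inv c \<in> borel_measurable (restrict_space lborel (chart_ran c))"
    by (simp cong: measurable_cong_sets add: sets_restrict_space)
  then show ?thesis unfolding MB_def
    using inv_dom[OF assms] dom_subset[OF assms] by (intro measurable_restrict_space2) (auto simp: space_restrict_space)
qed

lemma chart_preimage_borel:
  assumes "c \<in> A" "B \<in> sets MB"
  shows "{y\<in>chart_ran c. chart_inv c y \<in> B} \<in> sets borel"
proof -
  have "chart_inv c -` B \<inter> space (restrict_space lborel (chart_ran c)) \<in> sets (restrict_space lborel (chart_ran c))"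
    by (rule measurable_sets[OF measurable_chart_inv[OF assms(1)] assms(2)])
  moreover have "chart_inv c -` B \<inter> space (restrict_space lborel (chart_ran c)) = {y\<in>chart_ran c. chart_inv c y \<in> B}"
    by (auto simp: space_restrict_space)
  ultimately show ?thesis
    using open_ran[OF assms(1)] by (simp add: sets_restrict_space_iff)
qed

lemma density_continuous: "c \<in> A \<Longrightarrow> continuous_on (chart_ran c) (\<lambda>y. sqrt (det (g c y)))"
  by (intro continuous_on_real_sqrt C1_fun_continuous[OF C1_fun_det[OF C1_fun_entry[OF smooth_on_C1[OF smooth_g]]]])

lemma density_pos: "c \<in> A \<Longrightarrow> y \<in> chart_ran c \<Longrightarrow> 0 < sqrt (det (g c y))"
  using posdef_det_pos[OF posdef_g] by simp

lemma density_measurable: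
  assumes "c \<in> A"
  shows "(\<lambda>y. ennreal (sqrt (det (g c y)))) \<in> borel_measurable (restrict_space lborel (chart_ran c))"
proof -
  have "(\<lambda>y. sqrt (det (g c y))) \<in> borel_measurable (restrict_space borel (chart_ran c))"
    by (rule borel_measurable_continuous_on_restrict[OF density_continuous[OF assms]])
  then have "(\<lambda>y. sqrt (det (g c y))) \<in> borel_measurable (restrict_space lborel (chart_ran c))"
    by (simp cong: measurable_cong_sets add: sets_restrict_space)
  then show ?thesis by measurable
qed

lemma sets_chart_volume [simp]: "sets (chart_volume M g c) = sets MB"
  by (simp add: chart_volume_def MB_def)

lemma nn_integral_chart_volume:
  assumes c: "c \<in> A" and f: "f \<in> borel_measurable MB"
  shows "(\<integral>\<^sup>+x. f x \<partial>chart_volume M g c) =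
    (\<integral>\<^sup>+y. ennreal (sqrt (det (g c y))) * f (chart_inv c y) * indicator (chart_ran c) y \<partial>lborel)"
proof -
  let ?L = "restrict_space lborel (chart_ran c)"
  have [measurable]: "chart_inv c \<in> measurable ?L MB" by (rule measurable_chart_inv[OF c])
  have [measurable]: "(\<lambda>y. ennreal (sqrt (det (g c y)))) \<in> borel_measurable ?L" by (rule density_measurable[OF c])
  note [measurable] = f
  have "(\<integral>\<^sup>+x. f x \<partial>chart_volume M g c) = (\<integral>\<^sup>+y. f (chart_inv c y) \<partial>density ?L (\<lambda>y. ennreal (sqrt (det (g c y)))))"
    unfolding chart_volume_def MB_def[symmetric] by (rule nn_integral_distr) measurable
  also have "\<dots> = (\<integral>\<^sup>+y. ennreal (sqrt (det (g c y))) * f (chart_inv c y) \<partial>?L)"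
    by (rule nn_integral_density) measurable
  also have "\<dots> = (\<integral>\<^sup>+y. ennreal (sqrt (det (g c y))) * f (chart_inv c y) * indicator (chart_ran c) y \<partial>lborel)"
    using open_ran[OF c] by (intro nn_integral_restrict_space) simp
  finally show ?thesis .
qed

lemma emeasure_chart_volume:
  assumes c: "c \<in> A" and B: "B \<in> sets MB"
  shows "emeasure (chart_volume M g c) B =
    (\<integral>\<^sup>+y. ennreal (indicator {y\<in>chart_ran c. chart_inv c y \<in> B} y * sqrt (det (g c y))) \<partial>lborel)"
proof -
  have "emeasure (chart_volume M g c) B = (\<integral>\<^sup>+x. indicator B x \<partial>chart_volume M g c)"
    using B by simp
  also have "\<dots> = (\<integral>\<^sup>+y. ennreal (sqrt (det (g c y))) * indicator B (chart_inv c y) * indicator (chart_ran c) y \<partial>lborel)"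
    using B by (intro nn_integral_chart_volume c) simp
  also have "\<dots> = (\<integral>\<^sup>+y. ennreal (indicator {y\<in>chart_ran c. chart_inv c y \<in> B} y * sqrt (det (g c y))) \<partial>lborel)"
    by (intro nn_integral_cong) (auto simp: indicator_def)
  finally show ?thesis .
qed

text \<open>The volume of \<open>d\<close> sees only \<open>B \<inter> chart_dom d\<close>, and
  there the transition map turns it into the volume of \<open>c\<close>. An inequality remains
  because \<open>B\<close> may leave \<open>chart_dom d\<close>.\<close>

lemma chart_volume_compare:
  assumes cd: "c \<in> A" "d \<in> A" and B: "B \<in> sets MB" "B \<subseteq> chart_dom c"
  shows "emeasure (chart_volume M g d) B \<le> emeasure (chart_volume M g c) B"
proof -
  define T where "T = chart_map c \<circ> chart_inv d"
  define S where "S = {y\<in>chart_ran d. chart_inv d y \<in> B}"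
  define S' where "S' = {y\<in>chart_ran c. chart_inv c y \<in> B \<inter> chart_dom d}"
  define \<phi> where "\<phi> y = sqrt (det (g c y))" for y
  define \<psi> where "\<psi> y = sqrt (det (g d y))" for y
  have Bd: "B \<inter> chart_dom d \<in> sets MB" using B dom_sets_MB[OF cd(2)] by blast
  have TS: "T ` S = S'"
  proof (intro set_eqI iffI)
    fix y assume "y \<in> T ` S"
    then obtain z where z: "z \<in> chart_ran d" "chart_inv d z \<in> B" "y = chart_map c (chart_inv d z)"
      by (auto simp: T_def S_def)
    then show "y \<in> S'" using B inv_dom[OF cd(2) z(1)] inv_map[OF cd(1)] by (auto simp: S'_def)
  next
    fix y assume y: "y \<in> S'"
    define x where "x = chart_inv c y"
    have x: "x \<in> B" "x \<in> chart_dom d" "y = chart_map c x"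
      using y map_inv[OF cd(1), of y] by (auto simp: S'_def x_def)
    then have "chart_map d x \<in> S" "T (chart_map d x) = y"
      using inv_map[OF cd(2) x(2)] by (auto simp: S_def T_def)
    then show "y \<in> T ` S" by blast
  qed
  have SO: "S \<subseteq> chart_map d ` (chart_dom d \<inter> chart_dom c)"
  proof
    fix y assume y: "y \<in> S"
    then have yr: "y \<in> chart_ran d" "chart_inv d y \<in> B" by (simp_all add: S_def)
    then have "chart_inv d y \<in> chart_dom d \<inter> chart_dom c" using B inv_dom[OF cd(2)] by blast
    then show "y \<in> chart_map d ` (chart_dom d \<inter> chart_dom c)"
      by (rule image_eqI[rotated]) (simp add: map_inv[OF cd(2) yr(1)])
  qed
  have meas_ran: "(\<lambda>y. indicator X y * sqrt (det (g c y))) \<in> borel_measurable borel"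
    if "c \<in> A" "X \<in> sets borel" "X \<subseteq> chart_ran c" for c X
    using borel_measurable_continuous_on_indicator[OF that(2) continuous_on_subset[OF density_continuous[OF that(1)] that(3)]]
    by simp
  have Sran: "S \<subseteq> chart_ran d" and S'ran: "S' \<subseteq> chart_ran c" by (auto simp: S_def S'_def)
  have em_d: "emeasure (chart_volume M g d) B = (\<integral>\<^sup>+y. ennreal (indicator S y * \<psi> y) \<partial>lborel)"
    unfolding emeasure_chart_volume[OF cd(2) B(1)] S_def \<psi>_def ..
  have em_c: "(\<integral>\<^sup>+y. ennreal (indicator (T ` S) y * \<phi> y) \<partial>lborel) \<le> emeasure (chart_volume M g c) B"
    unfolding TS emeasure_chart_volume[OF cd(1) B(1)]
    using density_pos[OF cd(1), THEN less_imp_le]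
    by (intro nn_integral_mono ennreal_leI) (auto simp: indicator_def S'_def \<phi>_def simp del: real_sqrt_ge_0_iff)
  \<comment> \<open>The change of variables requires a finite integral on the side of
    \<open>c\<close>; if the volume there is infinite, the claim is trivial.\<close>
  show ?thesis
  proof (cases "emeasure (chart_volume M g c) B < \<infinity>")
    case True
    have "(\<integral>\<^sup>+y. ennreal (indicator S y * \<psi> y) \<partial>lborel) = (\<integral>\<^sup>+y. ennreal (indicator (T ` S) y * \<phi> y) \<partial>lborel)"
    proof (rule change_of_variables[where T' = "\<lambda>y. frechet_derivative T (at y)"])
      show "S \<in> sets borel" "T ` S \<in> sets borel"
        using chart_preimage_borel[OF cd(2) B(1)] chart_preimage_borel[OF cd(1) Bd]
        unfolding TS unfolding S_def S'_def by simp_all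
      then show "(\<lambda>y. indicator (T ` S) y * \<phi> y) \<in> borel_measurable borel"
        "(\<lambda>y. indicator S y * \<psi> y) \<in> borel_measurable borel"
        unfolding \<phi>_def \<psi>_def using S'ran Sran cd by (auto intro!: meas_ran simp: TS)
      show "(T has_derivative frechet_derivative T (at y)) (at y within S)" if "y \<in> S" for y
        using transition_deriv[OF cd(2,1)] SO that unfolding T_def by (meson has_derivative_at_withinI subsetD)
      show "inj_on T S"
      proof (rule inj_onI)
        fix x y assume xy: "x \<in> S" "y \<in> S" "T x = T y"
        then have "chart_inv d x \<in> chart_dom c" "chart_inv d y \<in> chart_dom c" using B by (auto simp: S_def)
        then have "chart_inv d x = chart_inv d y"
          using xy(3) inv_map[OF cd(1)] unfolding T_def by (metis comp_apply)
        then show "x = y" using xy map_inv[OF cd(2)] unfolding S_def by (metis (no_types, lifting) mem_Collect_eq)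
      qed
      show "0 \<le> \<phi> y" if "y \<in> T ` S" for y
        using that density_pos[OF cd(1), of y] by (auto simp: TS S'_def \<phi>_def)
      show "0 \<le> \<psi> y" if "y \<in> S" for y
        using that density_pos[OF cd(2), of y] by (auto simp: S_def \<psi>_def)
      show "\<psi> y = \<bar>det (matrix (frechet_derivative T (at y)))\<bar> * \<phi> (T y)" if "y \<in> S" for y
        using transition_density[OF cd(2,1)] SO that unfolding T_def \<phi>_def \<psi>_def by blast
      show "(\<integral>\<^sup>+y. ennreal (indicator (T ` S) y * \<phi> y) \<partial>lborel) < \<infinity>"
        using em_c True by simp
    qed
    then show ?thesis using em_c em_d by simp
  next
    case False
    then have "emeasure (chart_volume M g c) B = top" by (simp add: less_top[symmetric])
    then show ?thesis by simp
  qed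
qed

abbreviation vol :: "'m measure" where "vol \<equiv> riemannian_volume M A g"

lemma sets_vol [simp]: "sets vol = sets MB"
  unfolding riemannian_volume_def by (rule sets_SUP) (auto simp: A_nonempty)

lemma space_vol [simp]: "space vol = M"
  using sets_eq_imp_space_eq[OF sets_vol] by (simp add: space_MB)

lemma chart_volume_le_vol: "c \<in> A \<Longrightarrow> chart_volume M g c \<le> vol"
  unfolding riemannian_volume_def by (rule SUP_upper)

text \<open>The measure \<open>\<nu>\<close> below bounds all chart volumes and agrees with the given one on its domain.\<close>

lemma vol_le_chart_volume:
  assumes c: "c \<in> A" and B: "B \<in> sets MB" "B \<subseteq> chart_dom c"
  shows "emeasure vol B \<le> emeasure (chart_volume M g c) B"
proof -
  \<comment> \<open>Sets that leave the chart get mass \<infinity>. This is countably additive, as a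
    union leaves the chart exactly if some member does, and it makes the comparison with the other
    charts trivial for such sets.\<close>
  let ?f = "\<lambda>B. if B \<subseteq> chart_dom c then emeasure (chart_volume M g c) B else \<infinity>"
  define \<nu> where "\<nu> = measure_of M (sets MB) ?f"
  have alg: "sigma_algebra M (sets MB)" using sets.sigma_algebra_axioms[of MB] by (simp add: space_MB)
  have sets_\<nu>: "sets \<nu> = sets MB"
    unfolding \<nu>_def by (metis alg sigma_algebra.sets_measure_of_eq)
  have "positive (sets MB) ?f" by (simp add: positive_def)
  moreover have "countably_additive (sets MB) ?f"
  proof (rule countably_additiveI)
    fix F :: "nat \<Rightarrow> 'm set"
    assume F: "range F \<subseteq> sets MB" "disjoint_family F" "\<Union> (range F) \<in> sets MB"
    show "(\<Sum>i. ?f (F i)) = ?f (\<Union> (range F))"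
    proof (cases "\<forall>i. F i \<subseteq> chart_dom c")
      case True
      then have "(\<Sum>i. ?f (F i)) = (\<Sum>i. emeasure (chart_volume M g c) (F i))" by simp
      also have "\<dots> = emeasure (chart_volume M g c) (\<Union> (range F))"
        using F by (intro suminf_emeasure) auto
      finally show ?thesis using True by auto
    next
      case False
      then obtain i where i: "\<not> F i \<subseteq> chart_dom c" by blast
      then have "\<not> \<Union> (range F) \<subseteq> chart_dom c" by blast
      moreover have "h i \<le> suminf h" for h :: "nat \<Rightarrow> ennreal"
        using sum_le_suminf[OF summableI, of "{i}" h] by simp
      from this[of "\<lambda>i. ?f (F i)"] have "(\<Sum>i. ?f (F i)) = \<infinity>" using i by (simp add: top_unique)
      ultimately show ?thesis by simp
    qed
  qed
  ultimately have em: "emeasure \<nu> X = ?f X" if "X \<in> sets MB" for X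
    unfolding \<nu>_def using alg that by (intro emeasure_measure_of_sigma) auto
  have "chart_volume M g d \<le> \<nu>" if "d \<in> A" for d
  proof (subst le_measure)
    show "sets (chart_volume M g d) = sets \<nu>" by (simp add: sets_\<nu>)
    show "\<forall>X\<in>sets (chart_volume M g d). emeasure (chart_volume M g d) X \<le> emeasure \<nu> X"
      using chart_volume_compare[OF c that] by (auto simp: em)
  qed
  then have "vol \<le> \<nu>" unfolding riemannian_volume_def by (intro SUP_least)
  then have "emeasure vol B \<le> emeasure \<nu> B"
    using le_measure[of vol \<nu>] B by (simp add: sets_\<nu>)
  then show ?thesis using em[OF B(1)] B(2) by simp
qed

lemma nn_integral_chart_volume_le_vol:
  "c \<in> A \<Longrightarrow> (\<integral>\<^sup>+x. f x \<partial>chart_volume M g c) \<le> (\<integral>\<^sup>+x. f x \<partial>vol)"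
  by (intro nn_integral_mono_measure chart_volume_le_vol) simp

lemma nn_integral_vol_le_chart_volume:
  assumes c: "c \<in> A" and B: "B \<in> sets MB" "B \<subseteq> chart_dom c"
  shows "(\<integral>\<^sup>+x. f x * indicator B x \<partial>vol) \<le> (\<integral>\<^sup>+x. f x * indicator B x \<partial>chart_volume M g c)"
proof -
  have sp: "space (chart_volume M g c) = M"
    using sets_eq_imp_space_eq[OF sets_chart_volume] by (simp add: space_MB)
  have BM: "B \<subseteq> M" using B dom_subset[OF c] by blast
  have "restrict_space vol B \<le> restrict_space (chart_volume M g c) B"
  proof (subst le_measure)
    show "sets (restrict_space vol B) = sets (restrict_space (chart_volume M g c) B)"
      by (simp add: sets_restrict_space)
    show "\<forall>X\<in>sets (restrict_space vol B). emeasure (restrict_space vol B) X \<le> emeasure (restrict_space (chart_volume M g c) B) X"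
    proof
      fix X assume "X \<in> sets (restrict_space vol B)"
      then have X: "X \<in> sets MB" "X \<subseteq> B" using B by (auto simp: sets_restrict_space)
      then show "emeasure (restrict_space vol B) X \<le> emeasure (restrict_space (chart_volume M g c) B) X"
        using vol_le_chart_volume[OF c X(1)] B BM by (subst (1 2) emeasure_restrict_space) (auto simp: sp Int_absorb2)
    qed
  qed
  then have "(\<integral>\<^sup>+x. f x \<partial>restrict_space vol B) \<le> (\<integral>\<^sup>+x. f x \<partial>restrict_space (chart_volume M g c) B)"
    by (intro nn_integral_mono_measure) (simp_all add: sets_restrict_space)
  then show ?thesis
    using B BM by (subst (asm) (1 2) nn_integral_restrict_space) (auto simp: sp Int_absorb2)
qed

end

section \<open>Curves and tubular neighbourhoods\<close>

text \<open>A local and two-sided notion, so that it passes through transition maps, affine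
  substitutions and changes of the function away from the point.\<close>

definition C1_near :: "(real \<Rightarrow> 'a::real_normed_vector) \<Rightarrow> real \<Rightarrow> bool" where
  "C1_near \<phi> t \<longleftrightarrow> (\<exists>U D. open U \<and> t \<in> U \<and> (\<forall>s\<in>U. (\<phi> has_vector_derivative D s) (at s)) \<and> continuous_on U D)"

lemma C1_near_cong:
  assumes "C1_near \<phi> t" "open V" "t \<in> V" "\<And>s. s \<in> V \<Longrightarrow> \<phi> s = \<psi> s"
  shows "C1_near \<psi> t"
proof -
  obtain U D where U: "open U" "t \<in> U" "\<forall>s\<in>U. (\<phi> has_vector_derivative D s) (at s)" "continuous_on U D"
    using assms(1) by (auto simp: C1_near_def)
  have "(\<psi> has_vector_derivative D s) (at s)" if "s \<in> U \<inter> V" for s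
    using U(3) that assms(2,4) has_vector_derivative_transform_within_open[of \<phi> "D s" s V \<psi>] by blast
  then show ?thesis
    unfolding C1_near_def using U assms(2,3) continuous_on_subset[OF U(4), of "U \<inter> V"]
    by (intro exI[of _ "U \<inter> V"] exI[of _ D]) auto
qed

lemma C1_near_affine:
  assumes "C1_near \<phi> (a * t + b)"
  shows "C1_near (\<lambda>s. \<phi> (a * s + b)) t"
proof -
  obtain U D where U: "open U" "a * t + b \<in> U" "\<forall>s\<in>U. (\<phi> has_vector_derivative D s) (at s)" "continuous_on U D"
    using assms by (auto simp: C1_near_def)
  have "open ((\<lambda>s. a * s + b) -` U)" by (intro open_vimage U continuous_intros)
  moreover have "((\<lambda>s. \<phi> (a * s + b)) has_vector_derivative a *\<^sub>R D (a * s + b)) (at s)" if "a * s + b \<in> U" for s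
  proof -
    have "((\<lambda>s. a * s + b) has_vector_derivative a) (at s)"
      by (auto intro!: derivative_eq_intros)
    from vector_diff_chain_at[OF this] show ?thesis using U(3) that by (auto simp: o_def)
  qed
  moreover have "continuous_on ((\<lambda>s. a * s + b) -` U) (\<lambda>s. a *\<^sub>R D (a * s + b))"
    by (intro continuous_on_scaleR continuous_on_compose2[OF U(4)] continuous_intros) auto
  ultimately show ?thesis
    unfolding C1_near_def using U(2)
    by (intro exI[of _ "(\<lambda>s. a * s + b) -` U"] exI[of _ "\<lambda>s. a *\<^sub>R D (a * s + b)"]) auto
qed

lemma C1_near_compose:
  fixes T :: "real^'n \<Rightarrow> 'b::real_normed_vector"
  assumes \<phi>: "C1_near \<phi> t" and T: "C1_fun W T" "open W" "\<phi> t \<in> W"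
  shows "C1_near (T \<circ> \<phi>) t"
proof -
  obtain U D where U: "open U" "t \<in> U" "\<And>s. s \<in> U \<Longrightarrow> (\<phi> has_vector_derivative D s) (at s)" "continuous_on U D"
    using \<phi> by (auto simp: C1_near_def)
  obtain T' where T': "\<And>x. x \<in> W \<Longrightarrow> (T has_derivative T' x) (at x)" "\<And>v. continuous_on W (\<lambda>x. T' x v)"
    using T by (auto simp: C1_fun_def)
  have c\<phi>: "continuous_on U \<phi>"
    using U(3) by (meson continuous_at_imp_continuous_on has_vector_derivative_continuous)
  define V where "V = U \<inter> \<phi> -` W"
  have V: "open V" "t \<in> V" "V \<subseteq> U" "\<phi> ` V \<subseteq> W"
    unfolding V_def using continuous_open_preimage[OF c\<phi> U(1) T(2)] U T by auto
  have "((T \<circ> \<phi>) has_vector_derivative T' (\<phi> s) (D s)) (at s)" if "s \<in> V" for s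
    using U(3)[of s] T'(1)[of "\<phi> s"] that V
    by (intro vector_derivative_diff_chain_within) (auto intro: has_derivative_at_withinI)
  moreover have "continuous_on V (\<lambda>s. T' (\<phi> s) (D s))"
  proof -
    \<comment> \<open>\<open>T'\<close> is known to be continuous for fixed directions only;
      expanding the moving direction \<open>D s\<close> in the basis reduces to these.\<close>
    have cD: "continuous_on V (\<lambda>s. D s $ j)" for j
      by (rule continuous_on_component[OF continuous_on_subset[OF U(4) V(3)]])
    have cT: "continuous_on V (\<lambda>s. T' (\<phi> s) w)" for w
      by (rule continuous_on_compose2[OF T'(2) continuous_on_subset[OF c\<phi> V(3)] V(4)])
    have "continuous_on V (\<lambda>s. \<Sum>j\<in>UNIV. D s $ j *\<^sub>R T' (\<phi> s) (axis j 1))"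
      by (intro continuous_on_sum continuous_on_scaleR cD cT)
    moreover have "(\<Sum>j\<in>UNIV. D s $ j *\<^sub>R T' (\<phi> s) (axis j 1)) = T' (\<phi> s) (D s)" if "s \<in> V" for s
      using T'(1)[of "\<phi> s"] V that
      by (intro linear_vec_expansion[symmetric] has_derivative_linear) auto
    ultimately show ?thesis by (simp cong: continuous_on_cong)
  qed
  ultimately show ?thesis unfolding C1_near_def using V(1,2)
    by (intro exI[of _ V] exI[of _ "\<lambda>s. T' (\<phi> s) (D s)"]) simp
qed

lemma C1_nearD:
  assumes "C1_near \<phi> t"
  shows "(\<phi> has_vector_derivative vector_derivative \<phi> (at t)) (at t)"
    "isCont (\<lambda>s. vector_derivative \<phi> (at s)) t" "isCont \<phi> t"
proof -
  obtain U D where U: "open U" "t \<in> U" "\<And>s. s \<in> U \<Longrightarrow> (\<phi> has_vector_derivative D s) (at s)" "continuous_on U D"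
    using assms by (auto simp: C1_near_def)
  have eq: "vector_derivative \<phi> (at s) = D s" if "s \<in> U" for s
    using U(3)[OF that] by (rule vector_derivative_at)
  then have "continuous_on U (\<lambda>s. vector_derivative \<phi> (at s))" using U(4) by (simp cong: continuous_on_cong)
  then show "isCont (\<lambda>s. vector_derivative \<phi> (at s)) t"
    using U by (simp add: continuous_on_eq_continuous_at)
  show "(\<phi> has_vector_derivative vector_derivative \<phi> (at t)) (at t)" using U eq by simp
  show "isCont \<phi> t" using U(3)[OF U(2)] by (rule has_vector_derivative_continuous)
qed

lemma C1_near_imp_C1_on:
  assumes "\<And>t. t \<in> S \<Longrightarrow> C1_near \<phi> t"
  shows "\<phi> C1_differentiable_on S"
  unfolding C1_differentiable_on_def
proof (intro exI conjI ballI)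
  show "(\<phi> has_vector_derivative vector_derivative \<phi> (at t)) (at t)" if "t \<in> S" for t
    using C1_nearD(1)[OF assms[OF that]] .
  show "continuous_on S (\<lambda>s. vector_derivative \<phi> (at s))"
    by (intro continuous_at_imp_continuous_on ballI C1_nearD(2) assms)
qed

lemma C1_on_open_imp_near: "\<phi> C1_differentiable_on S \<Longrightarrow> open S \<Longrightarrow> t \<in> S \<Longrightarrow> C1_near \<phi> t"
  unfolding C1_differentiable_on_def C1_near_def by blast

context closed_manifold
begin

lemma finite_subcover:
  assumes "\<And>x. x \<in> M \<Longrightarrow> openin (top_of_set M) (W x)" "\<And>x. x \<in> M \<Longrightarrow> x \<in> W x"
  shows "\<exists>X. X \<subseteq> M \<and> finite X \<and> M \<subseteq> (\<Union>x\<in>X. W x)"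
proof -
  have "(\<forall>c\<in>W ` M. openin (top_of_set M) c) \<and> M \<subseteq> \<Union> (W ` M)" using assms by auto
  from compact_M[unfolded compact_eq_openin_cover, THEN spec, THEN mp, OF this]
  obtain D where D: "D \<subseteq> W ` M" "finite D" "M \<subseteq> \<Union> D" by blast
  then obtain X where "X \<subseteq> M" "finite X" "D = W ` X" using finite_subset_image[OF D(2,1)] by metis
  then show ?thesis using D by blast
qed

lemma finite_chart_cover: "\<exists>C. C \<subseteq> A \<and> finite C \<and> M \<subseteq> (\<Union>c\<in>C. chart_dom c)"
proof -
  have "\<forall>x\<in>M. \<exists>c. c \<in> A \<and> x \<in> chart_dom c" using chart_cover by metis
  from bchoice[OF this] obtain c where c: "\<forall>x\<in>M. c x \<in> A \<and> x \<in> chart_dom (c x)" by metis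
  have "\<exists>X. X \<subseteq> M \<and> finite X \<and> M \<subseteq> (\<Union>x\<in>X. chart_dom (c x))"
    using c by (intro finite_subcover openin_dom) simp_all
  then obtain X where X: "X \<subseteq> M" "finite X" "M \<subseteq> (\<Union>x\<in>X. chart_dom (c x))" by metis
  show ?thesis
  proof (intro exI conjI)
    show "c ` X \<subseteq> A" using X(1) c by (metis image_subsetI subsetD)
    show "finite (c ` X)" using X(2) by simp
    show "M \<subseteq> (\<Union>c\<in>c ` X. chart_dom c)" using X(3) by simp
  qed
qed

lemma curve_preimage_open:
  assumes "path \<gamma>" "path_image \<gamma> \<subseteq> M" "openin (top_of_set M) S"
  shows "open {s\<in>{0<..<1}. \<gamma> s \<in> S}"
proof -
  obtain V where V: "open V" "S = M \<inter> V" using assms(3) by (auto simp: openin_open)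
  have "continuous_on {0<..<1} \<gamma>" using assms(1) unfolding path_def by (rule continuous_on_subset) auto
  then have "open ({0<..<1} \<inter> \<gamma> -` V)" by (rule continuous_open_preimage) (use V in auto)
  moreover have "{0<..<1} \<inter> \<gamma> -` V = {s\<in>{0<..<1}. \<gamma> s \<in> S}"
    using assms(2) V by (auto simp: path_image_def)
  ultimately show ?thesis by simp
qed

section \<open>Piecewise C1 curves, their speed and their length\<close>

text \<open>One finite exceptional set serves all charts, whereas \<open>piecewise_C1_curve\<close>
  allows a separate one for each of possibly infinitely many charts. The endpoints are left out
  since derivatives are two-sided.\<close>

definition regular_curve :: "(real \<Rightarrow> 'm) \<Rightarrow> real set \<Rightarrow> bool" where
  "regular_curve \<gamma> F \<longleftrightarrow> path \<gamma> \<and> path_image \<gamma> \<subseteq> M \<and> finite F \<and>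
     (\<forall>t\<in>{0<..<1} - F. \<forall>d\<in>A. \<gamma> t \<in> chart_dom d \<longrightarrow> C1_near (chart_map d \<circ> \<gamma>) t)"

lemma regular_curveD:
  assumes "regular_curve \<gamma> F"
  shows "path \<gamma>" "path_image \<gamma> \<subseteq> M" "finite F"
    "t \<in> {0<..<1} - F \<Longrightarrow> d \<in> A \<Longrightarrow> \<gamma> t \<in> chart_dom d \<Longrightarrow> C1_near (chart_map d \<circ> \<gamma>) t"
  using assms unfolding regular_curve_def by blast+

lemma change_chart_near:
  assumes cd: "c \<in> A" "d \<in> A" and t: "0 < t" "t < 1" "\<gamma> t \<in> chart_dom c" "\<gamma> t \<in> chart_dom d"
    and \<gamma>: "path \<gamma>" "path_image \<gamma> \<subseteq> M"
  shows "\<exists>V. open V \<and> t \<in> V \<and> (\<forall>s\<in>V. ((chart_map d \<circ> chart_inv c) \<circ> (chart_map c \<circ> \<gamma>)) s = (chart_map d \<circ> \<gamma>) s)"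
proof (intro exI conjI ballI)
  show "open {s\<in>{0<..<1}. \<gamma> s \<in> chart_dom c}" by (intro curve_preimage_open \<gamma> openin_dom cd)
  show "t \<in> {s\<in>{0<..<1}. \<gamma> s \<in> chart_dom c}" using t by simp
qed (auto simp: inv_map[OF cd(1)])

text \<open>Finitely many charts cover \<open>M\<close>, and the union of their exceptional sets
  works for every chart: at any other interior time the curve is C1 in one of these charts, hence
  through a transition map in all charts around the point.\<close>

lemma piecewise_C1_curve_iff: "piecewise_C1_curve M A \<gamma> \<longleftrightarrow> (\<exists>F. regular_curve \<gamma> F)"
proof
  assume pw: "piecewise_C1_curve M A \<gamma>"
  then have \<gamma>: "path \<gamma>" "path_image \<gamma> \<subseteq> M" by (auto simp: piecewise_C1_curve_def)
  have "\<forall>c\<in>A. \<exists>F. finite F \<and> (chart_map c \<circ> \<gamma>) C1_differentiable_on ({t\<in>{0..1}. \<gamma> t \<in> chart_dom c} - F)"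
    using pw unfolding piecewise_C1_curve_def piecewise_C1_differentiable_on_def by blast
  from bchoice[OF this] obtain F where F': "\<forall>c\<in>A. finite (F c) \<and>
      (chart_map c \<circ> \<gamma>) C1_differentiable_on ({t\<in>{0..1}. \<gamma> t \<in> chart_dom c} - F c)" by blast
  have F: "finite (F c)" "(chart_map c \<circ> \<gamma>) C1_differentiable_on ({t\<in>{0..1}. \<gamma> t \<in> chart_dom c} - F c)"
    if "c \<in> A" for c
    using F' that by blast+
  obtain C where C: "C \<subseteq> A" "finite C" "M \<subseteq> (\<Union>c\<in>C. chart_dom c)" using finite_chart_cover by blast
  have "C1_near (chart_map d \<circ> \<gamma>) t" if t: "t \<in> {0<..<1} - (\<Union>c\<in>C. F c)" and d: "d \<in> A" "\<gamma> t \<in> chart_dom d" for t d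
  proof -
    have "\<gamma> t \<in> M" using \<gamma> t by (auto simp: path_image_def)
    then obtain c where c: "c \<in> C" "\<gamma> t \<in> chart_dom c" using C by blast
    then have cA: "c \<in> A" using C by blast
    have "open ({s\<in>{0<..<1}. \<gamma> s \<in> chart_dom c} - F c)"
      by (intro open_Diff curve_preimage_open \<gamma> openin_dom cA finite_imp_closed F)
    moreover have "(chart_map c \<circ> \<gamma>) C1_differentiable_on ({s\<in>{0<..<1}. \<gamma> s \<in> chart_dom c} - F c)"
      by (rule C1_differentiable_on_subset[OF F(2)[OF cA]]) auto
    ultimately have near: "C1_near (chart_map c \<circ> \<gamma>) t"
      using t c by (intro C1_on_open_imp_near) auto
    obtain V where V: "open V" "t \<in> V" "\<And>s. s \<in> V \<Longrightarrow> ((chart_map d \<circ> chart_inv c) \<circ> (chart_map c \<circ> \<gamma>)) s = (chart_map d \<circ> \<gamma>) s"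
      using change_chart_near[OF cA d(1) _ _ c(2) d(2) \<gamma>] t by auto
    have "C1_near ((chart_map d \<circ> chart_inv c) \<circ> (chart_map c \<circ> \<gamma>)) t"
      using c d by (intro C1_near_compose[OF near transition_C1[OF cA d(1)] transition_open[OF cA d(1)]]) auto
    then show ?thesis by (rule C1_near_cong[OF _ V])
  qed
  then show "\<exists>F. regular_curve \<gamma> F"
    unfolding regular_curve_def using \<gamma> C F(1) by (intro exI[of _ "\<Union>c\<in>C. F c"]) blast
next
  assume "\<exists>F. regular_curve \<gamma> F"
  then obtain F where "regular_curve \<gamma> F" by blast
  note \<gamma> = regular_curveD(1-3)[OF this] and F = regular_curveD(4)[OF this]
  have "(chart_map d \<circ> \<gamma>) piecewise_C1_differentiable_on {t\<in>{0..1}. \<gamma> t \<in> chart_dom d}" if d: "d \<in> A" for d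
    unfolding piecewise_C1_differentiable_on_def
  proof (intro conjI exI)
    show "continuous_on {t\<in>{0..1}. \<gamma> t \<in> chart_dom d} (chart_map d \<circ> \<gamma>)"
      using \<gamma>(1) unfolding path_def
      by (intro continuous_on_compose continuous_on_subset[OF cont_map[OF d]]) (auto elim: continuous_on_subset)
    show "finite (insert 0 (insert 1 F))" using \<gamma> by simp
    show "(chart_map d \<circ> \<gamma>) C1_differentiable_on ({t\<in>{0..1}. \<gamma> t \<in> chart_dom d} - insert 0 (insert 1 F))"
      using F d by (intro C1_near_imp_C1_on) auto
  qed
  then show "piecewise_C1_curve M A \<gamma>" using \<gamma> by (simp add: piecewise_C1_curve_def)
qed

definition chart_speed :: "('m, 'n) chart \<Rightarrow> (real \<Rightarrow> 'm) \<Rightarrow> real \<Rightarrow> real" where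
  "chart_speed c \<gamma> t = (let v = vector_derivative (chart_map c \<circ> \<gamma>) (at t)
     in sqrt (v \<bullet> (g c (chart_map c (\<gamma> t)) *v v)))"

lemma speed_eq_SUP: "speed A g \<gamma> t = (SUP c\<in>{c\<in>A. \<gamma> t \<in> chart_dom c}. ennreal (chart_speed c \<gamma> t))"
  by (simp add: speed_def chart_speed_def Let_def)

lemma chart_speed_le_speed: "c \<in> A \<Longrightarrow> \<gamma> t \<in> chart_dom c \<Longrightarrow> ennreal (chart_speed c \<gamma> t) \<le> speed A g \<gamma> t"
  unfolding speed_eq_SUP by (intro SUP_upper) simp

text \<open>The chain rule multiplies the velocity by the Jacobian matrix, and the metric transforms
  by the congruence with the same matrix.\<close>

lemma chart_speed_indep:
  assumes \<gamma>: "regular_curve \<gamma> F" and t: "t \<in> {0<..<1} - F"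
    and cd: "c \<in> A" "d \<in> A" "\<gamma> t \<in> chart_dom c" "\<gamma> t \<in> chart_dom d"
  shows "chart_speed d \<gamma> t = chart_speed c \<gamma> t"
proof -
  let ?T = "chart_map d \<circ> chart_inv c"
  define y where "y = chart_map c (\<gamma> t)"
  define J where "J = frechet_derivative ?T (at y)"
  define v where "v = vector_derivative (chart_map c \<circ> \<gamma>) (at t)"
  have near: "C1_near (chart_map c \<circ> \<gamma>) t" by (rule regular_curveD(4)[OF \<gamma> t cd(1,3)])
  have y: "y \<in> chart_map c ` (chart_dom c \<inter> chart_dom d)" using cd by (auto simp: y_def)
  obtain V where V: "open V" "t \<in> V" "\<And>s. s \<in> V \<Longrightarrow> (?T \<circ> (chart_map c \<circ> \<gamma>)) s = (chart_map d \<circ> \<gamma>) s"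
    using change_chart_near[where t = t, OF cd(1,2) _ _ cd(3,4) regular_curveD(1,2)[OF \<gamma>]] t by auto
  have J: "(?T has_derivative J) (at y)" unfolding J_def by (rule transition_deriv[OF cd(1,2) y])
  have "((?T \<circ> (chart_map c \<circ> \<gamma>)) has_vector_derivative J v) (at t)"
  proof -
    have "(?T has_derivative J) (at ((chart_map c \<circ> \<gamma>) t) within range (chart_map c \<circ> \<gamma>))"
      using J by (simp only: y_def comp_apply[of "chart_map c" \<gamma> t]) (rule has_derivative_at_withinI)
    from vector_derivative_diff_chain_within[OF C1_nearD(1)[OF near] this] show ?thesis by (simp only: v_def)
  qed
  then have "((chart_map d \<circ> \<gamma>) has_vector_derivative J v) (at t)"
    by (rule has_vector_derivative_transform_within_open[OF _ V])
  then have vd: "vector_derivative (chart_map d \<circ> \<gamma>) (at t) = J v" by (rule vector_derivative_at)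
  have Jv: "matrix J *v w = J w" for w
    using fun_cong[OF matrix_vector_mul(2)[OF has_derivative_linear[OF J]], of w] .
  have Ty: "chart_map d (chart_inv c y) = chart_map d (\<gamma> t)" using cd by (simp add: y_def inv_map)
  have "v \<bullet> (g c y *v v) = v \<bullet> (transpose (matrix J) *v (g d (?T y) *v (matrix J *v v)))"
    unfolding transition_metric[OF cd(1,2) y] J_def[symmetric] by (simp only: matrix_vector_mul_assoc matrix_mul_assoc)
  also have "\<dots> = (matrix J *v v) \<bullet> (g d (?T y) *v (matrix J *v v))"
    by (metis transpose_matrix_vector inner_commute dot_lmul_matrix)
  finally show ?thesis
    by (simp add: chart_speed_def Let_def vd Jv Ty y_def[symmetric] v_def[symmetric])
qed

lemma speed_eq_chart_speed:
  assumes "regular_curve \<gamma> F" "t \<in> {0<..<1} - F" "c \<in> A" "\<gamma> t \<in> chart_dom c"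
  shows "speed A g \<gamma> t = ennreal (chart_speed c \<gamma> t)"
proof (rule antisym)
  show "speed A g \<gamma> t \<le> ennreal (chart_speed c \<gamma> t)"
    unfolding speed_eq_SUP using chart_speed_indep[OF assms(1,2) assms(3) _ assms(4)]
    by (intro SUP_least) auto
  show "ennreal (chart_speed c \<gamma> t) \<le> speed A g \<gamma> t" using assms(3,4) by (rule chart_speed_le_speed)
qed

lemma chart_speed_cont:
  assumes c: "c \<in> A" "\<gamma> t \<in> chart_dom c" and near: "C1_near (chart_map c \<circ> \<gamma>) t"
  shows "isCont (chart_speed c \<gamma>) t"
proof -
  have y: "(chart_map c \<circ> \<gamma>) t \<in> chart_ran c" using c by auto
  have ent: "isCont (\<lambda>s. g c ((chart_map c \<circ> \<gamma>) s) $ i $ j) t" for i j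
  proof -
    have "continuous_on (chart_ran c) (\<lambda>y. g c y $ i $ j)"
      by (intro C1_fun_continuous[OF C1_fun_entry[OF smooth_on_C1[OF smooth_g]]] c)
    then have "isCont (\<lambda>y. g c y $ i $ j) ((chart_map c \<circ> \<gamma>) t)"
      using y continuous_on_eq_continuous_at[OF open_ran[OF c(1)]] by blast
    then show ?thesis by (rule isCont_o2[OF C1_nearD(3)[OF near]])
  qed
  have v: "isCont (\<lambda>s. vector_derivative (chart_map c \<circ> \<gamma>) (at s) $ i) t" for i
    by (intro isCont_o2[OF C1_nearD(2)[OF near]] continuous_intros)
  have "isCont (\<lambda>s. sqrt (\<Sum>i\<in>UNIV. vector_derivative (chart_map c \<circ> \<gamma>) (at s) $ i *
      (\<Sum>j\<in>UNIV. g c ((chart_map c \<circ> \<gamma>) s) $ i $ j * vector_derivative (chart_map c \<circ> \<gamma>) (at s) $ j))) t"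
    by (intro continuous_real_sqrt continuous_sum continuous_mult ent v)
  then show ?thesis
    by (simp add: chart_speed_def[abs_def] Let_def inner_vec_def matrix_vector_mult_def)
qed

text \<open>Off the exceptional set the speed coincides locally with the continuous speed in one
  chart. Measurability is what lets the integral for a joined curve be split.\<close>

lemma speed_measurable:
  assumes \<gamma>: "regular_curve \<gamma> F"
  shows "(\<lambda>t. speed A g \<gamma> t * indicator ({0<..<1} - F) t) \<in> borel_measurable borel"
proof -
  note p = regular_curveD(1-3)[OF \<gamma>] and F = regular_curveD(4)[OF \<gamma>]
  have "isCont (speed A g \<gamma>) t" if t: "t \<in> {0<..<1} - F" for t
  proof -
    have "\<gamma> t \<in> M" using p t by (auto simp: path_image_def)
    then obtain c where c: "c \<in> A" "\<gamma> t \<in> chart_dom c" using chart_cover by blast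
    define V where "V = {s\<in>{0<..<1}. \<gamma> s \<in> chart_dom c} - F"
    have V: "open V"
      unfolding V_def by (intro open_Diff curve_preimage_open p openin_dom c finite_imp_closed)
    have tV: "t \<in> V" unfolding V_def using t c by simp
    have "isCont (\<lambda>s. ennreal (chart_speed c \<gamma> s)) t"
      using chart_speed_cont[OF c F[OF t c]] by (simp add: isCont_def)
    moreover have "\<forall>\<^sub>F s in nhds t. speed A g \<gamma> s = ennreal (chart_speed c \<gamma> s)"
      using eventually_nhds_in_open[OF V tV]
      by eventually_elim (auto simp: V_def intro!: speed_eq_chart_speed[OF \<gamma> _ c(1)])
    ultimately show ?thesis by (simp add: isCont_cong)
  qed
  then have "continuous_on ({0<..<1} - F) (speed A g \<gamma>)" by (simp add: continuous_at_imp_continuous_on)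
  then have "speed A g \<gamma> \<in> borel_measurable (restrict_space borel ({0<..<1} - F))"
    by (rule borel_measurable_continuous_on_restrict)
  moreover have "{0<..<1} - F \<in> sets borel"
    by (intro borel_open open_Diff finite_imp_closed p(3)) simp
  ultimately show ?thesis by (simp add: borel_measurable_restrict_space_iff_ennreal)
qed

lemma curve_length_off_finite:
  assumes "finite F"
  shows "curve_length A g \<gamma> = (\<integral>\<^sup>+t. speed A g \<gamma> t * indicator ({0<..<1} - F) t \<partial>lborel)"
  unfolding curve_length_def
proof (rule nn_integral_cong_AE)
  have "finite (insert 0 (insert 1 F))" using assms by simp
  then have "insert 0 (insert 1 F) \<in> null_sets lborel" by (rule finite_imp_null_set_lborel)
  then have "AE t in lborel. t \<notin> insert 0 (insert 1 F)" by (rule AE_not_in)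
  then show "AE t in lborel. speed A g \<gamma> t * indicator {0..1} t = speed A g \<gamma> t * indicator ({0<..<1} - F) t"
    by eventually_elim (auto simp: indicator_def)
qed

text \<open>The displacement is the integral of the velocity, whose norm times \<kappa> is dominated
  by the speed. Finite length makes the velocity integrable, so that its integral may be estimated
  by that of the norm.\<close>

lemma chart_displacement:
  assumes \<gamma>: "regular_curve \<gamma> F" and c: "c \<in> A" and s: "0 \<le> s" "s \<le> 1" and \<kappa>: "0 < \<kappa>"
    and dom: "\<And>t. t \<in> {0..s} \<Longrightarrow> \<gamma> t \<in> chart_dom c"
    and ell: "\<And>t v. t \<in> {0..s} \<Longrightarrow> \<kappa>\<^sup>2 * (v \<bullet> v) \<le> v \<bullet> (g c (chart_map c (\<gamma> t)) *v v)"
    and fin: "curve_length A g \<gamma> < \<infinity>"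
  shows "ennreal (\<kappa> * dist (chart_map c (\<gamma> 0)) (chart_map c (\<gamma> s))) \<le> curve_length A g \<gamma>"
proof -
  define f where "f = chart_map c \<circ> \<gamma>"
  define I where "I = {0<..<s} - F"
  define h where "h t = indicator I t *\<^sub>R vector_derivative f (at t)" for t
  note p = regular_curveD(1-3)[OF \<gamma>]
  have near: "C1_near f t" if "t \<in> I" for t
    unfolding f_def using that s dom by (intro regular_curveD(4)[OF \<gamma> _ c]) (auto simp: I_def)
  have "open I" unfolding I_def by (intro open_Diff finite_imp_closed p) simp
  moreover have "continuous_on I (\<lambda>t. vector_derivative f (at t))"
    by (intro continuous_at_imp_continuous_on ballI C1_nearD(2) near)
  ultimately have hm: "h \<in> borel_measurable lborel"
    unfolding h_def by (simp add: borel_measurable_continuous_on_indicator)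
  have "ennreal (\<kappa> * norm (h t)) \<le> speed A g \<gamma> t * indicator {0..1} t" for t
  proof (cases "t \<in> I")
    case True
    then have t: "t \<in> {0..s}" "t \<in> {0..1}" using s by (auto simp: I_def)
    let ?v = "vector_derivative f (at t)"
    have "\<kappa> * norm ?v = sqrt (\<kappa>\<^sup>2 * (?v \<bullet> ?v))"
      using \<kappa> by (simp add: real_sqrt_mult norm_eq_sqrt_inner)
    also have "\<dots> \<le> chart_speed c \<gamma> t"
      using ell[OF t(1), of ?v] by (simp add: chart_speed_def Let_def f_def)
    finally have "ennreal (\<kappa> * norm (h t)) \<le> ennreal (chart_speed c \<gamma> t)"
      using True by (intro ennreal_leI) (simp add: h_def)
    also have "\<dots> \<le> speed A g \<gamma> t" using c dom[OF t(1)] by (rule chart_speed_le_speed)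
    finally show ?thesis using t by simp
  qed (simp add: h_def)
  then have "(\<integral>\<^sup>+t. ennreal (\<kappa> * norm (h t)) \<partial>lborel) \<le> curve_length A g \<gamma>"
    unfolding curve_length_def by (intro nn_integral_mono)
  moreover have "(\<integral>\<^sup>+t. ennreal (\<kappa> * norm (h t)) \<partial>lborel) = ennreal \<kappa> * (\<integral>\<^sup>+t. ennreal (norm (h t)) \<partial>lborel)"
    using \<kappa> hm by (simp add: ennreal_mult nn_integral_cmult)
  ultimately have le: "ennreal \<kappa> * (\<integral>\<^sup>+t. ennreal (norm (h t)) \<partial>lborel) \<le> curve_length A g \<gamma>" by simp
  then have "ennreal \<kappa> * (\<integral>\<^sup>+t. ennreal (norm (h t)) \<partial>lborel) < \<infinity>" using fin by simp
  then have "(\<integral>\<^sup>+t. ennreal (norm (h t)) \<partial>lborel) < \<infinity>"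
    using \<kappa> by (auto simp: ennreal_mult_less_top)
  then have hi: "integrable lborel h" using hm by (intro integrableI_bounded)
  \<comment> \<open>The derivative is known outside a finite set of times; continuity of
    \<open>f\<close> is enough for the fundamental theorem at these.\<close>
  have "(h has_integral (f s - f 0)) {0..s}"
  proof (rule fundamental_theorem_of_calculus_strong[of "insert 0 (insert s F)"])
    show "continuous_on {0..s} f"
      unfolding f_def using p(1) s dom unfolding path_def
      by (intro continuous_on_compose continuous_on_subset[OF cont_map[OF c]]) (auto elim: continuous_on_subset)
    show "(f has_vector_derivative h t) (at t)" if "t \<in> {0..s} - insert 0 (insert s F)" for t
      using C1_nearD(1)[OF near[of t]] that by (auto simp: I_def h_def)
  qed (use p s in auto)
  then have "(h has_integral (f s - f 0)) UNIV"
    by (rule has_integral_on_superset) (auto simp: h_def I_def)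
  then have "f s - f 0 = (\<integral>t. h t \<partial>lborel)"
    using has_integral_integral_lborel[OF hi] by (rule has_integral_unique)
  then have "norm (f s - f 0) \<le> (\<integral>t. norm (h t) \<partial>lborel)" by simp
  then have "ennreal (norm (f s - f 0)) \<le> (\<integral>\<^sup>+t. ennreal (norm (h t)) \<partial>lborel)"
    using hi by (subst nn_integral_eq_integral) (auto intro: ennreal_leI)
  then have "ennreal \<kappa> * ennreal (norm (f s - f 0)) \<le> curve_length A g \<gamma>"
    using le by (meson mult_left_mono order_trans zero_le)
  then show ?thesis
    using \<kappa> by (simp add: ennreal_mult f_def dist_norm norm_minus_commute)
qed

text \<open>Up to its exit time from the coordinate ball, the length of the curve controls the coordinate
  displacement, so that it stays in a smaller closed ball and cannot exit.\<close>

lemma short_curve_stays: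
  assumes pw: "piecewise_C1_curve M A \<gamma>" and c: "c \<in> A" and K: "cball z r \<subseteq> chart_ran c" "0 < r" and \<kappa>: "0 < \<kappa>"
    and ell: "\<And>y v. y \<in> cball z r \<Longrightarrow> \<kappa>\<^sup>2 * (v \<bullet> v) \<le> v \<bullet> (g c y *v v)"
    and start: "\<gamma> 0 = chart_inv c z" and len: "curve_length A g \<gamma> < ennreal (\<kappa> * r)"
  shows "\<gamma> 1 \<in> chart_dom c" "dist z (chart_map c (\<gamma> 1)) < r"
proof -
  obtain F where \<gamma>: "regular_curve \<gamma> F" using pw piecewise_C1_curve_iff by metis
  note p = regular_curveD(1-3)[OF \<gamma>]
  have z: "z \<in> chart_ran c" using K by auto
  obtain l where l: "curve_length A g \<gamma> = ennreal l" "0 \<le> l"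
    using len by (cases "curve_length A g \<gamma>") auto
  have l\<kappa>: "l < \<kappa> * r" using len l by (simp add: ennreal_less_iff)
  \<comment> \<open>The length is strictly below \<open>\<kappa> * r\<close>, so a closed ball of
    radius \<open>r' < r\<close> confines the coordinates, and its image \<open>H\<close>, being
    compact, is closed.\<close>
  define r' where "r' = l / \<kappa>"
  have r': "r' < r" using l\<kappa> \<kappa> by (simp add: r'_def field_simps)
  define G where "G = chart_inv c ` ball z r"
  define H where "H = chart_inv c ` cball z r'"
  have b: "ball z r \<subseteq> chart_ran c" "cball z r' \<subseteq> ball z r" "cball z r' \<subseteq> chart_ran c"
    using K r' by (auto simp: subset_iff)
  have HG: "H \<subseteq> G" unfolding G_def H_def using b by blast
  have opG: "openin (top_of_set M) G" unfolding G_def by (intro openin_chart_image c b) simp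
  have "compact H" unfolding H_def
    by (intro compact_continuous_image continuous_on_subset[OF cont_inv[OF c] b(3)]) simp
  then have clH: "closed H" by (rule compact_imp_closed)
  have Gd: "x \<in> chart_dom c" "chart_map c x \<in> ball z r" if "x \<in> G" for x
    using that b inv_dom[OF c] map_inv[OF c] unfolding G_def by (auto simp: subset_iff)
  have cont: "continuous_on {0..1} \<gamma>" using p(1) by (simp add: path_def)
  have in_H: "\<gamma> s \<in> H" if s: "0 \<le> s" "s \<le> 1" and G: "\<And>t. t \<in> {0..s} \<Longrightarrow> \<gamma> t \<in> G" for s
  proof -
    have "ennreal (\<kappa> * dist (chart_map c (\<gamma> 0)) (chart_map c (\<gamma> s))) \<le> curve_length A g \<gamma>"
    proof (rule chart_displacement[OF \<gamma> c s \<kappa>])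
      show "\<gamma> t \<in> chart_dom c" if "t \<in> {0..s}" for t using Gd(1)[OF G[OF that]] .
      show "\<kappa>\<^sup>2 * (v \<bullet> v) \<le> v \<bullet> (g c (chart_map c (\<gamma> t)) *v v)" if "t \<in> {0..s}" for t v
        using Gd(2)[OF G[OF that]] by (intro ell) simp
      show "curve_length A g \<gamma> < \<infinity>" using l by simp
    qed
    then have "\<kappa> * dist z (chart_map c (\<gamma> s)) \<le> l"
      using l by (simp add: start map_inv[OF c z])
    then have "chart_map c (\<gamma> s) \<in> cball z r'" using \<kappa> by (simp add: r'_def field_simps)
    moreover have "\<gamma> s = chart_inv c (chart_map c (\<gamma> s))"
      using Gd(1)[OF G[of s]] s inv_map[OF c] by simp
    ultimately show ?thesis unfolding H_def by blast
  qed
  have "\<gamma> t \<in> G" if "t \<in> {0..1}" for t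
  proof (rule ccontr)
    assume "\<gamma> t \<notin> G"
    obtain V where V: "open V" "G = M \<inter> V" using opG by (auto simp: openin_open)
    define E where "E = {0..1} \<inter> \<gamma> -` (- V)"
    have "\<gamma> s \<in> M" if "s \<in> {0..1}" for s using p(2) that by (auto simp: path_image_def)
    then have E: "E = {t\<in>{0..1}. \<gamma> t \<notin> G}" unfolding E_def V(2) by blast
    have "closed E" unfolding E_def using V cont by (intro continuous_closed_preimage) auto
    then have "compact ({0..1} \<inter> E)" by (intro compact_Int_closed) simp_all
    moreover have "{0..1} \<inter> E = E" by (auto simp: E_def)
    ultimately have cE: "compact E" by simp
    have "E \<noteq> {}" using \<open>\<gamma> t \<notin> G\<close> that by (auto simp: E)
    from compact_attains_inf[OF cE this] obtain t0 where t0: "t0 \<in> E" "\<And>t. t \<in> E \<Longrightarrow> t0 \<le> t"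
      by metis
    have t01: "t0 \<in> {0..1}" "\<gamma> t0 \<notin> G" using t0(1) by (auto simp: E)
    have "\<gamma> 0 \<in> G" using start K by (auto simp: G_def)
    then have t0pos: "0 < t0" using t01 by (cases "t0 = 0") auto
    have before: "\<gamma> s \<in> G" if "0 \<le> s" "s < t0" for s
      using t0(2)[of s] that t01 by (auto simp: E)
    have "closed ({0..1} \<inter> \<gamma> -` H)" by (intro continuous_closed_preimage cont clH) simp
    moreover have "{0..<t0} \<subseteq> {0..1} \<inter> \<gamma> -` H"
      using t01 before by (auto intro!: in_H)
    ultimately have "closure {0..<t0} \<subseteq> {0..1} \<inter> \<gamma> -` H" by (rule closure_minimal[rotated])
    then have "\<gamma> t0 \<in> H" using t0pos by (simp add: subset_iff)
    then show False using HG t01 by blast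
  qed
  then have "\<gamma> 1 \<in> G" by simp
  then show "\<gamma> 1 \<in> chart_dom c" "dist z (chart_map c (\<gamma> 1)) < r" using Gd[of "\<gamma> 1"] by simp_all
qed

lemma speed_affine:
  assumes \<gamma>: "regular_curve \<gamma> F" "t \<in> {0<..<1} - F" and \<sigma>: "regular_curve \<sigma> F'" "a * t + b \<in> {0<..<1} - F'"
    and a: "0 < a" and V: "open V" "t \<in> V" "\<And>s. s \<in> V \<Longrightarrow> \<sigma> (a * s + b) = \<gamma> s"
  shows "speed A g \<gamma> t = ennreal a * speed A g \<sigma> (a * t + b)"
proof -
  have "\<gamma> t \<in> M" using regular_curveD(2)[OF \<gamma>(1)] \<gamma>(2) by (auto simp: path_image_def)
  then obtain c where c: "c \<in> A" "\<gamma> t \<in> chart_dom c" using chart_cover by metis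
  have c': "\<sigma> (a * t + b) \<in> chart_dom c" using V c by simp
  let ?v = "vector_derivative (chart_map c \<circ> \<sigma>) (at (a * t + b))"
  have "C1_near (chart_map c \<circ> \<sigma>) (a * t + b)" by (rule regular_curveD(4)[OF \<sigma> c(1) c'])
  note d = C1_nearD(1)[OF this]
  have "((\<lambda>s. a * s + b) has_vector_derivative a) (at t)"
    by (auto intro!: derivative_eq_intros)
  from vector_diff_chain_at[OF this d]
  have "((chart_map c \<circ> \<sigma> \<circ> (\<lambda>s. a * s + b)) has_vector_derivative a *\<^sub>R ?v) (at t)" .
  then have "((chart_map c \<circ> \<gamma>) has_vector_derivative a *\<^sub>R ?v) (at t)"
    by (rule has_vector_derivative_transform_within_open[OF _ V(1,2)]) (simp add: V(3))
  then have "vector_derivative (chart_map c \<circ> \<gamma>) (at t) = a *\<^sub>R ?v" by (rule vector_derivative_at)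
  then have "chart_speed c \<gamma> t = a * chart_speed c \<sigma> (a * t + b)"
    using a V(3)[OF V(2)]
    by (simp add: chart_speed_def Let_def matrix_vector_mult_scaleR real_sqrt_mult real_sqrt_mult_self mult.assoc[symmetric])
  then show ?thesis
    using a by (simp add: speed_eq_chart_speed[OF \<gamma> c] speed_eq_chart_speed[OF \<sigma> c(1) c'] ennreal_mult')
qed

text \<open>The exceptional set consists of both rescaled ones and the corner \<open>1 / 2\<close>.
  On each half the speed doubles, which the substitution compensates; an upper bound for the length
  is all that the openness of tubes requires.\<close>

lemma regular_curve_join:
  assumes 1: "regular_curve \<gamma>1 F1" and 2: "regular_curve \<gamma>2 F2" and j: "pathfinish \<gamma>1 = pathstart \<gamma>2"
  defines "F \<equiv> insert (1 / 2) ((\<lambda>s. s / 2) ` F1 \<union> (\<lambda>s. (s + 1) / 2) ` F2)"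
  shows "regular_curve (\<gamma>1 +++ \<gamma>2) F"
    "curve_length A g (\<gamma>1 +++ \<gamma>2) \<le> curve_length A g \<gamma>1 + curve_length A g \<gamma>2"
proof -
  note p1 = regular_curveD(1-3)[OF 1] and p2 = regular_curveD(1-3)[OF 2]
  let ?\<gamma> = "\<gamma>1 +++ \<gamma>2"
  have L: "\<gamma>1 (2 * s + 0) = ?\<gamma> s" if "s \<in> {..<1/2}" for s using that by (simp add: joinpaths_def)
  have R: "\<gamma>2 (2 * s + (-1)) = ?\<gamma> s" if "s \<in> {1/2<..}" for s using that by (simp add: joinpaths_def)
  have F1: "2 * t + 0 \<in> {0<..<1} - F1" if "t \<in> {0<..<1} - F" "t < 1 / 2" for t
    using that by (auto simp: F_def image_iff mult.commute)
  have F2: "2 * t + (-1) \<in> {0<..<1} - F2" if "t \<in> {0<..<1} - F" "t > 1 / 2" for t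
    using that by (auto simp: F_def image_iff field_simps)
  have half: "t < 1 / 2 \<or> t > 1 / 2" if "t \<in> {0<..<1} - F" for t
    using that by (auto simp: F_def)
  show reg: "regular_curve ?\<gamma> F"
    unfolding regular_curve_def
  proof (intro conjI ballI impI)
    show "path ?\<gamma>" using p1 p2 j by simp
    show "path_image ?\<gamma> \<subseteq> M" using p1 p2 path_image_join_subset[of \<gamma>1 \<gamma>2] by blast
    show "finite F" using p1 p2 by (simp add: F_def)
    fix t d assume t: "t \<in> {0<..<1} - F" and d: "d \<in> A" "?\<gamma> t \<in> chart_dom d"
    from half[OF t] show "C1_near (chart_map d \<circ> ?\<gamma>) t"
    proof
      assume h: "t < 1 / 2"
      have "C1_near (chart_map d \<circ> \<gamma>1) (2 * t + 0)"
        by (rule regular_curveD(4)[OF 1 F1[OF t h] d(1)]) (use d L[of t] h in simp)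
      from C1_near_affine[OF this] show ?thesis
        by (rule C1_near_cong[of _ _ "{..<1/2}"]) (use h L in \<open>auto simp del: add_0_right\<close>)
    next
      assume h: "t > 1 / 2"
      have "C1_near (chart_map d \<circ> \<gamma>2) (2 * t + (-1))"
        by (rule regular_curveD(4)[OF 2 F2[OF t h] d(1)]) (use d R[of t] h in simp)
      from C1_near_affine[OF this] show ?thesis
        by (rule C1_near_cong[of _ _ "{1/2<..}"]) (use h R in auto)
    qed
  qed
  define s1 where "s1 t = speed A g \<gamma>1 t * indicator ({0<..<1} - F1) t" for t
  define s2 where "s2 t = speed A g \<gamma>2 t * indicator ({0<..<1} - F2) t" for t
  have m[measurable]: "s1 \<in> borel_measurable borel" "s2 \<in> borel_measurable borel"
    unfolding s1_def s2_def by (rule speed_measurable[OF 1], rule speed_measurable[OF 2])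
  \<comment> \<open>\<open>s1\<close> and \<open>s2\<close> vanish outside the unit interval, so the
    case distinction between the halves can be replaced by a sum.\<close>
  have "speed A g ?\<gamma> t * indicator ({0<..<1} - F) t \<le> 2 * s1 (0 + 2 * t) + 2 * s2 (-1 + 2 * t)" for t
  proof (cases "t \<in> {0<..<1} - F")
    case True
    from half[OF True] show ?thesis
    proof
      assume h: "t < 1 / 2"
      have "speed A g ?\<gamma> t = ennreal 2 * speed A g \<gamma>1 (2 * t + 0)"
        by (rule speed_affine[OF reg True 1 F1[OF True h], where V = "{..<1/2}"]) (use h L in auto)
      then show ?thesis using True F1[OF True h] by (simp add: s1_def)
    next
      assume h: "t > 1 / 2"
      have "speed A g ?\<gamma> t = ennreal 2 * speed A g \<gamma>2 (2 * t + (-1))"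
        by (rule speed_affine[OF reg True 2 F2[OF True h], where V = "{1/2<..}"]) (use h R in auto)
      then show ?thesis using True F2[OF True h] by (simp add: s2_def)
    qed
  qed simp
  then have "curve_length A g ?\<gamma> \<le> (\<integral>\<^sup>+t. 2 * s1 (0 + 2 * t) + 2 * s2 (-1 + 2 * t) \<partial>lborel)"
    unfolding curve_length_off_finite[OF regular_curveD(3)[OF reg]] by (intro nn_integral_mono)
  also have "\<dots> = 2 * (\<integral>\<^sup>+t. s1 (0 + 2 * t) \<partial>lborel) + 2 * (\<integral>\<^sup>+t. s2 (-1 + 2 * t) \<partial>lborel)"
    by (simp add: nn_integral_add nn_integral_cmult)
  also have "\<dots> = (\<integral>\<^sup>+t. s1 t \<partial>lborel) + (\<integral>\<^sup>+t. s2 t \<partial>lborel)"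
    using nn_integral_real_affine[OF m(1), of 2 0] nn_integral_real_affine[OF m(2), of 2 "-1"] by simp
  also have "\<dots> = curve_length A g \<gamma>1 + curve_length A g \<gamma>2"
    unfolding s1_def s2_def
    by (simp only: curve_length_off_finite[OF p1(3), of \<gamma>1] curve_length_off_finite[OF p2(3), of \<gamma>2])
  finally show "curve_length A g ?\<gamma> \<le> curve_length A g \<gamma>1 + curve_length A g \<gamma>2" .
qed

lemma segment_curve:
  assumes c: "c \<in> A" and S: "convex S" "S \<subseteq> chart_ran c" "z \<in> S" "w \<in> S" and \<kappa>: "0 \<le> \<kappa>"
    and up: "\<And>y v. y \<in> S \<Longrightarrow> v \<bullet> (g c y *v v) \<le> \<kappa>\<^sup>2 * (v \<bullet> v)"
  defines "\<sigma> \<equiv> \<lambda>t. chart_inv c (z + t *\<^sub>R (w - z))"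
  shows "regular_curve \<sigma> {}" "curve_length A g \<sigma> \<le> ennreal (\<kappa> * norm (w - z))"
proof -
  define line where "line t = z + t *\<^sub>R (w - z)" for t
  have line: "line t \<in> S" if "t \<in> {0..1}" for t
  proof -
    have "line t = (1 - t) *\<^sub>R z + t *\<^sub>R w" by (simp add: line_def algebra_simps)
    then show ?thesis using convexD_alt[OF S(1,3,4), of t] that by simp
  qed
  have \<sigma>: "\<sigma> = (\<lambda>t. chart_inv c (line t))" by (simp add: \<sigma>_def line_def)
  have d: "(line has_vector_derivative (w - z)) (at t)" for t
    unfolding line_def[abs_def] by (auto intro!: derivative_eq_intros)
  have cl: "continuous_on {0..1} line" unfolding line_def by (intro continuous_intros)
  have near: "C1_near line t" for t
    unfolding C1_near_def by (intro exI[of _ UNIV] exI[of _ "\<lambda>t. w - z"]) (simp add: d)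
  show reg: "regular_curve \<sigma> {}"
    unfolding regular_curve_def
  proof (intro conjI ballI impI)
    show "path \<sigma>" unfolding path_def \<sigma>
      by (rule continuous_on_compose2[OF cont_inv[OF c] cl]) (use line S in blast)
    show "path_image \<sigma> \<subseteq> M"
      unfolding path_image_def \<sigma> using line S inv_dom[OF c] dom_subset[OF c] by blast
    fix t e assume t: "t \<in> {0<..<1} - {}" and e: "e \<in> A" "\<sigma> t \<in> chart_dom e"
    have tr: "line t \<in> chart_ran c" using line[of t] t S by auto
    have "line t \<in> chart_map c ` (chart_dom c \<inter> chart_dom e)"
      by (rule image_eqI[of _ _ "\<sigma> t"]) (use e inv_dom[OF c tr] map_inv[OF c tr] in \<open>simp_all add: \<sigma>\<close>)
    then have "C1_near ((chart_map e \<circ> chart_inv c) \<circ> line) t"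
      by (intro C1_near_compose[OF near transition_C1[OF c e(1)] transition_open[OF c e(1)]])
    then show "C1_near (chart_map e \<circ> \<sigma>) t" by (simp add: \<sigma> o_def)
  qed simp
  have "speed A g \<sigma> t * indicator ({0<..<1} - {}) t \<le> ennreal (\<kappa> * norm (w - z)) * indicator {0<..<1} t" for t
  proof (cases "t \<in> {0<..<1}")
    case True
    have tr: "line t \<in> chart_ran c" using line[of t] True S by auto
    have st: "\<sigma> t \<in> chart_dom c" using inv_dom[OF c tr] by (simp add: \<sigma>)
    have "((chart_map c \<circ> \<sigma>) has_vector_derivative (w - z)) (at t)"
      by (rule has_vector_derivative_transform_within_open[OF d, of "{0<..<1}"])
        (use True line S map_inv[OF c] in \<open>auto simp: \<sigma> subset_iff\<close>)
    then have "vector_derivative (chart_map c \<circ> \<sigma>) (at t) = w - z" by (rule vector_derivative_at)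
    then have "chart_speed c \<sigma> t = sqrt ((w - z) \<bullet> (g c (line t) *v (w - z)))"
      using map_inv[OF c tr] by (simp add: chart_speed_def Let_def \<sigma>)
    also have "\<dots> \<le> sqrt (\<kappa>\<^sup>2 * ((w - z) \<bullet> (w - z)))"
      using up[OF line[of t]] True by (intro real_sqrt_le_mono) auto
    also have "\<dots> = \<kappa> * norm (w - z)" using \<kappa> by (simp add: real_sqrt_mult norm_eq_sqrt_inner)
    finally show ?thesis
      using True speed_eq_chart_speed[OF reg _ c st] by (auto intro: ennreal_leI)
  qed simp
  then have "curve_length A g \<sigma> \<le> (\<integral>\<^sup>+t. ennreal (\<kappa> * norm (w - z)) * indicator {0<..<1::real} t \<partial>lborel)"
    unfolding curve_length_off_finite[OF finite.emptyI] by (intro nn_integral_mono)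
  also have "(\<integral>\<^sup>+t. ennreal (\<kappa> * norm (w - z)) * indicator {0<..<1::real} t \<partial>lborel) = ennreal (\<kappa> * norm (w - z)) * emeasure lborel {0<..<1::real}"
    by (subst nn_integral_cmult_indicator) auto
  also have "\<dots> = ennreal (\<kappa> * norm (w - z))" by simp
  finally show "curve_length A g \<sigma> \<le> ennreal (\<kappa> * norm (w - z))" .
qed

section \<open>Coordinate balls and openness of tubes\<close>

text \<open>The radius is \<open>4 * \<rho>\<close> because balls of radius
  \<open>3 * \<rho>\<close> around points of \<open>ball z \<rho>\<close> have to fit inside; the
  images of the small balls will form the covers.\<close>

lemma chart_ball_at:
  assumes "x \<in> M"
  shows "\<exists>c z \<rho>. c \<in> A \<and> 0 < \<rho> \<and> cball z (4 * \<rho>) \<subseteq> chart_ran c \<and> x = chart_inv c z"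
proof -
  obtain c where c: "c \<in> A" "x \<in> chart_dom c" using chart_cover[OF assms] by metis
  then have "chart_map c x \<in> chart_ran c" by blast
  then obtain e where e: "0 < e" "cball (chart_map c x) e \<subseteq> chart_ran c"
    using open_ran[OF c(1)] by (meson open_contains_cball)
  show ?thesis
    by (intro exI[of _ c] exI[of _ "chart_map c x"] exI[of _ "e / 4"]) (use c e inv_map in simp)
qed

lemma chart_ball_image:
  assumes c: "c \<in> A" "0 < \<rho>" "cball z (4 * \<rho>) \<subseteq> chart_ran c"
  shows "ball z \<rho> \<subseteq> chart_ran c" "ball z \<rho> \<subseteq> cball z (4 * \<rho>)"
    "openin (top_of_set M) (chart_inv c ` ball z \<rho>)" "chart_inv c z \<in> chart_inv c ` ball z \<rho>"
    "chart_inv c ` ball z \<rho> \<subseteq> chart_dom c"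
    "y \<in> chart_ran c \<Longrightarrow> chart_inv c y \<in> chart_inv c ` ball z \<rho> \<Longrightarrow> y \<in> ball z \<rho>"
proof -
  show b: "ball z \<rho> \<subseteq> chart_ran c" "ball z \<rho> \<subseteq> cball z (4 * \<rho>)"
    using c(2,3) by (auto simp: subset_iff)
  show "openin (top_of_set M) (chart_inv c ` ball z \<rho>)" by (intro openin_chart_image c b) simp
  show "chart_inv c z \<in> chart_inv c ` ball z \<rho>" using c(2) by simp
  show "chart_inv c ` ball z \<rho> \<subseteq> chart_dom c" using inv_dom[OF c(1)] b(1) by blast
  assume y: "y \<in> chart_ran c" and "chart_inv c y \<in> chart_inv c ` ball z \<rho>"
  then obtain w where w: "w \<in> ball z \<rho>" "chart_inv c y = chart_inv c w" by auto
  then have "w \<in> chart_ran c" using b(1) by blast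
  then have "y = w" using map_inv[OF c(1)] y w(2) by metis
  then show "y \<in> ball z \<rho>" using w(1) by simp
qed

lemma g_entry_continuous: "c \<in> A \<Longrightarrow> continuous_on (chart_ran c) (\<lambda>y. g c y $ i $ j)"
  by (intro C1_fun_continuous[OF C1_fun_entry[OF smooth_on_C1[OF smooth_g]]])

lemma g_lower:
  assumes "c \<in> A" "cball z r \<subseteq> chart_ran c" "0 \<le> r"
  shows "\<exists>\<kappa>>0. \<forall>y\<in>cball z r. \<forall>v. \<kappa>\<^sup>2 * (v \<bullet> v) \<le> v \<bullet> (g c y *v v)"
proof -
  have "\<exists>m>0. \<forall>y\<in>cball z r. \<forall>v. m * (v \<bullet> v) \<le> v \<bullet> (g c y *v v)"
  proof (rule posdef_uniform)
    show "continuous_on (cball z r) (\<lambda>y. g c y $ i $ j)" for i j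
      by (rule continuous_on_subset[OF g_entry_continuous[OF assms(1)] assms(2)])
    show "posdef (g c y)" if "y \<in> cball z r" for y using posdef_g[OF assms(1)] assms(2) that by blast
  qed (use assms in auto)
  then obtain m where "m > 0" "\<forall>y\<in>cball z r. \<forall>v. m * (v \<bullet> v) \<le> v \<bullet> (g c y *v v)" by blast
  then show ?thesis by (intro exI[of _ "sqrt m"]) simp
qed

lemma g_upper:
  assumes "c \<in> A" "cball z r \<subseteq> chart_ran c"
  shows "\<exists>\<kappa>\<ge>0. \<forall>y\<in>cball z r. \<forall>v. v \<bullet> (g c y *v v) \<le> \<kappa>\<^sup>2 * (v \<bullet> v)"
proof -
  have "continuous_on (cball z r) (\<lambda>y. \<Sum>i\<in>UNIV. \<Sum>j\<in>UNIV. \<bar>g c y $ i $ j\<bar>)"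
    by (intro continuous_on_sum continuous_on_rabs continuous_on_subset[OF g_entry_continuous[OF assms(1)] assms(2)])
  from continuous_on_bounded_real[OF compact_cball this]
  obtain B where B: "0 \<le> B" "\<And>y. y \<in> cball z r \<Longrightarrow> \<bar>\<Sum>i\<in>UNIV. \<Sum>j\<in>UNIV. \<bar>g c y $ i $ j\<bar>\<bar> \<le> B" by blast
  have "v \<bullet> (g c y *v v) \<le> (sqrt B)\<^sup>2 * (v \<bullet> v)" if "y \<in> cball z r" for y v
  proof -
    have "v \<bullet> (g c y *v v) \<le> (\<Sum>i\<in>UNIV. \<Sum>j\<in>UNIV. \<bar>g c y $ i $ j\<bar>) * (v \<bullet> v)"
      using quadratic_bound[of v "g c y"] by linarith
    also have "\<dots> \<le> B * (v \<bullet> v)" using B(2)[OF that] by (intro mult_right_mono) auto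
    finally show ?thesis using B by simp
  qed
  then show ?thesis using B by (intro exI[of _ "sqrt B"]) simp
qed

text \<open>Makes tubes measurable. A point near \<open>x\<close> is joined to \<open>x\<close> by a
  coordinate segment shorter than the margin that a curve from \<open>x\<close> to \<open>Z\<close>
  leaves below \<delta>.\<close>

lemma tubular_nbhd_open:
  "openin (top_of_set M) (tubular_nbhd M A g Z \<delta>)"
proof (subst openin_subopen, intro ballI)
  fix x assume "x \<in> tubular_nbhd M A g Z \<delta>"
  then have xM: "x \<in> M" and "(INF y\<in>Z. riemannian_dist M A g x y) < ennreal \<delta>"
    by (auto simp: tubular_nbhd_def)
  then obtain y where y: "y \<in> Z" "riemannian_dist M A g x y < ennreal \<delta>" by (auto simp: INF_less_iff)
  then obtain \<gamma> where \<gamma>: "piecewise_C1_curve M A \<gamma>" "pathstart \<gamma> = x" "pathfinish \<gamma> = y" "curve_length A g \<gamma> < ennreal \<delta>"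
    unfolding riemannian_dist_def by (auto simp: INF_less_iff)
  obtain F where F: "regular_curve \<gamma> F" using \<gamma>(1) piecewise_C1_curve_iff by metis
  obtain l where l: "curve_length A g \<gamma> = ennreal l" "0 \<le> l" using \<gamma>(4) by (cases "curve_length A g \<gamma>") auto
  have l\<delta>: "l < \<delta>" using \<gamma>(4) l by (simp add: ennreal_less_iff)
  obtain c z \<rho> where c: "c \<in> A" "0 < \<rho>" "cball z (4 * \<rho>) \<subseteq> chart_ran c" "x = chart_inv c z"
    using chart_ball_at[OF xM] by blast
  obtain \<kappa> where \<kappa>: "0 \<le> \<kappa>" "\<And>y v. y \<in> cball z (4 * \<rho>) \<Longrightarrow> v \<bullet> (g c y *v v) \<le> \<kappa>\<^sup>2 * (v \<bullet> v)"
    using g_upper[OF c(1,3)] by blast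
  define \<epsilon> where "\<epsilon> = min \<rho> ((\<delta> - l) / (\<kappa> + 1))"
  have \<epsilon>: "0 < \<epsilon>" "\<epsilon> \<le> \<rho>" using c l\<delta> \<kappa> by (auto simp: \<epsilon>_def)
  have \<kappa>\<epsilon>: "\<kappa> * \<epsilon> < \<delta> - l"
  proof -
    have "\<kappa> * \<epsilon> < (\<kappa> + 1) * \<epsilon>" using \<epsilon> by simp
    also have "\<dots> \<le> (\<kappa> + 1) * ((\<delta> - l) / (\<kappa> + 1))" using \<kappa> by (intro mult_left_mono) (auto simp: \<epsilon>_def)
    finally show ?thesis using \<kappa> by simp
  qed
  have b: "ball z \<epsilon> \<subseteq> cball z (4 * \<rho>)" using \<epsilon> c(2) by (auto simp: subset_iff)
  have "chart_inv c ` ball z \<epsilon> \<subseteq> tubular_nbhd M A g Z \<delta>"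
  proof (rule image_subsetI)
    fix w assume w: "w \<in> ball z \<epsilon>"
    define \<sigma> where "\<sigma> = (\<lambda>t. chart_inv c (w + t *\<^sub>R (z - w)))"
    have \<sigma>: "regular_curve \<sigma> {}" "curve_length A g \<sigma> \<le> ennreal (\<kappa> * norm (z - w))"
      unfolding \<sigma>_def using w b c(2) \<kappa> by (auto intro!: segment_curve[OF c(1) convex_cball c(3)])
    have ends: "pathstart \<sigma> = chart_inv c w" "pathfinish \<sigma> = x"
      by (simp_all add: \<sigma>_def pathstart_def pathfinish_def c(4))
    have j: "pathfinish \<sigma> = pathstart \<gamma>" using ends \<gamma> by simp
    note join = regular_curve_join[OF \<sigma>(1) F j]
    have "riemannian_dist M A g (chart_inv c w) y \<le> curve_length A g (\<sigma> +++ \<gamma>)"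
      unfolding riemannian_dist_def
      by (rule INF_lower) (use join(1) piecewise_C1_curve_iff ends \<gamma> in auto)
    also have "\<dots> \<le> ennreal (\<kappa> * norm (z - w)) + ennreal l"
      using join(2) \<sigma>(2) l(1) by (metis add_mono order_refl order_trans)
    also have "\<dots> = ennreal (\<kappa> * norm (z - w) + l)" using \<kappa> l by (simp add: ennreal_plus)
    also have "\<dots> < ennreal \<delta>"
    proof (rule ennreal_lessI)
      have "\<kappa> * norm (z - w) \<le> \<kappa> * \<epsilon>" using w \<kappa> by (intro mult_left_mono) (auto simp: dist_norm)
      then show "\<kappa> * norm (z - w) + l < \<delta>" using \<kappa>\<epsilon> by simp
    qed (use l\<delta> l in simp)
    finally have "(INF y\<in>Z. riemannian_dist M A g (chart_inv c w) y) < ennreal \<delta>"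
      using y(1) by (auto simp: INF_less_iff)
    moreover have "chart_inv c w \<in> M" using w b c inv_dom[OF c(1), of w] dom_subset[OF c(1)] by blast
    ultimately show "chart_inv c w \<in> tubular_nbhd M A g Z \<delta>" by (simp add: tubular_nbhd_def)
  qed
  moreover have "openin (top_of_set M) (chart_inv c ` ball z \<epsilon>)"
    using b c by (intro openin_chart_image) auto
  moreover have "x \<in> chart_inv c ` ball z \<epsilon>" using \<epsilon> c(4) by auto
  ultimately show "\<exists>T. openin (top_of_set M) T \<and> x \<in> T \<and> T \<subseteq> tubular_nbhd M A g Z \<delta>" by blast
qed

section \<open>The spectral gap\<close>

lemma chart_equation:
  assumes c: "c \<in> A"
  shows "\<exists>b. continuous_on (chart_ran c) b \<and> (\<forall>lam u. eigenfunction M A g lam u \<longrightarrow>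
    solves_on (chart_ran c) (\<lambda>y. matrix_inv (g c y)) b lam (u \<circ> chart_inv c))"
proof -
  obtain b where b: "continuous_on (chart_ran c) b"
    and exp: "\<And>u D H y. C2_derivs (chart_ran c) u D H \<Longrightarrow> y \<in> chart_ran c \<Longrightarrow>
      (\<forall>x\<in>chart_ran c. frechet_derivative u (at x) = D x) \<Longrightarrow>
      (\<Sum>i\<in>UNIV. partial i (\<lambda>y. sqrt (det (g c y)) * (\<Sum>j\<in>UNIV. matrix_inv (g c y) $ i $ j * partial j u y)) y)
        / sqrt (det (g c y)) = contract (matrix_inv (g c y)) (H y) + D y (b y)"
    using laplace_expansion[OF smooth_g[OF c] posdef_g[OF c]] open_ran[OF c] by blast
  have "solves_on (chart_ran c) (\<lambda>y. matrix_inv (g c y)) b lam (u \<circ> chart_inv c)"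
    if eig: "eigenfunction M A g lam u" for lam u
  proof -
    let ?u = "u \<circ> chart_inv c"
    have "smooth_on (chart_ran c) ?u" using eig c by (simp add: eigenfunction_def smooth_function_def)
    note C2 = smooth_on_C2[OF this]
    have "contract (matrix_inv (g c y)) (\<lambda>v. frechet_derivative (\<lambda>y. frechet_derivative ?u (at y) v) (at y))
        + frechet_derivative ?u (at y) (b y) + lam * ?u y = 0" if y: "y \<in> chart_ran c" for y
    proof -
      have x: "chart_inv c y \<in> chart_dom c" using inv_dom[OF c y] .
      then have "- laplace_beltrami g c u (chart_inv c y) = lam * u (chart_inv c y)"
        using eig c unfolding eigenfunction_def by blast
      then show ?thesis
        using exp[OF C2 y] map_inv[OF c y] by (simp add: laplace_beltrami_def Let_def)
    qed
    then show ?thesis unfolding solves_on_def using C2 by blast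
  qed
  then show ?thesis using b by blast
qed

text \<open>Chosen once for each chart, so that it is the same for all eigenfunctions.\<close>

definition drift :: "('m, 'n) chart \<Rightarrow> real^'n \<Rightarrow> real^'n" where
  "drift c = (SOME b. continuous_on (chart_ran c) b \<and> (\<forall>lam u. eigenfunction M A g lam u \<longrightarrow>
    solves_on (chart_ran c) (\<lambda>y. matrix_inv (g c y)) b lam (u \<circ> chart_inv c)))"

lemma drift:
  assumes "c \<in> A"
  shows "continuous_on (chart_ran c) (drift c)"
    "eigenfunction M A g lam u \<Longrightarrow> solves_on (chart_ran c) (\<lambda>y. matrix_inv (g c y)) (drift c) lam (u \<circ> chart_inv c)"
  using someI_ex[OF chart_equation[OF assms]] unfolding drift_def by blast+

text \<open>What the estimates use of an eigenfunction, with the equation already in nondivergence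
  form. It is closed under all multiples, as normalization requires.\<close>

definition solution :: "real \<Rightarrow> ('m \<Rightarrow> real) \<Rightarrow> bool" where
  "solution lam u \<longleftrightarrow> continuous_on M u \<and>
    (\<forall>c\<in>A. solves_on (chart_ran c) (\<lambda>y. matrix_inv (g c y)) (drift c) lam (u \<circ> chart_inv c))"

lemma continuous_on_M:
  assumes "\<And>c. c \<in> A \<Longrightarrow> continuous_on (chart_ran c) (u \<circ> chart_inv c)"
  shows "continuous_on M u"
  unfolding continuous_on_eq_continuous_within
proof
  fix x assume x: "x \<in> M"
  then obtain c where c: "c \<in> A" "x \<in> chart_dom c" using chart_cover by metis
  have "continuous_on (chart_dom c) ((u \<circ> chart_inv c) \<circ> chart_map c)"
    by (intro continuous_on_compose cont_map[OF c(1)] assms[OF c(1)])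
  moreover have "((u \<circ> chart_inv c) \<circ> chart_map c) y = u y" if "y \<in> chart_dom c" for y
    using inv_map[OF c(1) that] by simp
  ultimately have "continuous_on (chart_dom c) u" by (simp cong: continuous_on_cong)
  then have w: "continuous (at x within chart_dom c) u" using c by (simp add: continuous_on_eq_continuous_within)
  obtain V where V: "open V" "chart_dom c = M \<inter> V" using openin_dom[OF c(1)] by (auto simp: openin_open)
  have "at x within chart_dom c = at x within M"
    by (rule at_within_nhd[of x V]) (use V c in auto)
  then show "continuous (at x within M) u" using w by simp
qed

lemma eigenfunction_solution:
  assumes "eigenfunction M A g lam u"
  shows "solution lam u"
  unfolding solution_def
proof (intro conjI ballI continuous_on_M)
  fix c assume c: "c \<in> A"
  show *: "solves_on (chart_ran c) (\<lambda>y. matrix_inv (g c y)) (drift c) lam (u \<circ> chart_inv c)"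
    by (rule drift(2)[OF c assms])
  then show "continuous_on (chart_ran c) (u \<circ> chart_inv c)"
    unfolding solves_on_def using C2_continuous_on by blast
qed

lemma solution_mult: "solution lam u \<Longrightarrow> solution lam (\<lambda>x. r * u x)"
  unfolding solution_def o_def by (auto intro!: continuous_on_mult_left solves_on_mult)

lemma chart_elliptic:
  assumes "c \<in> A" "cball z r \<subseteq> chart_ran c" "0 \<le> r"
  shows "\<exists>\<mu> L B. elliptic_on (cball z r) (\<lambda>y. matrix_inv (g c y)) (drift c) \<mu> L B"
  by (rule elliptic_on_compact[OF smooth_g posdef_g drift(1)]) (use assms in auto)

lemma chart_gradient_bound:
  assumes c: "c \<in> A" "cball z r \<subseteq> chart_ran c" "0 \<le> r"
  shows "\<exists>R0>0. \<exists>N\<ge>1. \<forall>u lam R. solution lam u \<longrightarrow> 0 \<le> lam \<longrightarrow> R \<le> R0 \<longrightarrow> lam * R\<^sup>2 \<le> 1 \<longrightarrow>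
    gradient_bounded (cball z r) R N (u \<circ> chart_inv c)"
proof -
  obtain \<mu> L B where "elliptic_on (cball z r) (\<lambda>y. matrix_inv (g c y)) (drift c) \<mu> L B"
    using chart_elliptic[OF c] by blast
  from gradient_bounded_solution[OF this open_ran[OF c(1)] c(2)]
  show ?thesis using c(1) unfolding solution_def by blast
qed

section \<open>Propagation of an upper bound below 1\<close>

definition normalized :: "real \<Rightarrow> ('m \<Rightarrow> real) \<Rightarrow> bool" where
  "normalized lam u \<longleftrightarrow> solution lam u \<and> 0 \<le> lam \<and> (\<forall>x\<in>M. \<bar>u x\<bar> \<le> 1)"

text \<open>The gradient bound spreads \<open>u x \<le> 1 - t\<close> to
  \<open>u \<le> 1 - t / 2\<close> on a small ball around the point, and the barrier centred there
  carries it on to distance \<open>2 * \<rho>\<close>, which covers \<open>ball z \<rho>\<close>.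
  The number \<open>t'\<close> is at once the gain and the admissible size of \<open>lam\<close>, so
  that such statements can be chained.\<close>

lemma positivity_spreads_locally:
  assumes c: "c \<in> A" "0 < \<rho>" "cball z (4 * \<rho>) \<subseteq> chart_ran c" and t: "0 < t"
  shows "\<exists>t'>0. \<forall>lam u. normalized lam u \<longrightarrow> lam \<le> t' \<longrightarrow>
    (\<forall>x\<in>chart_inv c ` ball z \<rho>. \<forall>y\<in>chart_inv c ` ball z \<rho>. u x \<le> 1 - t \<longrightarrow> u y \<le> 1 - t')"
proof -
  have r0: "0 \<le> 4 * \<rho>" using c by simp
  obtain \<mu> L B where ell: "elliptic_on (cball z (4 * \<rho>)) (\<lambda>y. matrix_inv (g c y)) (drift c) \<mu> L B"
    using chart_elliptic[OF c(1,3) r0] by blast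
  have pos: "0 < \<mu>" "0 \<le> B" using ell by (auto simp: elliptic_on_def)
  obtain R0 N where RN: "0 < R0" "1 \<le> N" "\<And>u lam R. solution lam u \<Longrightarrow> 0 \<le> lam \<Longrightarrow> R \<le> R0 \<Longrightarrow> lam * R\<^sup>2 \<le> 1 \<Longrightarrow>
      gradient_bounded (cball z (4 * \<rho>)) R N (u \<circ> chart_inv c)"
    using chart_gradient_bound[OF c(1,3) r0] by blast
  define R where "R = min R0 (min 1 \<rho>)"
  have R: "0 < R" "R \<le> R0" "R \<le> 1" "R \<le> \<rho>" using RN c by (auto simp: R_def)
  \<comment> \<open>Within this radius the gradient bound is available and a function bounded by 1
    varies by at most \<open>t / 2\<close>.\<close>
  define \<eta> where "\<eta> = min (R / 4) (t * R / (2 * N))"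
  have \<eta>: "0 < \<eta>" "\<eta> \<le> R / 4" "\<eta> \<le> t * R / (2 * N)" using R RN t by (auto simp: \<eta>_def)
  define \<alpha> where "\<alpha> = (2 * B + 6 * B * \<rho> + 1) / (8 * \<mu> * \<eta>\<^sup>2)"
  have "0 < 2 * B + 6 * B * \<rho> + 1" using pos c by (simp add: add_nonneg_pos)
  then have \<alpha>: "0 < \<alpha>" "2 * B + 6 * B * \<rho> + 1 \<le> 8 * \<alpha> * \<mu> * \<eta>\<^sup>2"
    using pos \<eta> by (simp_all add: \<alpha>_def)
  define e where "e = exp (- \<alpha> * (2 * \<rho>)\<^sup>2) - exp (- \<alpha> * (3 * \<rho>)\<^sup>2)"
  have e: "0 < e" using \<alpha> c by (simp add: e_def power2_eq_square)
  \<comment> \<open>The entries provide \<open>lam \<le> 1\<close> and thus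
    \<open>lam * R\<^sup>2 \<le> 1\<close>, the strict smallness of \<open>lam\<close> required by
    \<open>barrier\<close>, for which the additional halving stands, and the gain that
    \<open>barrier\<close> yields.\<close>
  define t' where "t' = min 1 (min (t / 2 * (\<alpha> * exp (- \<alpha> * (3 * \<rho>)\<^sup>2)) / 2) (t / 2 * e))"
  have t': "0 < t'" "t' \<le> 1" "t' \<le> t / 2 * e" using t \<alpha> e by (auto simp: t'_def)
  have t'2: "t' < t / 2 * (\<alpha> * exp (- \<alpha> * (3 * \<rho>)\<^sup>2))"
  proof -
    have "0 < t / 2 * (\<alpha> * exp (- \<alpha> * (3 * \<rho>)\<^sup>2))" using t \<alpha> by simp
    then show ?thesis unfolding t'_def by linarith
  qed
  have "u y \<le> 1 - t'"
    if n: "normalized lam u" and lam: "lam \<le> t'" and x: "x \<in> chart_inv c ` ball z \<rho>" and y: "y \<in> chart_inv c ` ball z \<rho>"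
      and ux: "u x \<le> 1 - t" for lam u x y
  proof -
    let ?u = "u \<circ> chart_inv c"
    obtain x' y' where x': "x' \<in> ball z \<rho>" "x = chart_inv c x'" and y': "y' \<in> ball z \<rho>" "y = chart_inv c y'"
      using x y by blast
    have sol: "solution lam u" "0 \<le> lam" and u1: "\<And>x. x \<in> M \<Longrightarrow> \<bar>u x\<bar> \<le> 1"
      using n by (auto simp: normalized_def)
    have lR: "lam * R\<^sup>2 \<le> 1"
      using mult_mono[of lam 1 "R\<^sup>2" 1] lam t' R sol by (simp add: power_le_one)
    have gb: "gradient_bounded (cball z (4 * \<rho>)) R N ?u" using RN(3)[OF sol R(2) lR] .
    have u1': "\<bar>?u w\<bar> \<le> 1" if "w \<in> cball z (4 * \<rho>)" for w
    proof -
      have "chart_inv c w \<in> M" using inv_dom[OF c(1)] dom_subset[OF c(1)] that c(3) by blast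
      then show ?thesis using u1 by simp
    qed
    have sub: "cball x' s \<subseteq> cball z (4 * \<rho>)" if "s \<le> 3 * \<rho>" for s
      using x' that by (simp add: cball_subset_cball_iff dist_commute)
    have near: "?u w \<le> 1 - t / 2" if w: "w \<in> cball x' \<eta>" for w
    proof -
      have "\<bar>?u x' - ?u w\<bar> \<le> N * 1 / R * dist x' w"
        by (rule gradient_boundedD[OF gb R(1) order_refl])
          (use sub[of "R / 2"] u1' R c(2) w \<eta> in \<open>auto simp: subset_iff\<close>)
      also have "\<dots> \<le> N * 1 / R * (t * R / (2 * N))"
        using w \<eta> R RN by (intro mult_left_mono) auto
      also have "\<dots> = t / 2" using R RN by simp
      finally have "?u w \<le> ?u x' + t / 2" by linarith
      then show ?thesis using ux x' by simp
    qed
    have "?u y' \<le> 1 - t / 2 * (exp (- \<alpha> * (2 * \<rho>)\<^sup>2) - exp (- \<alpha> * (3 * \<rho>)\<^sup>2))"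
    proof (rule barrier[where U = "chart_ran c" and z = x' and \<rho> = \<rho> and \<eta> = \<eta> and b = "drift c" and lam = lam])
      show "open (chart_ran c)" by (rule open_ran[OF c(1)])
      show "cball x' (3 * \<rho>) \<subseteq> chart_ran c" using sub[of "3 * \<rho>"] c(3) by auto
      show "solves_on (chart_ran c) (\<lambda>y. matrix_inv (g c y)) (drift c) lam ?u"
        using sol c(1) unfolding solution_def by blast
      show "elliptic_on (cball x' (3 * \<rho>)) (\<lambda>y. matrix_inv (g c y)) (drift c) \<mu> L B"
        using ell sub[of "3 * \<rho>"] unfolding elliptic_on_def by blast
      show "?u w \<le> 1" if "w \<in> cball x' (3 * \<rho>)" for w
        using u1'[of w] sub[of "3 * \<rho>"] that by (auto simp: subset_iff)
      show "y' \<in> cball x' (2 * \<rho>)" using x' y' dist_triangle[of x' y' z] by (simp add: dist_commute)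
      show "lam < t / 2 * (\<alpha> * exp (- \<alpha> * (3 * \<rho>)\<^sup>2))" using lam t'2 by simp
    qed (use \<eta> R \<alpha> near t sol in auto)
    then show ?thesis using t'(3) y' by (simp add: e_def)
  qed
  then show ?thesis using t'(1) by blast
qed

text \<open>The relation \<open>Q\<close> says that an upper bound below 1 at \<open>x\<close>
  forces one at \<open>y\<close>, uniformly in \<open>u\<close>. Quantified over all
  \<open>t\<close> it is transitive, and it holds between any two points of a coordinate ball;
  connectedness then replaces an explicit chain.\<close>

lemma positivity_spreads:
  assumes "x \<in> M" "y \<in> M" "0 < t"
  shows "\<exists>t'>0. \<forall>lam u. normalized lam u \<longrightarrow> lam \<le> t' \<longrightarrow> u x \<le> 1 - t \<longrightarrow> u y \<le> 1 - t'"
proof -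
  define Q where "Q x y \<longleftrightarrow> (\<forall>t>0. \<exists>t'>0. \<forall>lam u. normalized lam u \<longrightarrow> lam \<le> t' \<longrightarrow> u x \<le> 1 - t \<longrightarrow> u y \<le> 1 - t')" for x y
  have "Q x y"
  proof (rule connected_equivalence_relation_gen[OF connected_M assms(1,2), where P = "\<lambda>_. True"])
    fix x y z assume xy: "Q x y" and yz: "Q y z"
    show "Q x z" unfolding Q_def
    proof (intro allI impI)
      fix t :: real assume "0 < t"
      then obtain t1 where t1: "t1 > 0" "\<And>lam u. normalized lam u \<Longrightarrow> lam \<le> t1 \<Longrightarrow> u x \<le> 1 - t \<Longrightarrow> u y \<le> 1 - t1"
        using xy unfolding Q_def by metis
      then obtain t2 where t2: "t2 > 0" "\<And>lam u. normalized lam u \<Longrightarrow> lam \<le> t2 \<Longrightarrow> u y \<le> 1 - t1 \<Longrightarrow> u z \<le> 1 - t2"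
        using yz unfolding Q_def by metis
      show "\<exists>t'>0. \<forall>lam u. normalized lam u \<longrightarrow> lam \<le> t' \<longrightarrow> u x \<le> 1 - t \<longrightarrow> u z \<le> 1 - t'"
      proof (intro exI[of _ "min t1 t2"] conjI allI impI)
        fix lam u assume "normalized lam u" "lam \<le> min t1 t2" "u x \<le> 1 - t"
        then have "u z \<le> 1 - t2" using t1(2)[of lam u] t2(2)[of lam u] by simp
        then show "u z \<le> 1 - min t1 t2" by simp
      qed (use t1 t2 in simp)
    qed
  next
    fix a assume "a \<in> M"
    then obtain c z \<rho> where c: "c \<in> A" "0 < \<rho>" "cball z (4 * \<rho>) \<subseteq> chart_ran c" "a = chart_inv c z"
      using chart_ball_at by metis
    note chart_ball_image(3,4)[OF c(1-3), folded c(4)]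
    moreover have "Q x y" if "x \<in> chart_inv c ` ball z \<rho>" "y \<in> chart_inv c ` ball z \<rho>" for x y
      unfolding Q_def using positivity_spreads_locally[OF c(1-3)] that by metis
    ultimately show "\<exists>T. openin (top_of_set M) T \<and> a \<in> T \<and> (\<forall>x\<in>T. \<forall>y\<in>T. True \<and> True \<longrightarrow> Q x y)" by blast
  qed auto
  then show ?thesis using assms(3) unfolding Q_def by blast
qed

text \<open>The extreme points vary with \<open>u\<close>, so propagation between two fixed points
  is not enough: a finite cover leaves finitely many pairs of patches, each with its own threshold,
  and \<open>lam0\<close> is the smallest of these.\<close>

lemma spectral_gap: "\<exists>lam0>0. \<forall>lam u. 0 < lam \<longrightarrow> eigenfunction M A g lam u \<longrightarrow> lam0 \<le> lam"
proof -
  have "\<exists>W. openin (top_of_set M) W \<and> x \<in> W \<and> (\<forall>t>0. \<exists>t'>0. \<forall>lam u. normalized lam u \<longrightarrow> lam \<le> t' \<longrightarrow>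
      (\<forall>p\<in>W. \<forall>q\<in>W. u p \<le> 1 - t \<longrightarrow> u q \<le> 1 - t'))" if x: "x \<in> M" for x
  proof -
    obtain c z \<rho> where c: "c \<in> A" "0 < \<rho>" "cball z (4 * \<rho>) \<subseteq> chart_ran c" "x = chart_inv c z"
      using chart_ball_at[OF x] by metis
    show ?thesis
      using chart_ball_image(3,4)[OF c(1-3)] positivity_spreads_locally[OF c(1-3)] c(4)
      by (intro exI[of _ "chart_inv c ` ball z \<rho>"]) simp
  qed
  then have "\<forall>x\<in>M. \<exists>W. openin (top_of_set M) W \<and> x \<in> W \<and> (\<forall>t>0. \<exists>t'>0. \<forall>lam u. normalized lam u \<longrightarrow> lam \<le> t' \<longrightarrow>
      (\<forall>p\<in>W. \<forall>q\<in>W. u p \<le> 1 - t \<longrightarrow> u q \<le> 1 - t'))" by blast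
  from bchoice[OF this] obtain W where W': "\<forall>x\<in>M. openin (top_of_set M) (W x) \<and> x \<in> W x \<and>
      (\<forall>t>0. \<exists>t'>0. \<forall>lam u. normalized lam u \<longrightarrow> lam \<le> t' \<longrightarrow> (\<forall>p\<in>W x. \<forall>q\<in>W x. u p \<le> 1 - t \<longrightarrow> u q \<le> 1 - t'))"
    by metis
  have W: "openin (top_of_set M) (W x)" "x \<in> W x" if "x \<in> M" for x using W' that by blast+
  have Wt: "\<exists>t'>0. \<forall>lam u. normalized lam u \<longrightarrow> lam \<le> t' \<longrightarrow> (\<forall>p\<in>W x. \<forall>q\<in>W x. u p \<le> 1 - t \<longrightarrow> u q \<le> 1 - t')"
    if "x \<in> M" "0 < t" for x t using W' that by blast
  obtain X where X: "X \<subseteq> M" "finite X" "M \<subseteq> (\<Union>x\<in>X. W x)" using finite_subcover[of W] W by metis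
  \<comment> \<open>The bound travels from \<open>p\<close> to the centre of its patch, on to the
    centre of the other patch, and from there to \<open>q\<close>.\<close>
  have "\<exists>\<tau>>0. \<forall>lam u. normalized lam u \<longrightarrow> lam \<le> \<tau> \<longrightarrow> (\<forall>p\<in>W (fst k). \<forall>q\<in>W (snd k). u p \<le> 0 \<longrightarrow> u q \<le> 1 - \<tau>)"
    if k: "k \<in> X \<times> X" for k
  proof -
    have M: "fst k \<in> M" "snd k \<in> M" using k X by auto
    obtain t1 where t1: "t1 > 0" "\<And>lam u p q. normalized lam u \<Longrightarrow> lam \<le> t1 \<Longrightarrow> p \<in> W (fst k) \<Longrightarrow> q \<in> W (fst k) \<Longrightarrow>
        u p \<le> 1 - 1 \<Longrightarrow> u q \<le> 1 - t1" using Wt[OF M(1), of 1] by (metis zero_less_one)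
    obtain t2 where t2: "t2 > 0" "\<And>lam u. normalized lam u \<Longrightarrow> lam \<le> t2 \<Longrightarrow> u (fst k) \<le> 1 - t1 \<Longrightarrow> u (snd k) \<le> 1 - t2"
      using positivity_spreads[OF M t1(1)] by metis
    obtain t3 where t3: "t3 > 0" "\<And>lam u p q. normalized lam u \<Longrightarrow> lam \<le> t3 \<Longrightarrow> p \<in> W (snd k) \<Longrightarrow> q \<in> W (snd k) \<Longrightarrow>
        u p \<le> 1 - t2 \<Longrightarrow> u q \<le> 1 - t3" using Wt[OF M(2) t2(1)] by metis
    show ?thesis
    proof (intro exI[of _ "min t1 (min t2 t3)"] conjI allI impI ballI)
      fix lam u p q
      assume n: "normalized lam u" "lam \<le> min t1 (min t2 t3)" "p \<in> W (fst k)" "q \<in> W (snd k)" "u p \<le> 0"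
      have "u (fst k) \<le> 1 - t1" using t1(2)[OF n(1) _ n(3) W(2)[OF M(1)]] n by simp
      then have "u (snd k) \<le> 1 - t2" using t2(2)[OF n(1)] n by simp
      then have "u q \<le> 1 - t3" using t3(2)[OF n(1) _ W(2)[OF M(2)] n(4)] n by simp
      then show "u q \<le> 1 - min t1 (min t2 t3)" by simp
    qed (use t1 t2 t3 in simp)
  qed
  then have "\<forall>k\<in>X \<times> X. \<exists>\<tau>>0. \<forall>lam u. normalized lam u \<longrightarrow> lam \<le> \<tau> \<longrightarrow> (\<forall>p\<in>W (fst k). \<forall>q\<in>W (snd k). u p \<le> 0 \<longrightarrow> u q \<le> 1 - \<tau>)"
    by blast
  from bchoice[OF this] obtain \<tau> where \<tau>: "\<forall>k\<in>X \<times> X. 0 < \<tau> k \<and> (\<forall>lam u. normalized lam u \<longrightarrow> lam \<le> \<tau> k \<longrightarrow>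
      (\<forall>p\<in>W (fst k). \<forall>q\<in>W (snd k). u p \<le> 0 \<longrightarrow> u q \<le> 1 - \<tau> k))" by metis
  have Xne: "X \<noteq> {}" using X(3) M_nonempty by blast
  define lam0 where "lam0 = Min (\<tau> ` (X \<times> X))"
  have fin: "finite (\<tau> ` (X \<times> X))" "\<tau> ` (X \<times> X) \<noteq> {}" using X Xne by auto
  have "0 < lam0" unfolding lam0_def using fin \<tau> by (subst Min_gr_iff) auto
  moreover have "lam0 \<le> lam" if lam: "0 < lam" and eig: "eigenfunction M A g lam u" for lam u
  proof (rule ccontr)
    assume "\<not> lam0 \<le> lam"
    then have small: "lam < \<tau> k" if "k \<in> X \<times> X" for k
      using Min_le[OF fin(1), of "\<tau> k"] that by (simp add: lam0_def)
    have sol: "solution lam u" by (rule eigenfunction_solution[OF eig])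
    then have cu: "continuous_on M u" by (simp add: solution_def)
    obtain q where q: "q \<in> M" "\<And>x. x \<in> M \<Longrightarrow> \<bar>u x\<bar> \<le> \<bar>u q\<bar>"
      using continuous_attains_sup[OF compact_M M_nonempty continuous_on_rabs[OF cu]] by blast
    obtain x0 where "x0 \<in> M" "u x0 \<noteq> 0" using eig by (auto simp: eigenfunction_def)
    then have uq: "u q \<noteq> 0" using q(2)[of x0] by auto
    \<comment> \<open>Dividing by the signed value \<open>u q\<close> makes \<open>q\<close> a
      maximum with value 1, whichever sign \<open>u q\<close> has.\<close>
    define v where "v x = (1 / u q) * u x" for x
    have vq: "v q = 1" using uq by (simp add: v_def)
    have solv: "solution lam v" unfolding v_def[abs_def] by (rule solution_mult[OF sol])
    have "\<bar>v x\<bar> \<le> 1" if "x \<in> M" for x using q(2)[OF that] uq by (simp add: v_def)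
    then have nv: "normalized lam v" using solv lam by (simp add: normalized_def)
    have "continuous_on M v" using solv by (simp add: solution_def)
    from continuous_attains_inf[OF compact_M M_nonempty this]
    obtain p where p: "p \<in> M" "\<And>x. x \<in> M \<Longrightarrow> v p \<le> v x" by metis
    \<comment> \<open>The negative of \<open>v\<close> solves the same equation and has a maximum at
      \<open>p\<close>.\<close>
    have "0 \<le> - v p"
    proof -
      obtain c where c: "c \<in> A" "p \<in> chart_dom c" using chart_cover[OF p(1)] by metis
      define y where "y = chart_map c p"
      have y: "y \<in> chart_ran c" using c by (auto simp: y_def)
      have inv: "chart_inv c y = p" using inv_map[OF c] by (simp add: y_def)
      have s: "solves_on (chart_ran c) (\<lambda>y. matrix_inv (g c y)) (drift c) lam (\<lambda>y. -1 * (v \<circ> chart_inv c) y)"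
        using solv c(1) unfolding solution_def by (intro solves_on_mult) blast
      have "0 \<le> -1 * (v \<circ> chart_inv c) y"
      proof (rule local_max_nonneg[OF s open_ran[OF c(1)] y _ lam])
        show "psd (matrix_inv (g c y))"
          by (intro posdef_imp_psd posdef_matrix_inv posdef_g c y)
        show "-1 * (v \<circ> chart_inv c) w \<le> -1 * (v \<circ> chart_inv c) y" if "w \<in> chart_ran c" for w
          using p(2)[of "chart_inv c w"] inv_dom[OF c(1) that] dom_subset[OF c(1)] by (auto simp: inv)
      qed
      then show ?thesis by (simp add: inv)
    qed
    then have vp: "v p \<le> 0" by simp
    obtain i j where ij: "i \<in> X" "p \<in> W i" "j \<in> X" "q \<in> W j" using X(3) p(1) q(1) by blast
    then have k: "(i, j) \<in> X \<times> X" by simp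
    have "v q \<le> 1 - \<tau> (i, j)"
      using \<tau>[rule_format, OF k] nv small[OF k] ij vp by (metis fst_conv snd_conv less_imp_le)
    moreover have "0 < \<tau> (i, j)" using \<tau> k by blast
    ultimately show False using vq by simp
  qed
  ultimately show ?thesis by blast
qed

section \<open>Tubes on the manifold\<close>

lemma density_bounds:
  assumes c: "c \<in> A" "cball z r \<subseteq> chart_ran c" "0 \<le> r"
  shows "\<exists>d0>0. \<exists>d1. \<forall>y\<in>cball z r. d0 \<le> sqrt (det (g c y)) \<and> sqrt (det (g c y)) \<le> d1"
proof -
  have cont: "continuous_on (cball z r) (\<lambda>y. sqrt (det (g c y)))"
    by (rule continuous_on_subset[OF density_continuous[OF c(1)] c(2)])
  have ne: "cball z r \<noteq> {}" using c(3) by simp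
  obtain y0 where y0: "y0 \<in> cball z r" "\<forall>y\<in>cball z r. sqrt (det (g c y0)) \<le> sqrt (det (g c y))"
    using continuous_attains_inf[OF compact_cball ne cont] by blast
  obtain y1 where y1: "y1 \<in> cball z r" "\<forall>y\<in>cball z r. sqrt (det (g c y)) \<le> sqrt (det (g c y1))"
    using continuous_attains_sup[OF compact_cball ne cont] by blast
  have "0 < sqrt (det (g c y0))" using y0 c by (intro density_pos) auto
  then show ?thesis using y0 y1 by blast
qed

text \<open>Makes the integral of the bounded function \<open>\<bar>u\<bar> powr p\<close> finite,
  so that the part over the tube may be subtracted.\<close>

lemma vol_finite: "emeasure vol M < \<infinity>"
proof -
  have "\<exists>W. openin (top_of_set M) W \<and> x \<in> W \<and> emeasure vol W < \<infinity>" if x: "x \<in> M" for x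
  proof -
    obtain c z \<rho> where c: "c \<in> A" "0 < \<rho>" "cball z (4 * \<rho>) \<subseteq> chart_ran c" "x = chart_inv c z"
      using chart_ball_at[OF x] by metis
    obtain d0 d1 where d: "\<forall>y\<in>cball z (4 * \<rho>). d0 \<le> sqrt (det (g c y)) \<and> sqrt (det (g c y)) \<le> d1"
      using density_bounds[OF c(1,3)] c(2) by force
    define W where "W = chart_inv c ` ball z \<rho>"
    note br = chart_ball_image(1,2)[OF c(1-3)] and oW = chart_ball_image(3)[OF c(1-3), folded W_def]
      and Wd = chart_ball_image(5)[OF c(1-3), folded W_def] and pre = chart_ball_image(6)[OF c(1-3), folded W_def]
    have "emeasure vol W \<le> emeasure (chart_volume M g c) W"
      by (rule vol_le_chart_volume[OF c(1) openin_sets_MB[OF oW] Wd])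
    also have "\<dots> = (\<integral>\<^sup>+y. ennreal (indicator {y\<in>chart_ran c. chart_inv c y \<in> W} y * sqrt (det (g c y))) \<partial>lborel)"
      by (rule emeasure_chart_volume[OF c(1) openin_sets_MB[OF oW]])
    also have "\<dots> \<le> (\<integral>\<^sup>+y. ennreal d1 * indicator (ball z \<rho>) y \<partial>lborel)"
    proof (rule nn_integral_mono)
      fix y
      show "ennreal (indicator {y\<in>chart_ran c. chart_inv c y \<in> W} y * sqrt (det (g c y))) \<le> ennreal d1 * indicator (ball z \<rho>) y"
      proof (cases "y \<in> chart_ran c \<and> chart_inv c y \<in> W")
        case True
        then have "y \<in> ball z \<rho>" using pre by blast
        then show ?thesis using d br(2) True by (auto simp: subset_iff intro!: ennreal_leI)
      qed simp
    qed
    also have "\<dots> = ennreal d1 * emeasure lborel (ball z \<rho>)"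
      by (subst nn_integral_cmult_indicator) auto
    also have "\<dots> < \<infinity>" using c(2) by (simp add: emeasure_ball ennreal_mult_less_top)
    finally show ?thesis using oW c by (intro exI[of _ W]) (auto simp: W_def)
  qed
  then have "\<forall>x\<in>M. \<exists>W. openin (top_of_set M) W \<and> x \<in> W \<and> emeasure vol W < \<infinity>" by blast
  from bchoice[OF this] obtain W where W: "\<forall>x\<in>M. openin (top_of_set M) (W x) \<and> x \<in> W x \<and> emeasure vol (W x) < \<infinity>"
    by metis
  obtain X where X: "X \<subseteq> M" "finite X" "M \<subseteq> (\<Union>x\<in>X. W x)" using finite_subcover[of W] W by metis
  have s: "W x \<in> sets vol" if "x \<in> X" for x using W X that openin_sets_MB[of "W x"] by auto
  have "emeasure vol M \<le> emeasure vol (\<Union>x\<in>X. W x)" using X s by (intro emeasure_mono) auto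
  also have "\<dots> \<le> (\<Sum>x\<in>X. emeasure vol (W x))"
    using X s by (intro emeasure_subadditive_finite) auto
  also have "\<dots> < \<infinity>" using X W by (simp add: subset_iff)
  finally show ?thesis .
qed

text \<open>For infinite exponents: an essential supremum notices a value of a continuous function
  because nearby values fill an open set of positive volume.\<close>

lemma vol_open_pos:
  assumes "openin (top_of_set M) V" "x \<in> V"
  shows "0 < emeasure vol V"
proof (rule ccontr)
  assume "\<not> ?thesis"
  then have 0: "emeasure vol V = 0" by simp
  have "x \<in> M" using assms openin_imp_subset by blast
  then obtain c where c: "c \<in> A" "x \<in> chart_dom c" using chart_cover by metis
  have V: "V \<in> sets MB" by (rule openin_sets_MB[OF assms(1)])
  define S where "S = {y\<in>chart_ran c. chart_inv c y \<in> V}"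
  obtain U where U: "open U" "V = M \<inter> U" using assms(1) by (auto simp: openin_open)
  have "S = chart_ran c \<inter> chart_inv c -` U"
    using inv_dom[OF c(1)] dom_subset[OF c(1)] U by (auto simp: S_def)
  then have "open S" using continuous_open_preimage[OF cont_inv[OF c(1)] open_ran[OF c(1)] U(1)] by simp
  moreover have xS: "chart_map c x \<in> S" using c assms inv_map[OF c] by (auto simp: S_def)
  ultimately obtain e where e: "0 < e" "ball (chart_map c x) e \<subseteq> S" by (meson open_contains_ball)
  have Sb: "S \<in> sets borel" using \<open>open S\<close> by simp
  have "emeasure (chart_volume M g c) V = 0"
    using le_measureD3[OF chart_volume_le_vol[OF c(1)], of V] 0 by simp
  then have "(\<integral>\<^sup>+y. ennreal (indicator S y * sqrt (det (g c y))) \<partial>lborel) = 0"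
    by (simp add: emeasure_chart_volume[OF c(1) V] S_def)
  moreover have "(\<lambda>y. indicator S y * sqrt (det (g c y))) \<in> borel_measurable borel"
    using borel_measurable_continuous_on_indicator[OF Sb continuous_on_subset[OF density_continuous[OF c(1)], of S]]
    by (auto simp: S_def)
  ultimately have "AE y in lborel. ennreal (indicator S y * sqrt (det (g c y))) = 0"
    by (subst (asm) nn_integral_0_iff_AE) auto
  then have "AE y in lborel. y \<notin> S"
  proof eventually_elim
    case (elim y)
    show ?case
    proof
      assume "y \<in> S"
      then have "0 < sqrt (det (g c y))" using density_pos[OF c(1)] by (auto simp: S_def)
      then show False using elim \<open>y \<in> S\<close> by (simp add: ennreal_eq_0_iff)
    qed
  qed
  then have "S \<in> null_sets lborel" using Sb AE_iff_null_sets[of S lborel] by simp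
  then have "emeasure lborel S = 0" by auto
  then have "emeasure lborel (ball (chart_map c x) e) = 0"
    using emeasure_mono[OF e(2), of lborel] Sb by simp
  then show False using e(1) unit_ball_vol_pos[of "real CARD('n)"] by (simp add: emeasure_ball)
qed

lemma solution_measurable: "solution lam u \<Longrightarrow> u \<in> borel_measurable MB"
  unfolding solution_def MB_def by (intro borel_measurable_continuous_on_restrict) blast

abbreviation tube :: "('m \<Rightarrow> real) \<Rightarrow> real \<Rightarrow> 'm set" where
  "tube u \<delta> \<equiv> tubular_nbhd M A g (nodal_set M u) \<delta>"

text \<open>A curve to the nodal set shorter than \<open>\<kappa> * r\<close> cannot leave the
  coordinate ball, so the zero at its end is visible in the same chart.\<close>

lemma tube_near_zero:
  assumes c: "c \<in> A" "cball y r \<subseteq> chart_ran c" "0 < r" and \<kappa>: "0 < \<kappa>"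
    "\<And>w v. w \<in> cball y r \<Longrightarrow> \<kappa>\<^sup>2 * (v \<bullet> v) \<le> v \<bullet> (g c w *v v)"
    and y: "chart_inv c y \<in> tube u (\<kappa> * r)"
  shows "\<exists>w. dist y w \<le> r \<and> (u \<circ> chart_inv c) w = 0"
proof -
  have "(INF q\<in>nodal_set M u. riemannian_dist M A g (chart_inv c y) q) < ennreal (\<kappa> * r)"
    using y by (simp add: tubular_nbhd_def)
  then obtain q where q: "q \<in> nodal_set M u" "riemannian_dist M A g (chart_inv c y) q < ennreal (\<kappa> * r)"
    by (auto simp: INF_less_iff)
  then obtain \<gamma> where \<gamma>: "piecewise_C1_curve M A \<gamma>" "pathstart \<gamma> = chart_inv c y" "pathfinish \<gamma> = q"
      "curve_length A g \<gamma> < ennreal (\<kappa> * r)"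
    unfolding riemannian_dist_def by (auto simp: INF_less_iff)
  have start: "\<gamma> 0 = chart_inv c y" and fin: "\<gamma> 1 = q" using \<gamma> by (simp_all add: pathstart_def pathfinish_def)
  note stays = short_curve_stays[OF \<gamma>(1) c \<kappa> start \<gamma>(4)]
  have "(u \<circ> chart_inv c) (chart_map c q) = 0"
    using q(1) inv_map[OF c(1)] stays(1) by (simp add: fin nodal_set_def)
  then show ?thesis using stays(2) by (intro exI[of _ "chart_map c q"]) (simp add: fin)
qed

text \<open>The bounds are in terms of \<open>r\<close>, the width of the tube on the scale
  \<open>lam powr (- 1 / 2)\<close>, which frees them from \<open>lam\<close>. The integral and the
  pointwise bound sit in one predicate so that a single finite cover serves finite and infinite
  exponents.\<close>

definition tube_control :: "real \<Rightarrow> real \<Rightarrow> 'm set \<Rightarrow> real \<Rightarrow> real \<Rightarrow> bool" where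
  "tube_control lam0 p W r0 C \<longleftrightarrow> 0 < r0 \<and> 0 \<le> C \<and> (\<forall>lam u r \<delta>. solution lam u \<longrightarrow> lam0 \<le> lam \<longrightarrow>
    0 < r \<longrightarrow> r \<le> r0 \<longrightarrow> 0 < \<delta> \<longrightarrow> \<delta> \<le> r * lam powr (- 1 / 2) \<longrightarrow>
    power_integral vol p u (tube u \<delta> \<inter> W)
      \<le> ennreal (C * r powr p) * (\<integral>\<^sup>+x. ennreal (\<bar>u x\<bar> powr p) \<partial>vol) \<and>
    (\<forall>S. (\<forall>x\<in>M. \<bar>u x\<bar> \<le> S) \<longrightarrow> (\<forall>x\<in>tube u \<delta> \<inter> W. \<bar>u x\<bar> \<le> C * r * S)))"

lemma local_tube:
  assumes x: "x \<in> M" and lam0: "0 < lam0" and p: "1 \<le> p"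
  shows "\<exists>W r0 C. openin (top_of_set M) W \<and> x \<in> W \<and> tube_control lam0 p W r0 C"
proof -
  obtain c z \<rho> where c: "c \<in> A" "0 < \<rho>" "cball z (4 * \<rho>) \<subseteq> chart_ran c" "x = chart_inv c z"
    using chart_ball_at[OF x] by blast
  have \<rho>4: "0 \<le> 4 * \<rho>" using c by simp
  obtain \<kappa> where \<kappa>: "0 < \<kappa>" "\<And>y v. y \<in> cball z (4 * \<rho>) \<Longrightarrow> \<kappa>\<^sup>2 * (v \<bullet> v) \<le> v \<bullet> (g c y *v v)"
    using g_lower[OF c(1,3) \<rho>4] by blast
  obtain R0 N where RN: "0 < R0" "1 \<le> N" "\<And>u lam R. solution lam u \<Longrightarrow> 0 \<le> lam \<Longrightarrow> R \<le> R0 \<Longrightarrow> lam * R\<^sup>2 \<le> 1 \<Longrightarrow>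
      gradient_bounded (cball z (4 * \<rho>)) R N (u \<circ> chart_inv c)"
    using chart_gradient_bound[OF c(1,3) \<rho>4] by blast
  obtain d0 d1 where d: "0 < d0" "\<And>y. y \<in> cball z (4 * \<rho>) \<Longrightarrow> d0 \<le> sqrt (det (g c y))"
      "\<And>y. y \<in> cball z (4 * \<rho>) \<Longrightarrow> sqrt (det (g c y)) \<le> d1"
    using density_bounds[OF c(1,3) \<rho>4] by blast
  have d1: "0 \<le> d1" using d(2)[of z] d(3)[of z] d(1) c(2) by simp
  \<comment> \<open>The radius will be \<open>R = s / sqrt lam\<close>. It satisfies
    \<open>lam * R\<^sup>2 \<le> 1\<close> and, for every \<open>lam \<ge> lam0\<close>, fits into
    the chart: here the lower bound for the eigenvalues enters.\<close>
  define s where "s = min 1 (min R0 \<rho> * sqrt lam0)"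
  have s: "0 < s" "s \<le> 1" "s \<le> min R0 \<rho> * sqrt lam0" using RN c lam0 by (auto simp: s_def)
  \<comment> \<open>With \<open>r \<le> r0\<close> the coordinate width of the tube is at most
    \<open>R / 4\<close>, the range of the gradient bound.\<close>
  define r0 where "r0 = \<kappa> * s / 4"
  \<comment> \<open>The ratio \<open>d1 / d0\<close> pays for passing from the volume to Lebesgue
    measure and back, and \<open>r / (\<kappa> * s)\<close> will bound the coordinate width over
    \<open>R\<close>.\<close>
  define C1 where "C1 = d1 / d0 * (tube_const TYPE('n) N p * (N / (\<kappa> * s)) powr p)"
  define C where "C = max C1 (N / (\<kappa> * s))"
  define W where "W = chart_inv c ` ball z \<rho>"
  note br = chart_ball_image(1,2)[OF c(1-3)] and oW = chart_ball_image(3)[OF c(1-3), folded W_def]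
    and Wd = chart_ball_image(5)[OF c(1-3), folded W_def] and pre = chart_ball_image(6)[OF c(1-3), folded W_def]
  have xW: "x \<in> W" using chart_ball_image(4)[OF c(1-3)] c(4) by (simp add: W_def)
  have "0 \<le> N / (\<kappa> * s)" using RN(2) \<kappa>(1) s(1) by simp
  then have C: "0 \<le> C" unfolding C_def by (rule max.coboundedI2)
  have r0: "0 < r0" using \<kappa> s by (simp add: r0_def)
  have "power_integral vol p u (tube u \<delta> \<inter> W)
      \<le> ennreal (C * r powr p) * (\<integral>\<^sup>+x. ennreal (\<bar>u x\<bar> powr p) \<partial>vol)" (is ?int)
    and "\<forall>S. (\<forall>x\<in>M. \<bar>u x\<bar> \<le> S) \<longrightarrow> (\<forall>x\<in>tube u \<delta> \<inter> W. \<bar>u x\<bar> \<le> C * r * S)" (is ?sup)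
    if sol: "solution lam u" and lam: "lam0 \<le> lam" and r: "0 < r" "r \<le> r0" and \<delta>: "0 < \<delta>" "\<delta> \<le> r * lam powr (- 1 / 2)"
    for lam u r \<delta>
  proof -
    have lampos: "0 < lam" using lam lam0 by simp
    have pw: "lam powr (- 1 / 2) = 1 / sqrt lam"
      using lampos by (simp add: powr_minus_divide powr_half_sqrt)
    define R where "R = s / sqrt lam"
    have R: "0 < R" using s lampos by (simp add: R_def)
    have "s / sqrt lam \<le> min R0 \<rho> * sqrt lam0 / sqrt lam"
      using s lampos by (intro divide_right_mono) auto
    also have "\<dots> \<le> min R0 \<rho>"
    proof -
      have "sqrt lam0 / sqrt lam \<le> 1" using lam lampos by simp
      then show ?thesis using mult_left_mono[of "sqrt lam0 / sqrt lam" 1 "min R0 \<rho>"] RN c by simp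
    qed
    finally have R2: "R \<le> R0" "R \<le> \<rho>" by (simp_all add: R_def)
    have lR: "lam * R\<^sup>2 \<le> 1"
      using lampos s by (simp add: R_def power_divide power_le_one)
    have gb: "gradient_bounded (cball z (4 * \<rho>)) R N (u \<circ> chart_inv c)"
      using RN(3)[OF sol _ R2(1) lR] lampos by simp
    \<comment> \<open>The lower bound \<kappa> of the metric turns the Riemannian width into a
      coordinate width.\<close>
    define \<delta>' where "\<delta>' = \<delta> / \<kappa>"
    have \<delta>': "0 < \<delta>'" "\<kappa> * \<delta>' = \<delta>" using \<delta> \<kappa> by (auto simp: \<delta>'_def)
    have "\<delta> \<le> r / sqrt lam" using \<delta>(2) unfolding pw by simp
    then have "\<delta> / \<kappa> \<le> r / sqrt lam / \<kappa>" using \<kappa>(1) by (intro divide_right_mono) auto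
    also have "\<dots> = r / (\<kappa> * s) * R" using s(1) by (simp add: R_def)
    finally have \<delta>r: "\<delta>' \<le> r / (\<kappa> * s) * R" by (simp add: \<delta>'_def)
    then have \<delta>R: "\<delta>' / R \<le> r / (\<kappa> * s)" using R by (simp add: field_simps)
    have "r / (\<kappa> * s) \<le> 1 / 4" using r \<kappa> s by (simp add: r0_def field_simps)
    from mult_right_mono[OF this, of R] have \<delta>4: "\<delta>' \<le> R / 4" using \<delta>r R by linarith
    have N\<delta>: "N * \<delta>' / R \<le> N / (\<kappa> * s) * r"
      using mult_left_mono[OF \<delta>R, of N] RN by (simp add: field_simps)
    have near: "\<exists>w. dist y w \<le> \<delta>' \<and> (u \<circ> chart_inv c) w = 0" if y: "y \<in> ball z \<rho>" "chart_inv c y \<in> tube u \<delta>" for y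
    proof -
      have sub: "cball y \<delta>' \<subseteq> cball z (4 * \<rho>)"
        using y \<delta>4 R R2 by (simp add: cball_subset_cball_iff dist_commute)
      show ?thesis
        by (rule tube_near_zero[OF c(1) _ \<delta>'(1) \<kappa>(1)]) (use sub c(3) \<kappa>(2) y(2) \<delta>'(2) in auto)
    qed
    have T: "tube u \<delta> \<inter> W \<in> sets MB" by (intro sets.Int openin_sets_MB tubular_nbhd_open oW)
    show ?sup
    proof (intro allI impI ballI)
      fix S q assume S: "\<forall>x\<in>M. \<bar>u x\<bar> \<le> S" and q: "q \<in> tube u \<delta> \<inter> W"
      then obtain y where y: "y \<in> ball z \<rho>" "q = chart_inv c y" by (auto simp: W_def)
      then obtain w where w: "dist y w \<le> \<delta>'" "(u \<circ> chart_inv c) w = 0" using near[of y] q by auto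
      have S0: "0 \<le> S" using S x by force
      have sub: "cball y (R / 2) \<subseteq> cball z (4 * \<rho>)"
        using y R R2 by (simp add: cball_subset_cball_iff dist_commute)
      have "\<bar>(u \<circ> chart_inv c) y - (u \<circ> chart_inv c) w\<bar> \<le> N * S / R * dist y w"
      proof (rule gradient_boundedD[OF gb R order_refl sub])
        show "\<bar>(u \<circ> chart_inv c) v\<bar> \<le> S" if "v \<in> cball y (R / 2)" for v
        proof -
          have "chart_inv c v \<in> M" using that sub c(3) inv_dom[OF c(1)] dom_subset[OF c(1)] by blast
          then show ?thesis using S by simp
        qed
        show "w \<in> cball y (R / 4)" using w \<delta>4 by simp
      qed
      then have "\<bar>u q\<bar> \<le> N * S / R * dist y w" using w y by simp
      also have "\<dots> \<le> N * S / R * \<delta>'" using w RN S0 R by (intro mult_left_mono) auto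
      also have "\<dots> = (N * \<delta>' / R) * S" by simp
      also have "\<dots> \<le> (N / (\<kappa> * s) * r) * S" using N\<delta> S0 by (intro mult_right_mono) auto
      also have "\<dots> \<le> (C * r) * S" using r S0 by (intro mult_right_mono) (auto simp: C_def)
      finally show "\<bar>u q\<bar> \<le> C * r * S" .
    qed
    let ?f = "\<lambda>x. ennreal (\<bar>u x\<bar> powr p)"
    let ?g = "\<lambda>y. ennreal (\<bar>(u \<circ> chart_inv c) y\<bar> powr p)"
    note um [measurable] = solution_measurable[OF sol]
    define T' where "T' = {y\<in>chart_ran c. chart_inv c y \<in> tube u \<delta> \<inter> W}"
    have T'b: "T' \<in> sets borel" unfolding T'_def by (rule chart_preimage_borel[OF c(1) T])
    have T'z: "T' \<subseteq> ball z \<rho>" using pre by (auto simp: T'_def)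
    have T'2: "T' \<subseteq> cball z (2 * \<rho>)"
    proof
      fix y assume "y \<in> T'"
      then have "y \<in> ball z \<rho>" using T'z by blast
      then show "y \<in> cball z (2 * \<rho>)" using c(2) by simp
    qed
    have cu: "continuous_on (cball z (2 * \<rho>)) (u \<circ> chart_inv c)"
    proof -
      have "cball z (2 * \<rho>) \<subseteq> chart_ran c" using c(2,3) by (auto simp: subset_iff)
      moreover have "continuous_on (chart_ran c) (u \<circ> chart_inv c)"
        using sol c(1) C2_continuous_on unfolding solution_def solves_on_def by blast
      ultimately show ?thesis by (meson continuous_on_subset)
    qed
    have s2: "cball z (2 * \<rho>) \<subseteq> cball z (4 * \<rho>)" using c(2) by auto
    \<comment> \<open>On the way into the chart the volume is bounded by the chart volume, which
      holds inside the chart domain only; on the way back the chart volume is bounded by the volume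
      on all of \<open>M\<close>.\<close>
    have "(\<integral>\<^sup>+x. ?f x * indicator (tube u \<delta> \<inter> W) x \<partial>vol) \<le> (\<integral>\<^sup>+x. ?f x * indicator (tube u \<delta> \<inter> W) x \<partial>chart_volume M g c)"
      by (rule nn_integral_vol_le_chart_volume[OF c(1) T]) (use Wd in auto)
    also have "\<dots> = (\<integral>\<^sup>+y. ennreal (sqrt (det (g c y))) * (?f (chart_inv c y) * indicator (tube u \<delta> \<inter> W) (chart_inv c y)) * indicator (chart_ran c) y \<partial>lborel)"
      by (intro nn_integral_chart_volume c borel_measurable_times_ennreal borel_measurable_indicator T) measurable
    also have "\<dots> \<le> (\<integral>\<^sup>+y. ennreal d1 * (?g y * indicator T' y) \<partial>lborel)"
    proof (rule nn_integral_mono)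
      fix y
      show "ennreal (sqrt (det (g c y))) * (?f (chart_inv c y) * indicator (tube u \<delta> \<inter> W) (chart_inv c y)) * indicator (chart_ran c) y
          \<le> ennreal d1 * (?g y * indicator T' y)"
      proof (cases "y \<in> T'")
        case True
        then have "y \<in> cball z (4 * \<rho>)" using T'z br by blast
        from d(3)[OF this] show ?thesis using True by (auto simp: T'_def intro!: mult_right_mono ennreal_leI)
      qed (auto simp: T'_def indicator_def)
    qed
    also have "\<dots> = ennreal d1 * (\<integral>\<^sup>+y. ?g y * indicator T' y \<partial>lborel)"
    proof (rule nn_integral_cmult)
      have "(\<lambda>y. indicator T' y *\<^sub>R (u \<circ> chart_inv c) y) \<in> borel_measurable borel"
        by (intro borel_measurable_continuous_on_indicator T'b continuous_on_subset[OF cu T'2])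
      then have "(\<lambda>y. ennreal (\<bar>indicator T' y *\<^sub>R (u \<circ> chart_inv c) y\<bar> powr p) * indicator T' y) \<in> borel_measurable borel"
        using T'b by measurable
      also have "(\<lambda>y. ennreal (\<bar>indicator T' y *\<^sub>R (u \<circ> chart_inv c) y\<bar> powr p) * indicator T' y) = (\<lambda>y. ?g y * indicator T' y)"
        by (auto simp: fun_eq_iff indicator_def)
      finally show "(\<lambda>y. ?g y * indicator T' y) \<in> borel_measurable lborel" by simp
    qed
    also have "\<dots> \<le> ennreal d1 * (ennreal (tube_const TYPE('n) N p * (N * \<delta>' / R) powr p) * (\<integral>\<^sup>+y. ?g y * indicator (cball z (2 * \<rho>)) y \<partial>lborel))"
    proof (rule mult_left_mono)
      show "(\<integral>\<^sup>+y. ?g y * indicator T' y \<partial>lborel) \<le>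
          ennreal (tube_const TYPE('n) N p * (N * \<delta>' / R) powr p) * (\<integral>\<^sup>+y. ?g y * indicator (cball z (2 * \<rho>)) y \<partial>lborel)"
      proof (rule tube_integral_bound[OF cu gradient_bounded_subset[OF gb s2] R R2(2) RN(2) p T'b])
        show "T' \<subseteq> cball z \<rho>" using T'z by auto
        show "\<exists>w. dist y w \<le> \<delta>' \<and> (u \<circ> chart_inv c) w = 0" if "y \<in> T'" for y
          using that T'z by (intro near) (auto simp: T'_def)
      qed (use \<delta>' \<delta>4 in auto)
    qed simp
    also have "(\<integral>\<^sup>+y. ?g y * indicator (cball z (2 * \<rho>)) y \<partial>lborel) \<le> ennreal (1 / d0) * (\<integral>\<^sup>+x. ?f x \<partial>vol)"
    proof -
      have "(\<integral>\<^sup>+y. ?g y * indicator (cball z (2 * \<rho>)) y \<partial>lborel) \<le>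
          (\<integral>\<^sup>+y. ennreal (1 / d0) * (ennreal (sqrt (det (g c y))) * ?f (chart_inv c y) * indicator (chart_ran c) y) \<partial>lborel)"
      proof (rule nn_integral_mono)
        fix y
        show "?g y * indicator (cball z (2 * \<rho>)) y \<le> ennreal (1 / d0) * (ennreal (sqrt (det (g c y))) * ?f (chart_inv c y) * indicator (chart_ran c) y)"
        proof (cases "y \<in> cball z (2 * \<rho>)")
          case True
          then have y4: "y \<in> cball z (4 * \<rho>)" using s2 by blast
          have "1 \<le> 1 / d0 * sqrt (det (g c y))" using d(2)[OF y4] d(1) by (simp add: field_simps)
          then have "ennreal 1 * ?g y \<le> ennreal (1 / d0 * sqrt (det (g c y))) * ?g y"
            by (intro mult_right_mono ennreal_leI) auto
          moreover have "ennreal (1 / d0 * sqrt (det (g c y))) = ennreal (1 / d0) * ennreal (sqrt (det (g c y)))"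
            using d(2)[OF y4] d(1) by (intro ennreal_mult) (simp, linarith)
          ultimately have "?g y \<le> ennreal (1 / d0) * (ennreal (sqrt (det (g c y))) * ?g y)"
            by (simp only: mult.assoc ennreal_1 mult_1)
          moreover have "y \<in> chart_ran c" using y4 c(3) by blast
          ultimately show ?thesis using True by simp
        qed simp
      qed
      also have "\<dots> = ennreal (1 / d0) * (\<integral>\<^sup>+y. ennreal (sqrt (det (g c y))) * ?f (chart_inv c y) * indicator (chart_ran c) y \<partial>lborel)"
      proof (rule nn_integral_cmult)
        have "(\<lambda>y. ennreal (sqrt (det (g c y))) * ?f (chart_inv c y)) \<in> borel_measurable (restrict_space lborel (chart_ran c))"
          using measurable_chart_inv[OF c(1)] density_measurable[OF c(1)] by measurable
        then show "(\<lambda>y. ennreal (sqrt (det (g c y))) * ?f (chart_inv c y) * indicator (chart_ran c) y) \<in> borel_measurable lborel"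
          using open_ran[OF c(1)] by (subst (asm) borel_measurable_restrict_space_iff_ennreal) auto
      qed
      also have "(\<integral>\<^sup>+y. ennreal (sqrt (det (g c y))) * ?f (chart_inv c y) * indicator (chart_ran c) y \<partial>lborel) = (\<integral>\<^sup>+x. ?f x \<partial>chart_volume M g c)"
        by (intro nn_integral_chart_volume[symmetric] c) measurable
      also have "\<dots> \<le> (\<integral>\<^sup>+x. ?f x \<partial>vol)" by (rule nn_integral_chart_volume_le_vol[OF c(1)])
      finally show ?thesis by (simp add: mult_left_mono)
    qed
    finally have "(\<integral>\<^sup>+x. ?f x * indicator (tube u \<delta> \<inter> W) x \<partial>vol) \<le>
        ennreal d1 * (ennreal (tube_const TYPE('n) N p * (N * \<delta>' / R) powr p) * (ennreal (1 / d0) * (\<integral>\<^sup>+x. ?f x \<partial>vol)))"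
      by (simp add: mult_left_mono)
    also have "\<dots> = ennreal (d1 * (tube_const TYPE('n) N p * (N * \<delta>' / R) powr p) * (1 / d0)) * (\<integral>\<^sup>+x. ?f x \<partial>vol)"
    proof -
      have "0 \<le> tube_const TYPE('n) N p * (N * \<delta>' / R) powr p"
        using mv_const_pos[of N, where 'n = 'n and p = p] RN by (simp add: tube_const_def)
      then have "ennreal (d1 * (tube_const TYPE('n) N p * (N * \<delta>' / R) powr p) * (1 / d0)) =
          ennreal d1 * ennreal (tube_const TYPE('n) N p * (N * \<delta>' / R) powr p) * ennreal (1 / d0)"
        using d1 d(1) by (simp only: ennreal_mult mult_nonneg_nonneg zero_le_divide_1_iff less_imp_le)
      then show ?thesis by (simp only: mult.assoc)
    qed
    also have "\<dots> \<le> ennreal (C * r powr p) * (\<integral>\<^sup>+x. ?f x \<partial>vol)"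
    proof (intro mult_right_mono ennreal_leI)
      have tc: "0 \<le> tube_const TYPE('n) N p"
        using mv_const_pos[of N, where 'n = 'n and p = p] RN by (simp add: tube_const_def)
      have "(N * \<delta>' / R) powr p \<le> (N / (\<kappa> * s) * r) powr p"
        using N\<delta> p RN \<delta>' R by (intro powr_mono2) auto
      also have "\<dots> = (N / (\<kappa> * s)) powr p * r powr p" by (rule powr_mult)
      finally have "d1 * (tube_const TYPE('n) N p * (N * \<delta>' / R) powr p) * (1 / d0)
          \<le> d1 * (tube_const TYPE('n) N p * ((N / (\<kappa> * s)) powr p * r powr p)) * (1 / d0)"
        using d1 d(1) tc by (intro mult_right_mono mult_left_mono) auto
      also have "\<dots> = C1 * r powr p" by (simp add: C1_def)
      also have "\<dots> \<le> C * r powr p" by (intro mult_right_mono) (simp_all add: C_def)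
      finally show "d1 * (tube_const TYPE('n) N p * (N * \<delta>' / R) powr p) * (1 / d0) \<le> C * r powr p" .
    qed simp
    finally show ?int .
  qed
  then have "tube_control lam0 p W r0 C"
    using r0 C unfolding tube_control_def by (intro conjI allI impI) auto
  then show ?thesis using oW xW by blast
qed

lemma tube_bounds:
  assumes lam0: "0 < lam0" and p: "1 \<le> p"
  shows "\<exists>r>0. \<forall>lam u \<delta>. solution lam u \<longrightarrow> lam0 \<le> lam \<longrightarrow> 0 < \<delta> \<longrightarrow> \<delta> \<le> r * lam powr (- 1 / 2) \<longrightarrow>
    power_integral vol p u (tube u \<delta>)
      \<le> ennreal (1 / 2) * (\<integral>\<^sup>+x. ennreal (\<bar>u x\<bar> powr p) \<partial>vol) \<and>
    (\<forall>S. (\<forall>x\<in>M. \<bar>u x\<bar> \<le> S) \<longrightarrow> (\<forall>x\<in>tube u \<delta>. \<bar>u x\<bar> \<le> S / 2))"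
proof -
  have "\<forall>x\<in>M. \<exists>w. openin (top_of_set M) (fst w) \<and> x \<in> fst w \<and> tube_control lam0 p (fst w) (fst (snd w)) (snd (snd w))"
  proof
    fix x assume "x \<in> M"
    from local_tube[OF this lam0 p] obtain W r0 C where "openin (top_of_set M) W" "x \<in> W" "tube_control lam0 p W r0 C"
      by blast
    then show "\<exists>w. openin (top_of_set M) (fst w) \<and> x \<in> fst w \<and> tube_control lam0 p (fst w) (fst (snd w)) (snd (snd w))"
      by (intro exI[of _ "(W, r0, C)"]) simp
  qed
  from bchoice[OF this] obtain w where w: "\<forall>x\<in>M. openin (top_of_set M) (fst (w x)) \<and> x \<in> fst (w x) \<and>
      tube_control lam0 p (fst (w x)) (fst (snd (w x))) (snd (snd (w x)))" by metis
  define W r0 C where "W x = fst (w x)" and "r0 x = fst (snd (w x))" and "C x = snd (snd (w x))" for x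
  have W: "openin (top_of_set M) (W x)" "x \<in> W x" and gd: "tube_control lam0 p (W x) (r0 x) (C x)" if "x \<in> M" for x
    using w that by (auto simp: W_def r0_def C_def)
  obtain X where X: "X \<subseteq> M" "finite X" "M \<subseteq> (\<Union>x\<in>X. W x)" using finite_subcover[of W] W by metis
  have Xne: "X \<noteq> {}" using X M_nonempty by blast
  have Cr: "0 < r0 x" "0 \<le> C x" if "x \<in> X" for x using gd[of x] that X by (auto simp: tube_control_def)
  \<comment> \<open>The sum bounds every single constant, for the pointwise estimate, and absorbs
    the overlaps of the cover in the integral estimate.\<close>
  define CC where "CC = (\<Sum>x\<in>X. C x)"
  have CC: "0 \<le> CC" unfolding CC_def by (intro sum_nonneg Cr)
  have C_le: "C x \<le> CC" if "x \<in> X" for x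
    unfolding CC_def using that X(2) Cr by (intro member_le_sum) auto
  \<comment> \<open>Besides respecting every \<open>r0\<close>, this gives
    \<open>CC * r \<le> 1 / 2\<close>, while \<open>r \<le> 1\<close> allows \<open>r powr p\<close>
    to be replaced by \<open>r\<close>.\<close>
  define r where "r = min (Min (r0 ` X)) (min 1 (1 / (2 * (CC + 1))))"
  have "0 < Min (r0 ` X)" using X Xne Cr by (subst Min_gr_iff) auto
  then have r: "0 < r" using CC by (simp add: r_def)
  have r': "r \<le> 1" "r \<le> 1 / (2 * (CC + 1))" unfolding r_def by linarith+
  have rx: "r \<le> r0 x" if "x \<in> X" for x
  proof -
    have "Min (r0 ` X) \<le> r0 x" using X that by (intro Min_le) auto
    then show ?thesis unfolding r_def by linarith
  qed
  have CCr: "CC * r \<le> 1 / 2"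
  proof -
    have "CC * r \<le> (CC + 1) * (1 / (2 * (CC + 1)))" using r r'(2) CC by (intro mult_mono) auto
    also have "\<dots> = 1 / 2" using CC by (simp add: field_simps)
    finally show ?thesis .
  qed
  have "power_integral vol p u (tube u \<delta>)
      \<le> ennreal (1 / 2) * (\<integral>\<^sup>+x. ennreal (\<bar>u x\<bar> powr p) \<partial>vol)" (is ?int)
    and "\<forall>S. (\<forall>x\<in>M. \<bar>u x\<bar> \<le> S) \<longrightarrow> (\<forall>x\<in>tube u \<delta>. \<bar>u x\<bar> \<le> S / 2)" (is ?sup)
    if sol: "solution lam u" and lam: "lam0 \<le> lam" and \<delta>: "0 < \<delta>" "\<delta> \<le> r * lam powr (- 1 / 2)" for lam u \<delta>
  proof -
    have loc: "power_integral vol p u (tube u \<delta> \<inter> W x)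
        \<le> ennreal (C x * r powr p) * (\<integral>\<^sup>+x. ennreal (\<bar>u x\<bar> powr p) \<partial>vol)"
      "\<And>S y. (\<forall>x\<in>M. \<bar>u x\<bar> \<le> S) \<Longrightarrow> y \<in> tube u \<delta> \<inter> W x \<Longrightarrow> \<bar>u y\<bar> \<le> C x * r * S" if "x \<in> X" for x
      using gd[of x] sol lam r rx[OF that] \<delta> that X(1) unfolding tube_control_def by blast+
    have TM: "tube u \<delta> \<subseteq> M" by (auto simp: tubular_nbhd_def)
    show ?sup
    proof (intro allI impI ballI)
      fix S y assume S: "\<forall>x\<in>M. \<bar>u x\<bar> \<le> S" and y: "y \<in> tube u \<delta>"
      then obtain x where x: "x \<in> X" "y \<in> W x" using X(3) TM by blast
      have S0: "0 \<le> S" using S y TM by force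
      have "\<bar>u y\<bar> \<le> C x * r * S" using loc(2)[OF x(1) S] y x by blast
      also have "\<dots> \<le> CC * r * S" using C_le[OF x(1)] r S0 by (intro mult_right_mono) auto
      also have "\<dots> \<le> 1 / 2 * S" using CCr S0 by (intro mult_right_mono) auto
      finally show "\<bar>u y\<bar> \<le> S / 2" by simp
    qed
    note [measurable] = solution_measurable[OF sol]
    have meas: "tube u \<delta> \<inter> W x \<in> sets MB" if "x \<in> X" for x
      using that X(1) by (intro sets.Int openin_sets_MB tubular_nbhd_open W) auto
    have fm: "(\<lambda>y. ennreal (\<bar>u y\<bar> powr p)) \<in> borel_measurable vol"
      by (simp cong: measurable_cong_sets)
    have "power_integral vol p u (tube u \<delta>)
        \<le> (\<integral>\<^sup>+y. (\<Sum>x\<in>X. ennreal (\<bar>u y\<bar> powr p) * indicator (tube u \<delta> \<inter> W x) y) \<partial>vol)"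
    proof (rule nn_integral_mono)
      fix y
      show "ennreal (\<bar>u y\<bar> powr p) * indicator (tube u \<delta>) y \<le> (\<Sum>x\<in>X. ennreal (\<bar>u y\<bar> powr p) * indicator (tube u \<delta> \<inter> W x) y)"
      proof (cases "y \<in> tube u \<delta>")
        case True
        then obtain x where x: "x \<in> X" "y \<in> W x" using X(3) TM by blast
        have "ennreal (\<bar>u y\<bar> powr p) * indicator (tube u \<delta>) y = ennreal (\<bar>u y\<bar> powr p) * indicator (tube u \<delta> \<inter> W x) y"
          using True x by simp
        also have "\<dots> \<le> (\<Sum>x\<in>X. ennreal (\<bar>u y\<bar> powr p) * indicator (tube u \<delta> \<inter> W x) y)"
          using x(1) X(2) by (intro member_le_sum) auto
        finally show ?thesis .
      qed simp
    qed
    also have "\<dots> = (\<Sum>x\<in>X. power_integral vol p u (tube u \<delta> \<inter> W x))"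
      using meas fm by (intro nn_integral_sum borel_measurable_times_ennreal borel_measurable_indicator) auto
    also have "\<dots> \<le> (\<Sum>x\<in>X. ennreal (C x * r) * (\<integral>\<^sup>+x. ennreal (\<bar>u x\<bar> powr p) \<partial>vol))"
    proof (intro sum_mono order_trans[OF loc(1)] mult_right_mono ennreal_leI mult_left_mono)
      show "r powr p \<le> r" using powr_mono'[of 1 p r] r r' p by simp
    qed (use Cr in auto)
    also have "\<dots> = ennreal (CC * r) * (\<integral>\<^sup>+x. ennreal (\<bar>u x\<bar> powr p) \<partial>vol)"
      using Cr r by (simp add: sum_distrib_right[symmetric] CC_def sum_ennreal)
    also have "\<dots> \<le> ennreal (1 / 2) * (\<integral>\<^sup>+x. ennreal (\<bar>u x\<bar> powr p) \<partial>vol)"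
      using CCr by (intro mult_right_mono ennreal_leI) auto
    finally show ?int .
  qed
  then show ?thesis using r by blast
qed

section \<open>From tubes to norms on the complement\<close>

lemma solution_bounded:
  assumes "solution lam u"
  shows "\<exists>q\<in>M. \<forall>x\<in>M. \<bar>u x\<bar> \<le> \<bar>u q\<bar>"
  using continuous_attains_sup[OF compact_M M_nonempty, of "\<lambda>x. \<bar>u x\<bar>"] assms
  by (auto simp: solution_def intro: continuous_on_rabs)

lemma tube_sets: "tube u \<delta> \<in> sets MB"
  by (intro openin_sets_MB tubular_nbhd_open)

text \<open>The total integral is finite, so it splits into real numbers, and a tube carrying at
  most half of it leaves at least half to the complement.\<close>

lemma Lp_finite_case:
  assumes sol: "solution lam u" and p: "1 \<le> p" "p \<noteq> \<infinity>"
    and half: "(\<integral>\<^sup>+x. ennreal (\<bar>u x\<bar> powr enn2real p) * indicator (tube u \<delta>) x \<partial>vol)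
      \<le> ennreal (1 / 2) * (\<integral>\<^sup>+x. ennreal (\<bar>u x\<bar> powr enn2real p) \<partial>vol)"
  shows "ennreal (1 / 2) * Lp_norm p vol u \<le> Lp_norm p (restrict_space vol (M - tube u \<delta>)) u"
proof -
  let ?f = "\<lambda>x. ennreal (\<bar>u x\<bar> powr enn2real p)"
  note [measurable] = solution_measurable[OF sol]
  have fm: "?f \<in> borel_measurable vol" by (simp cong: measurable_cong_sets)
  have T: "tube u \<delta> \<in> sets vol" by (simp add: tube_sets)
  have MT: "M - tube u \<delta> \<in> sets vol" using sets.compl_sets[OF T] by simp
  obtain q where q: "q \<in> M" "\<And>x. x \<in> M \<Longrightarrow> \<bar>u x\<bar> \<le> \<bar>u q\<bar>" using solution_bounded[OF sol] by blast
  have "(\<integral>\<^sup>+x. ?f x \<partial>vol) \<le> (\<integral>\<^sup>+x. ennreal (\<bar>u q\<bar> powr enn2real p) \<partial>vol)"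
    using q(2) by (intro nn_integral_mono ennreal_leI powr_mono2) auto
  also have "\<dots> = ennreal (\<bar>u q\<bar> powr enn2real p) * emeasure vol M" by simp
  also have "\<dots> < \<infinity>" using vol_finite by (simp add: ennreal_mult_less_top)
  finally have fin: "(\<integral>\<^sup>+x. ?f x \<partial>vol) < \<infinity>" .
  then obtain a where a: "(\<integral>\<^sup>+x. ?f x \<partial>vol) = ennreal a" "0 \<le> a"
    by (cases "\<integral>\<^sup>+x. ?f x \<partial>vol") auto
  have split: "(\<integral>\<^sup>+x. ?f x \<partial>vol) = (\<integral>\<^sup>+x. ?f x * indicator (tube u \<delta>) x \<partial>vol) + (\<integral>\<^sup>+x. ?f x * indicator (M - tube u \<delta>) x \<partial>vol)"
  proof -
    have "(\<integral>\<^sup>+x. ?f x \<partial>vol) = (\<integral>\<^sup>+x. ?f x * indicator (tube u \<delta>) x + ?f x * indicator (M - tube u \<delta>) x \<partial>vol)"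
      by (intro nn_integral_cong) (auto simp: indicator_def)
    also have "\<dots> = (\<integral>\<^sup>+x. ?f x * indicator (tube u \<delta>) x \<partial>vol) + (\<integral>\<^sup>+x. ?f x * indicator (M - tube u \<delta>) x \<partial>vol)"
      by (intro nn_integral_add borel_measurable_times_ennreal borel_measurable_indicator fm T MT)
    finally show ?thesis .
  qed
  obtain b where b: "(\<integral>\<^sup>+x. ?f x * indicator (tube u \<delta>) x \<partial>vol) = ennreal b" "0 \<le> b"
    using split a by (cases "\<integral>\<^sup>+x. ?f x * indicator (tube u \<delta>) x \<partial>vol") auto
  obtain c where c: "(\<integral>\<^sup>+x. ?f x * indicator (M - tube u \<delta>) x \<partial>vol) = ennreal c" "0 \<le> c"
    using split a by (cases "\<integral>\<^sup>+x. ?f x * indicator (M - tube u \<delta>) x \<partial>vol") auto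
  have abc: "a = b + c"
    using split[unfolded a(1) b(1) c(1)] a(2) b(2) c(2) by (simp add: ennreal_plus[symmetric] del: ennreal_plus)
  have m: "ennreal (1 / 2 * a) = ennreal (1 / 2) * ennreal a" by (rule ennreal_mult) (use a in auto)
  have "ennreal b \<le> ennreal (1 / 2 * a)" using half unfolding a(1) b(1) m .
  then have "b \<le> 1 / 2 * a" using a(2) by (subst (asm) ennreal_le_iff) auto
  then have "1 / 2 * a \<le> c" using abc by linarith
  then have "ennreal (1 / 2) * (\<integral>\<^sup>+x. ?f x \<partial>vol) \<le> (\<integral>\<^sup>+x. ?f x * indicator (M - tube u \<delta>) x \<partial>vol)"
    unfolding a(1) c(1) m[symmetric] by (rule ennreal_leI)
  also have "\<dots> = (\<integral>\<^sup>+x. ?f x \<partial>restrict_space vol (M - tube u \<delta>))"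
    by (rule nn_integral_restrict_space[symmetric]) (use MT in \<open>simp add: Int_absorb2\<close>)
  finally show ?thesis using p fin by (intro Lp_norm_half) auto
qed

text \<open>The set where \<open>\<bar>u\<bar>\<close> exceeds half its maximum is open, nonempty
  and disjoint from the tube. As it has positive volume, the essential supremum off the tube is at
  least half the maximum.\<close>

lemma Lp_infinite_case:
  assumes sol: "solution lam u" and nz: "\<exists>x\<in>M. u x \<noteq> 0"
    and half: "\<And>S x. \<forall>x\<in>M. \<bar>u x\<bar> \<le> S \<Longrightarrow> x \<in> tube u \<delta> \<Longrightarrow> \<bar>u x\<bar> \<le> S / 2"
  shows "ennreal (1 / 2) * Lp_norm \<infinity> vol u \<le> Lp_norm \<infinity> (restrict_space vol (M - tube u \<delta>)) u"
proof -
  let ?\<nu> = "restrict_space vol (M - tube u \<delta>)"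
  obtain q where q: "q \<in> M" "\<And>x. x \<in> M \<Longrightarrow> \<bar>u x\<bar> \<le> \<bar>u q\<bar>" using solution_bounded[OF sol] by blast
  define S where "S = \<bar>u q\<bar>"
  have S: "0 < S" using nz q unfolding S_def by force
  note [measurable] = solution_measurable[OF sol]
  have fm: "(\<lambda>x. ennreal \<bar>u x\<bar>) \<in> borel_measurable vol" by (simp cong: measurable_cong_sets)
  have T: "tube u \<delta> \<in> sets vol" by (simp add: tube_sets)
  have MT: "M - tube u \<delta> \<in> sets vol" using sets.compl_sets[OF T] by simp
  have "esssup vol (\<lambda>x. ennreal \<bar>u x\<bar>) \<le> ennreal S"
    using q(2) by (intro esssup_I fm AE_I2 ennreal_leI) (simp add: S_def)
  then have "ennreal (1 / 2) * esssup vol (\<lambda>x. ennreal \<bar>u x\<bar>) \<le> ennreal (1 / 2) * ennreal S"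
    by (rule mult_left_mono) simp
  also have "\<dots> = ennreal (S / 2)" using S by (subst ennreal_mult[symmetric]) auto
  also have "\<dots> \<le> esssup ?\<nu> (\<lambda>x. ennreal \<bar>u x\<bar>)"
  proof (rule ccontr)
    assume "\<not> ?thesis"
    then have lt: "esssup ?\<nu> (\<lambda>x. ennreal \<bar>u x\<bar>) < ennreal (S / 2)" by simp
    have "AE x in ?\<nu>. ennreal \<bar>u x\<bar> \<le> esssup ?\<nu> (\<lambda>x. ennreal \<bar>u x\<bar>)" by (rule esssup_AE)
    then have ae: "AE x in vol. x \<in> M - tube u \<delta> \<longrightarrow> ennreal \<bar>u x\<bar> \<le> esssup ?\<nu> (\<lambda>x. ennreal \<bar>u x\<bar>)"
      using MT by (subst (asm) AE_restrict_space_iff) (auto simp: Int_absorb2)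
    define V where "V = {x\<in>M. S / 2 < \<bar>u x\<bar>}"
    have "openin (top_of_set M) (M \<inter> (\<lambda>x. \<bar>u x\<bar>) -` {S / 2<..})"
      using sol by (intro continuous_openin_preimage_gen continuous_on_rabs) (auto simp: solution_def)
    moreover have "M \<inter> (\<lambda>x. \<bar>u x\<bar>) -` {S / 2<..} = V" by (auto simp: V_def)
    ultimately have oV: "openin (top_of_set M) V" by simp
    have qV: "q \<in> V" using q(1) S by (simp add: V_def S_def)
    have "AE x in vol. x \<notin> V"
      using ae
    proof eventually_elim
      case (elim x)
      show ?case
      proof
        assume x: "x \<in> V"
        then have "x \<notin> tube u \<delta>" using half[of S x] q(2) by (auto simp: V_def S_def)
        then have "ennreal \<bar>u x\<bar> < ennreal (S / 2)" using elim x lt by (auto simp: V_def)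
        then show False using x by (simp add: V_def ennreal_less_iff)
      qed
    qed
    then have "emeasure vol V = 0"
      using AE_iff_null_sets[of V vol] openin_sets_MB[OF oV] by auto
    then show False using vol_open_pos[OF oV qV] by simp
  qed
  finally show ?thesis by (simp add: Lp_norm_def)
qed

end

theorem theorem2p3:
  fixes M :: "'m::t2_space set"
    and A :: "('m, 'n::finite) chart set"
    and g :: "('m, 'n) metric_coeffs"
    and p :: ennreal
  assumes "closed_riemannian_manifold M A g"
    and "1 \<le> p"
  shows "\<exists>r>0. \<exists>c>0. \<forall>lam>0. \<forall>u \<delta>.
           eigenfunction M A g lam u \<longrightarrow> 0 < \<delta> \<longrightarrow> \<delta> \<le> r * lam powr (- 1 / 2) \<longrightarrow>
           Lp_norm p (restrict_space (riemannian_volume M A g)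
                        (M - tubular_nbhd M A g (nodal_set M u) \<delta>)) u
             \<ge> ennreal c * Lp_norm p (riemannian_volume M A g) u"
proof -
  interpret closed_manifold M A g by unfold_locales (rule assms(1))
  obtain lam0 where lam0: "0 < lam0" "\<And>lam u. 0 < lam \<Longrightarrow> eigenfunction M A g lam u \<Longrightarrow> lam0 \<le> lam"
    using spectral_gap by blast
  \<comment> \<open>For an infinite exponent the value 1 is a placeholder: in that case only the
    pointwise half of \<open>tube_bounds\<close> is used, which does not involve the
    exponent.\<close>
  define q where "q = (if p = \<infinity> then 1 else enn2real p)"
  have q: "1 \<le> q"
  proof (cases p)
    case (real r)
    then show ?thesis using assms(2) by (simp add: q_def)
  qed (simp add: q_def)
  obtain r where r: "0 < r" and bound: "\<And>lam u \<delta>. solution lam u \<Longrightarrow> lam0 \<le> lam \<Longrightarrow> 0 < \<delta> \<Longrightarrow> \<delta> \<le> r * lam powr (- 1 / 2) \<Longrightarrow>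
    (\<integral>\<^sup>+x. ennreal (\<bar>u x\<bar> powr q) * indicator (tube u \<delta>) x \<partial>vol)
      \<le> ennreal (1 / 2) * (\<integral>\<^sup>+x. ennreal (\<bar>u x\<bar> powr q) \<partial>vol) \<and>
    (\<forall>S. (\<forall>x\<in>M. \<bar>u x\<bar> \<le> S) \<longrightarrow> (\<forall>x\<in>tube u \<delta>. \<bar>u x\<bar> \<le> S / 2))"
    using tube_bounds[OF lam0(1) q] by blast
  have "ennreal (1 / 2) * Lp_norm p vol u \<le> Lp_norm p (restrict_space vol (M - tube u \<delta>)) u"
    if lam: "0 < lam" and eig: "eigenfunction M A g lam u" and \<delta>: "0 < \<delta>" "\<delta> \<le> r * lam powr (- 1 / 2)" for lam u \<delta>
  proof -
    have sol: "solution lam u" by (rule eigenfunction_solution[OF eig])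
    note b = bound[OF sol lam0(2)[OF lam eig] \<delta>]
    show ?thesis
    proof (cases "p = \<infinity>")
      case True
      have "\<exists>x\<in>M. u x \<noteq> 0" using eig by (simp add: eigenfunction_def)
      then show ?thesis unfolding True using b by (intro Lp_infinite_case[OF sol]) blast+
    next
      case False
      then show ?thesis using b by (intro Lp_finite_case[OF sol assms(2) False]) (simp add: q_def)
    qed
  qed
  then show ?thesis using r by (intro exI[of _ r] conjI exI[of _ "1 / 2"] allI impI) auto
qed

end
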